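(* Let $n\ge 1$, let $s\le n+3$, and let $X^{n,n+1}_s$ be the blow-up of $\mathbb{P}^n\times\mathbb{P}^{n+1}$ in $s$ points $p_1,\dots,p_s$ in general position. Let $D=d_1H_1+d_2H_2-\sum_{i=1}^s m_iE_i$ be an effective divisor class on $X^{n,n+1}_s$. (a) Let $2\le k\le n+1$ and let $p_{i_1},\dots,p_{i_k}$ be $k$ distinct points among the $s$ blown-up points. Then $D$ contains the strict transform of the bilinear span $\operatorname{BL}(p_{i_1},\dots,p_{i_k})$ in its base locus at least $$\max\{0,\,m_{i_1}+\cdots+m_{i_k}-(k-1)(d_1+d_2)\}$$ times. (b) Moreover, if $n+1\le s\le n+2$ and $i_1,\dots,i_{n+1}\in\{1,\dots,s\}$ are distinct, then the multiplicity of containment of $F_2:=H_2-\sum_{j=1}^{n+1}E_{i_j}$ in the base locus of $D$ is exactly $$\max\{0,\,m_{i_1}+\cdots+m_{i_{n+1}}-n(d_1+d_2)\}.$$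
   Context: We work over an algebraically closed field of characteristic zero. $H_1,H_2$ are the pullbacks of the hyperplane classes of the two factors and $E_i$ is the exceptional divisor over $p_i$. For points $z_1,\dots,z_k\in\mathbb{P}^n\times\mathbb{P}^{n+1}$ whose projections to each factor are linearly independent, the bilinear span is $\operatorname{BL}(z_1,\dots,z_k)=L^1\times L^2$, where $L^j$ is the linear span of the projections of the points to the $j$-th factor. $F_2$ is identified with its unique effective representative, namely the strict transform of $\operatorname{BL}(p_{i_1},\dots,p_{i_{n+1}})$. The statement that $D$ contains $V$ in its base locus at least $m$ times means that every effective divisor in $|D|$ has multiplicity at least $m$ along $V$; the (exact) multiplicity of containment is the minimum, over effective divisors in $|D|$, of the multiplicity along $V$. *)

theory Defs
  imports
    "HOL-Computational_Algebra.Computational_Algebra"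
    "HOL-Library.Poly_Mapping"
    "HOL-Library.Extended_Nat"
begin

section \<open>Bihomogeneous polynomials and the product of two projective spaces\<close>

text \<open>
  Bihomogeneous coordinates on the product of a projective \<open>n\<close>-space and a projective
  \<open>(n+1)\<close>-space: the variables with indices \<open>0, ..., n\<close> are the coordinates of the first factor,
  those with indices \<open>n+1, ..., 2n+2\<close> the coordinates of the second one.  A point is given by a
  coordinate vector \<open>z :: nat \<Rightarrow> 'a\<close>; a set of points is given by the set of all coordinate
  vectors of its elements.
\<close>

type_synonym 'a mpol = "(nat \<Rightarrow>\<^sub>0 nat) \<Rightarrow>\<^sub>0 'a"
type_synonym 'a ratfun = "'a mpol fract"

definition block1 :: "nat \<Rightarrow> nat set" where "block1 n = {0..n}"
definition block2 :: "nat \<Rightarrow> nat set" where "block2 n = {n+1..2*n+2}"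

definition pvar :: "nat \<Rightarrow> 'a::field mpol" where
  "pvar i = Poly_Mapping.single (Poly_Mapping.single i 1) 1"

definition peval :: "'a::field mpol \<Rightarrow> (nat \<Rightarrow> 'a) \<Rightarrow> 'a" where
  "peval P z = (\<Sum>e\<in>Poly_Mapping.keys P. Poly_Mapping.lookup P e *
                 (\<Prod>i\<in>Poly_Mapping.keys e. z i ^ Poly_Mapping.lookup e i))"

definition bihom :: "nat \<Rightarrow> nat \<Rightarrow> nat \<Rightarrow> 'a::field mpol \<Rightarrow> bool" where
  "bihom n a b P \<longleftrightarrow> (\<forall>e\<in>Poly_Mapping.keys P.
      Poly_Mapping.keys e \<subseteq> block1 n \<union> block2 n \<and>
      (\<Sum>i\<in>block1 n. Poly_Mapping.lookup e i) = a \<and>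
      (\<Sum>j\<in>block2 n. Poly_Mapping.lookup e j) = b)"

definition biproj :: "nat \<Rightarrow> (nat \<Rightarrow> 'a::field) set" where
  "biproj n = {z. (\<exists>i\<in>block1 n. z i \<noteq> 0) \<and> (\<exists>j\<in>block2 n. z j \<noteq> 0) \<and> (\<forall>i>2*n+2. z i = 0)}"

definition point_class :: "nat \<Rightarrow> (nat \<Rightarrow> 'a::field) \<Rightarrow> (nat \<Rightarrow> 'a) set" where
  "point_class n z = {\<lambda>i. if i \<in> block1 n then a * z i else b * z i | a b. a \<noteq> 0 \<and> b \<noteq> 0}"

definition zariski_closed :: "nat \<Rightarrow> (nat \<Rightarrow> 'a::field) set \<Rightarrow> bool" where
  "zariski_closed n V \<longleftrightarrow> (\<exists>S. (\<forall>P\<in>S. \<exists>a b. bihom n a b P) \<and>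
      V = {z \<in> biproj n. \<forall>P\<in>S. peval P z = 0})"

definition irreducible_closed :: "nat \<Rightarrow> (nat \<Rightarrow> 'a::field) set \<Rightarrow> bool" where
  "irreducible_closed n V \<longleftrightarrow> zariski_closed n V \<and> V \<noteq> {} \<and>
     (\<forall>V1 V2. zariski_closed n V1 \<and> zariski_closed n V2 \<and> V \<subseteq> V1 \<union> V2 \<longrightarrow> V \<subseteq> V1 \<or> V \<subseteq> V2)"

definition function_field :: "nat \<Rightarrow> 'a::field ratfun set" where
  "function_field n = {Fract A B | A B a b. bihom n a b A \<and> bihom n a b B \<and> B \<noteq> 0}"

text \<open>
  The local ring of the product at the generic point of an irreducible closed set \<open>V\<close>;
  for \<open>V = point_class n z\<close> this is the local ring at a closed point.
\<close>
definition local_ring :: "nat \<Rightarrow> (nat \<Rightarrow> 'a::field) set \<Rightarrow> 'a ratfun set" where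
  "local_ring n V = {Fract A B | A B a b. bihom n a b A \<and> bihom n a b B \<and> (\<exists>z\<in>V. peval B z \<noteq> 0)}"


section \<open>Subrings of a field\<close>

definition unit_set :: "'k::field set \<Rightarrow> 'k set" where
  "unit_set R = {u \<in> R. u \<noteq> 0 \<and> inverse u \<in> R}"

text \<open>For a local ring this is its maximal ideal.\<close>
definition nonunits :: "'k::field set \<Rightarrow> 'k set" where
  "nonunits R = R - unit_set R"

fun ideal_power :: "'k::field set \<Rightarrow> 'k set \<Rightarrow> nat \<Rightarrow> 'k set" where
  "ideal_power R I 0 = R"
| "ideal_power R I (Suc k) = group_closure {a * b | a b. a \<in> I \<and> b \<in> ideal_power R I k}"

definition prime_ideal_of :: "'k::field set \<Rightarrow> 'k set \<Rightarrow> bool" where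
  "prime_ideal_of A Q \<longleftrightarrow> Q \<subseteq> A \<and> 0 \<in> Q \<and> 1 \<notin> Q \<and>
     (\<forall>a\<in>Q. \<forall>b\<in>Q. a - b \<in> Q) \<and> (\<forall>a\<in>A. \<forall>b\<in>Q. a * b \<in> Q) \<and>
     (\<forall>a\<in>A. \<forall>b\<in>A. a * b \<in> Q \<longrightarrow> a \<in> Q \<or> b \<in> Q)"

definition localize :: "'k::field set \<Rightarrow> 'k set \<Rightarrow> 'k set" where
  "localize A Q = {a / b | a b. a \<in> A \<and> b \<in> A - Q}"

text \<open>The affine blow-up algebra \<open>R[I/t]\<close>, i.e. the ring of the chart \<open>D\<^sub>+(t)\<close> of \<open>Proj\<close> of the
  Rees algebra of \<open>I\<close>.\<close>
definition affine_blowup :: "'k::field set \<Rightarrow> 'k set \<Rightarrow> 'k \<Rightarrow> 'k set" where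
  "affine_blowup R I t = {a / t ^ k | a k. a \<in> ideal_power R I k}"


section \<open>The blow-up\<close>

definition point_ideal :: "nat \<Rightarrow> (nat \<Rightarrow> 'a::field) \<Rightarrow> 'a ratfun set" where
  "point_ideal n z = nonunits (local_ring n (point_class n z))"

text \<open>
  The blow-up is a separated integral scheme with the same function field as the product, so it is
  determined by the set of its local rings, viewed as subrings of the function field; we identify
  a (not necessarily closed) scheme point with its local ring.  Away from the blown-up points
  these are the local rings of the product; the points over a blown-up point \<open>z\<close> are the primes of
  the affine blow-up algebras of the maximal ideal at \<open>z\<close> that contain this maximal ideal
  (equivalently, that contain \<open>t\<close>).
\<close>
definition blowup :: "nat \<Rightarrow> nat \<Rightarrow> (nat \<Rightarrow> nat \<Rightarrow> 'a::field) \<Rightarrow> 'a ratfun set set" where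
  "blowup n s p =
     {local_ring n V | V. irreducible_closed n V \<and> (\<forall>i\<in>{1..s}. V \<noteq> point_class n (p i))} \<union>
     (\<Union>i\<in>{1..s}. {localize A Q | A Q t. t \<in> point_ideal n (p i) \<and> t \<noteq> 0 \<and>
         A = affine_blowup (local_ring n (point_class n (p i))) (point_ideal n (p i)) t \<and>
         prime_ideal_of A Q \<and> t \<in> Q})"

text \<open>
  The blow-down map is an isomorphism over the complement of the blown-up points.  Hence, for an
  irreducible closed set \<open>V\<close> different from the blown-up points, the generic point of the strict
  transform of \<open>V\<close> has the same local ring as the generic point of \<open>V\<close>.
\<close>
definition strict_transform_pt :: "nat \<Rightarrow> (nat \<Rightarrow> 'a::field) set \<Rightarrow> 'a ratfun set" where
  "strict_transform_pt n V = local_ring n V"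


section \<open>Divisors and linear systems\<close>

text \<open>
  A (Cartier) divisor assigns to each point \<open>R\<close> of the blow-up its set of local equations at \<open>R\<close>,
  which is a coset of the unit group of \<open>R\<close> in the multiplicative group of the function field.
  Only divisors that differ by a principal divisor from an integral combination of the pullbacks
  \<open>H1\<close>, \<open>H2\<close> of hyperplanes and of the exceptional divisors are used below; these are
  locally principal, so that this condition need not be imposed.
\<close>
type_synonym 'a divisor = "'a ratfun set \<Rightarrow> 'a ratfun set"

text \<open>
  The pullback of the hyperplane given by the vanishing of the coordinate \<open>i0\<close> in the factor with
  coordinates indexed by \<open>J\<close>.  The condition that all quotients of coordinates by the \<open>i\<close>-th one
  are regular at \<open>R\<close> says that \<open>R\<close> lies over the chart where the \<open>i\<close>-th coordinate does not vanish.
\<close>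
definition hyperplane_div :: "nat set \<Rightarrow> nat \<Rightarrow> 'a::field divisor" where
  "hyperplane_div J i0 R = {Fract (pvar i0) (pvar i) * u | i u.
      i \<in> J \<and> (\<forall>k\<in>J. Fract (pvar k) (pvar i) \<in> R) \<and> u \<in> unit_set R}"

definition H1 :: "nat \<Rightarrow> 'a::field divisor" where "H1 n = hyperplane_div (block1 n) 0"
definition H2 :: "nat \<Rightarrow> 'a::field divisor" where "H2 n = hyperplane_div (block2 n) (n+1)"

text \<open>
  The exceptional divisor over \<open>z\<close>: its ideal sheaf is the inverse image ideal sheaf of the ideal of
  \<open>z\<close>.  A point \<open>R\<close> of the blow-up lies over \<open>z\<close> iff the maximal ideal of \<open>R\<close> contains the one
  of \<open>z\<close>.
\<close>
definition exceptional_div :: "nat \<Rightarrow> (nat \<Rightarrow> 'a::field) \<Rightarrow> 'a divisor" where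
  "exceptional_div n z R =
     (if point_ideal n z \<subseteq> nonunits R
      then {t * u | t u. t \<in> point_ideal n z \<and> u \<in> unit_set R \<and>
              (\<forall>a\<in>point_ideal n z. \<exists>r\<in>R. a = t * r)}
      else unit_set R)"

definition blowup_div ::
  "nat \<Rightarrow> nat \<Rightarrow> (nat \<Rightarrow> nat \<Rightarrow> 'a::field) \<Rightarrow> int \<Rightarrow> int \<Rightarrow> (nat \<Rightarrow> int) \<Rightarrow> 'a divisor" where
  "blowup_div n s p d1 d2 m R =
     {h1 powi d1 * h2 powi d2 * (\<Prod>i\<in>{1..s}. e i powi (- m i)) * u | h1 h2 e u.
        h1 \<in> H1 n R \<and> h2 \<in> H2 n R \<and> (\<forall>i\<in>{1..s}. e i \<in> exceptional_div n (p i) R) \<and>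
        u \<in> unit_set R}"

definition add_principal :: "'a::field divisor \<Rightarrow> 'a ratfun \<Rightarrow> 'a divisor" where
  "add_principal D f = (\<lambda>R. {g * f | g. g \<in> D R})"

definition effective_on :: "'a::field ratfun set set \<Rightarrow> 'a divisor \<Rightarrow> bool" where
  "effective_on X D \<longleftrightarrow> (\<forall>R\<in>X. D R \<subseteq> R)"

text \<open>The complete linear system: all effective divisors \<open>D + div f\<close>.\<close>
definition linear_system ::
  "nat \<Rightarrow> nat \<Rightarrow> (nat \<Rightarrow> nat \<Rightarrow> 'a::field) \<Rightarrow> 'a divisor \<Rightarrow> 'a divisor set" where
  "linear_system n s p D =
     {add_principal D f | f. f \<in> function_field n \<and> f \<noteq> 0 \<and>
        effective_on (blowup n s p) (add_principal D f)}"

text \<open>The multiplicity of an effective divisor at a scheme point; at the generic point of an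
  irreducible closed subset it is the multiplicity along that subset.\<close>
definition div_mult :: "'a::field ratfun set \<Rightarrow> 'a divisor \<Rightarrow> enat" where
  "div_mult R D = Sup {enat k | k. D R \<subseteq> ideal_power R (nonunits R) k}"

definition base_mult ::
  "nat \<Rightarrow> nat \<Rightarrow> (nat \<Rightarrow> nat \<Rightarrow> 'a::field) \<Rightarrow> 'a divisor \<Rightarrow> 'a ratfun set \<Rightarrow> enat" where
  "base_mult n s p D R = (INF D'\<in>linear_system n s p D. div_mult R D')"


section \<open>General position and bilinear spans\<close>

definition independent_in ::
  "nat set \<Rightarrow> (nat \<Rightarrow> nat \<Rightarrow> 'a::field) \<Rightarrow> nat set \<Rightarrow> bool" where
  "independent_in J p I \<longleftrightarrow>
     (\<forall>c. (\<forall>j\<in>J. (\<Sum>i\<in>I. c i * p i j) = 0) \<longrightarrow> (\<forall>i\<in>I. c i = 0))"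

text \<open>
  General position means that the projections to each of the two factors are in linearly general
  position.  Over an infinite field this is a nonempty Zariski open condition on
  \<open>(p 1, ..., p s)\<close>; for \<open>n \<ge> 1\<close> it implies that the points are distinct.
\<close>
definition general_position :: "nat \<Rightarrow> nat \<Rightarrow> (nat \<Rightarrow> nat \<Rightarrow> 'a::field) \<Rightarrow> bool" where
  "general_position n s p \<longleftrightarrow> (\<forall>i\<in>{1..s}. p i \<in> biproj n) \<and>
     (\<forall>I\<subseteq>{1..s}. (card I \<le> n + 1 \<longrightarrow> independent_in (block1 n) p I) \<and>
                  (card I \<le> n + 2 \<longrightarrow> independent_in (block2 n) p I))"

definition bilinear_span ::
  "nat \<Rightarrow> (nat \<Rightarrow> nat \<Rightarrow> 'a::field) \<Rightarrow> nat set \<Rightarrow> (nat \<Rightarrow> 'a) set" where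
  "bilinear_span n p I = {z \<in> biproj n.
     (\<exists>c. \<forall>j\<in>block1 n. z j = (\<Sum>i\<in>I. c i * p i j)) \<and>
     (\<exists>c. \<forall>j\<in>block2 n. z j = (\<Sum>i\<in>I. c i * p i j))}"

end

theory Submission
  imports Defs
begin

text \<open>
  Multiplying a rational function \<open>f\<close> for which \<open>D + div f\<close> is effective by \<open>x\<^sub>0\<^bsup>d1\<^esup> y\<^sub>0\<^bsup>d2\<^esup>\<close>
  gives a bihomogeneous polynomial \<open>F\<close> of bidegree \<open>(d1, d2)\<close> that vanishes to order at least \<open>m i\<close>
  at each \<open>p i\<close> (\<open>section_polynomial\<close>, \<open>section_multiplicity\<close>), and every such polynomial gives an
  effective divisor (\<open>effective_if_multiplicities\<close>). Both parts are then statements about the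
  monomials of such polynomials.

  Choose coordinates in which the \<open>p i\<close> with \<open>i \<in> I\<close> are coordinate points of both factors
  (\<open>adapted_coordinates\<close>). Let \<open>e i\<close> be the total exponent in a monomial of the two coordinates that do not
  vanish at \<open>p i\<close>. Vanishing to order \<open>m i\<close> at a coordinate point is a condition on each monomial
  separately: \<open>e i + m i \<le> d1 + d2\<close> (\<open>monomial_bound\<close>). The coordinates that belong to no \<open>i \<in> I\<close>
  generate the ideal of the bilinear span, and their total exponent is
  \<open>d1 + d2 - (\<Sum>i\<in>I. e i) \<ge> (\<Sum>i\<in>I. m i) - (k - 1) (d1 + d2)\<close>. This proves (a)
  (\<open>rest_exponent_bound\<close>, \<open>span_ideal_power\<close>).

  In (b) only one coordinate \<open>y\<^sub>N\<close> is left over; the span is the divisor \<open>y\<^sub>N = 0\<close>, and the multiplicity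
  along it is the least exponent of \<open>y\<^sub>N\<close> in a monomial of \<open>F\<close>. As long as this exponent exceeds the
  bound of (a), it can be lowered: the degrees leave slack in the condition at some \<open>p i\<close>, and an
  operator of the form \<open>(y\<^sub>i / y\<^sub>N) (x\<^sub>i \<partial>/\<partial>x\<^sub>i - g)\<close> exchanges one \<open>y\<^sub>N\<close> for \<open>y\<^sub>i\<close>. The constant \<open>g\<close> is
  chosen to kill the monomials in which the condition at \<open>p i\<close> is already sharp. If there is one
  more point, it has \<open>y\<^sub>i = 0\<close> and \<open>y\<^sub>N \<noteq> 0\<close>, so the factor \<open>y\<^sub>i\<close> restores there the order that the
  derivative may lose (\<open>lower_last_exponent_step\<close>).

  That \<open>F\<close> is a polynomial follows from regularity at the closed points other than the \<open>p i\<close> alone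
  (\<open>regular_imp_dvd\<close>): on a generic line, which avoids the \<open>p i\<close>, the denominator divides the
  numerator because the quotient has no poles; hence division with remainder by the denominator
  along a generic direction leaves no remainder. The order of \<open>F\<close> at \<open>p i\<close> is read off at the generic
  point of the exceptional divisor, whose local ring is contained in the valuation ring of the order
  of vanishing (\<open>generic_exceptional_point\<close>).
\<close>

section \<open>The polynomial ring\<close>

abbreviation (input) lookup where "lookup \<equiv> Poly_Mapping.lookup"
abbreviation (input) keys where "keys \<equiv> Poly_Mapping.keys"
abbreviation (input) single where "single \<equiv> Poly_Mapping.single"

definition mconst :: "'a::field \<Rightarrow> 'a mpol" where "mconst c = single 0 c"

lemma mconst_0 [simp]: "mconst 0 = 0" by (simp add: mconst_def)
lemma mconst_1 [simp]: "mconst 1 = 1" by (simp add: mconst_def)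
lemma mconst_add: "mconst (a + b) = mconst a + mconst b" by (simp add: mconst_def single_add)
lemma mconst_mult: "mconst (a * b) = mconst a * mconst b" by (simp add: mconst_def mult_single)
lemma mconst_eq_0 [simp]: "mconst a = 0 \<longleftrightarrow> a = 0"
  by (metis mconst_def lookup_single_eq lookup_zero single_zero)

lemma pvar_neq_0 [simp]: "pvar i \<noteq> (0 :: 'a::field mpol)"
  by (metis pvar_def lookup_single_eq lookup_zero zero_neq_one)

definition monom_of :: "(nat \<Rightarrow>\<^sub>0 nat) \<Rightarrow> 'a::field mpol" where
  "monom_of e = single e 1"

lemma monom_of_0 [simp]: "monom_of 0 = 1" by (simp add: monom_of_def)
lemma monom_of_add: "monom_of (e + e') = monom_of e * monom_of e'"
  by (simp add: monom_of_def mult_single)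
lemma single_conv_monom: "single e c = mconst c * monom_of e"
  by (simp add: monom_of_def mconst_def mult_single)

lemma pvar_power: "pvar i ^ k = monom_of (single i k)"
  by (induction k) (simp_all add: monom_of_def pvar_def mult_single flip: single_add)

lemma poly_mapping_expand: "F = (\<Sum>e\<in>keys F. single e (lookup F e))"
proof (rule poly_mapping_eqI)
  fix k
  have "(\<Sum>x\<in>keys F. lookup (single x (lookup F x)) k) = (\<Sum>x\<in>keys F. if x = k then lookup F x else 0)"
    by (intro sum.cong) (auto simp: lookup_single)
  then show "lookup F k = lookup (\<Sum>e\<in>keys F. single e (lookup F e)) k"
    by (auto simp: lookup_sum in_keys_iff)
qed

lemma monom_of_sum: "finite A \<Longrightarrow> monom_of (sum f A) = (\<Prod>i\<in>A. monom_of (f i))"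
  by (induction A rule: finite_induct) (simp_all add: monom_of_add)

lemma monom_of_expand: "monom_of e = (\<Prod>i\<in>keys e. pvar i ^ lookup e i)"
  by (subst poly_mapping_expand [of e]) (simp add: monom_of_sum pvar_power)

lemma mpol_expand: "F = (\<Sum>e\<in>keys F. mconst (lookup F e) * (\<Prod>i\<in>keys e. pvar i ^ lookup e i))"
  by (subst poly_mapping_expand [of F]) (simp add: single_conv_monom monom_of_expand)

lemma mpol_induct [case_names const var add mult]:
  fixes F :: "'a::field mpol"
  assumes "\<And>c. P (mconst c)" "\<And>i. P (pvar i)"
    "\<And>F G. P F \<Longrightarrow> P G \<Longrightarrow> P (F + G)" "\<And>F G. P F \<Longrightarrow> P G \<Longrightarrow> P (F * G)"
  shows "P F"
proof -
  have 1: "P 1" and 0: "P 0" using assms(1)[of 1] assms(1)[of 0] by auto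
  have pow: "P (G ^ k)" if "P G" for G k
    by (induction k) (auto simp: 1 that intro: assms(4))
  have prd: "P (\<Prod>i\<in>A. f i)" if "finite A" "\<And>i. i \<in> A \<Longrightarrow> P (f i)" for A and f :: "nat \<Rightarrow> 'a mpol"
    using that by (induction A rule: finite_induct) (auto simp: 1 intro: assms(4))
  have sm: "P (\<Sum>i\<in>A. f i)" if "finite A" "\<And>i. i \<in> A \<Longrightarrow> P (f i)"
    for A and f :: "(nat \<Rightarrow>\<^sub>0 nat) \<Rightarrow> 'a mpol"
    using that by (induction A rule: finite_induct) (auto simp: 0 intro: assms(3))
  show ?thesis
    by (subst mpol_expand) (auto intro!: sm prd assms(4) assms(1) pow assms(2))
qed

section \<open>Substitution\<close>

text \<open>
  Ring homomorphisms as plain functions, so that substitutions, evaluations and coefficientwise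
  maps can be composed and compared on generators.
\<close>
definition rhom :: "('r::comm_ring_1 \<Rightarrow> 's::comm_ring_1) \<Rightarrow> bool" where
  "rhom h \<longleftrightarrow> h 1 = 1 \<and> (\<forall>a b. h (a + b) = h a + h b) \<and> (\<forall>a b. h (a * b) = h a * h b)"

lemma rhomI: "h 1 = 1 \<Longrightarrow> (\<And>a b. h (a + b) = h a + h b) \<Longrightarrow> (\<And>a b. h (a * b) = h a * h b) \<Longrightarrow> rhom h"
  by (simp add: rhom_def)

lemma rhom_1: "rhom h \<Longrightarrow> h 1 = 1" and rhom_add: "rhom h \<Longrightarrow> h (a + b) = h a + h b"
  and rhom_mult: "rhom h \<Longrightarrow> h (a * b) = h a * h b"
  by (simp_all add: rhom_def)
lemma rhom_0: "rhom h \<Longrightarrow> h 0 = 0"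
  using rhom_add [of h 0 0] by simp
lemma rhom_power: "rhom h \<Longrightarrow> h (a ^ n) = h a ^ n"
  by (induction n) (simp_all add: rhom_1 rhom_mult)
lemma rhom_uminus: "rhom h \<Longrightarrow> h (- a) = - h a"
  using rhom_add [of h a "- a"] by (simp add: rhom_0 eq_neg_iff_add_eq_0 add.commute)
lemma rhom_diff: "rhom h \<Longrightarrow> h (a - b) = h a - h b"
  using rhom_add [of h a "- b"] by (simp add: rhom_uminus)
lemma rhom_sum: "rhom h \<Longrightarrow> h (sum f A) = (\<Sum>x\<in>A. h (f x))"
  by (induction A rule: infinite_finite_induct) (simp_all add: rhom_0 rhom_add)
lemma rhom_prod: "rhom h \<Longrightarrow> h (prod f A) = (\<Prod>x\<in>A. h (f x))"
  by (induction A rule: infinite_finite_induct) (simp_all add: rhom_1 rhom_mult)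
lemma rhom_comp: "rhom g \<Longrightarrow> rhom h \<Longrightarrow> rhom (\<lambda>x. g (h x))"
  by (simp add: rhom_def)
lemmas rhom_simps = rhom_0 rhom_1 rhom_add rhom_mult rhom_power rhom_uminus rhom_diff rhom_sum rhom_prod

lemma rhom_id: "rhom (\<lambda>x. x)" by (simp add: rhom_def)
lemma rhom_mconst: "rhom mconst" by (simp add: rhom_def mconst_add mconst_mult)
lemma rhom_pCons0: "rhom (\<lambda>c. [:c:])" by (simp add: rhom_def one_pCons)
lemma rhom_poly: "rhom (\<lambda>p. poly p a)" by (simp add: rhom_def)
lemma rhom_to_fract: "rhom to_fract" by (simp add: rhom_def)

lemma rhom_map_poly:
  assumes "rhom h" shows "rhom (map_poly h)"
proof (rule rhomI)
  show "map_poly h 1 = 1" by (simp add: map_poly_1 rhom_simps [OF assms])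
  show "map_poly h (a + b) = map_poly h a + map_poly h b" for a b
    by (rule poly_eqI) (simp add: coeff_map_poly rhom_simps [OF assms])
  show "map_poly h (a * b) = map_poly h a * map_poly h b" for a b
    by (rule poly_eqI) (simp add: coeff_map_poly rhom_simps [OF assms] coeff_mult)
qed

text \<open>
  The universal property of the polynomial ring. Nearly all identities between substitutions below
  are proved by it.
\<close>
lemma mpol_hom_eq:
  fixes g h :: "'a::field mpol \<Rightarrow> 'b::comm_ring_1"
  assumes "rhom g" "rhom h" "\<And>c. g (mconst c) = h (mconst c)" "\<And>i. g (pvar i) = h (pvar i)"
  shows "g F = h F"
  by (induction F rule: mpol_induct) (simp_all add: assms(3,4) rhom_simps [OF assms(1)] rhom_simps [OF assms(2)])

text \<open>
  Substitution of \<open>\<sigma> i\<close> for the variable \<open>i\<close>, with the coefficients mapped by \<open>c\<close>; the target ring is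
  the base field, the polynomial ring, or the polynomials in one variable over either of them.
\<close>
definition msub :: "('a::field \<Rightarrow> 'b::comm_ring_1) \<Rightarrow> (nat \<Rightarrow> 'b) \<Rightarrow> 'a mpol \<Rightarrow> 'b" where
  "msub c \<sigma> F = (\<Sum>e\<in>keys F. c (lookup F e) * (\<Prod>i\<in>keys e. \<sigma> i ^ lookup e i))"

context
  fixes c :: "'a::field \<Rightarrow> 'b::comm_ring_1" and \<sigma> :: "nat \<Rightarrow> 'b"
  assumes c: "rhom c"
begin

lemma msub_superset:
  assumes "finite A" "keys F \<subseteq> A"
  shows "msub c \<sigma> F = (\<Sum>e\<in>A. c (lookup F e) * (\<Prod>i\<in>keys e. \<sigma> i ^ lookup e i))"
  unfolding msub_def using assms
  by (intro sum.mono_neutral_left) (auto simp: in_keys_iff rhom_0 [OF c])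

lemma msub_add: "msub c \<sigma> (F + G) = msub c \<sigma> F + msub c \<sigma> G"
  by (subst (1 2 3) msub_superset [of "keys F \<union> keys G"])
     (use Poly_Mapping.keys_add [of F G] in \<open>auto simp: lookup_add rhom_add [OF c] sum.distrib algebra_simps\<close>)

lemma msub_single: "msub c \<sigma> (single e a) = c a * (\<Prod>i\<in>keys e. \<sigma> i ^ lookup e i)"
  by (simp add: msub_def rhom_0 [OF c])

lemma monomial_value_add:
  "(\<Prod>i\<in>keys (e + e'). \<sigma> i ^ lookup (e + e') i) =
     (\<Prod>i\<in>keys e. \<sigma> i ^ lookup e i) * (\<Prod>i\<in>keys e'. \<sigma> i ^ lookup e' i)"
proof -
  have *: "(\<Prod>i\<in>keys d. \<sigma> i ^ lookup d i) = (\<Prod>i\<in>keys e \<union> keys e'. \<sigma> i ^ lookup d i)"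
    if "keys d \<subseteq> keys e \<union> keys e'" for d
    using that by (intro prod.mono_neutral_left) (auto simp: in_keys_iff)
  show ?thesis
    using Poly_Mapping.keys_add [of e e']
    by (subst (1 2 3) *) (auto simp: lookup_add power_add prod.distrib)
qed

lemma msub_sum: "msub c \<sigma> (sum f A) = (\<Sum>x\<in>A. msub c \<sigma> (f x))"
  by (induction A rule: infinite_finite_induct) (simp_all add: msub_add, simp_all add: msub_def)

lemma msub_mult: "msub c \<sigma> (F * G) = msub c \<sigma> F * msub c \<sigma> G"
proof -
  have s: "msub c \<sigma> (single e a * single e' b) = msub c \<sigma> (single e a) * msub c \<sigma> (single e' b)" for e e' a b
    by (simp add: mult_single msub_single monomial_value_add rhom_mult [OF c] algebra_simps)
  have "msub c \<sigma> (F * G) = msub c \<sigma> ((\<Sum>e\<in>keys F. single e (lookup F e)) * (\<Sum>e\<in>keys G. single e (lookup G e)))"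
    by (simp flip: poly_mapping_expand)
  also have "\<dots> = (\<Sum>e\<in>keys F. msub c \<sigma> (single e (lookup F e))) * (\<Sum>e\<in>keys G. msub c \<sigma> (single e (lookup G e)))"
    by (simp add: sum_product msub_sum s)
  also have "\<dots> = msub c \<sigma> F * msub c \<sigma> G"
    by (simp add: msub_sum [symmetric] flip: poly_mapping_expand)
  finally show ?thesis .
qed

lemma msub_mconst [simp]: "msub c \<sigma> (mconst a) = c a"
  by (simp add: mconst_def msub_single)

lemma msub_pvar [simp]: "msub c \<sigma> (pvar i) = \<sigma> i"
  by (simp add: pvar_def msub_single rhom_1 [OF c])

lemma rhom_msub: "rhom (msub c \<sigma>)"
  using msub_mconst [of 1] by (intro rhomI) (simp_all add: msub_add msub_mult rhom_1 [OF c])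

end

lemma peval_msub: "peval F z = msub (\<lambda>c. c) z F"
  by (simp add: peval_def msub_def)

lemma rhom_peval: "rhom (\<lambda>F. peval F z)"
  by (simp add: peval_msub rhom_msub rhom_id)

lemma peval_mconst [simp]: "peval (mconst c) z = c"
  and peval_pvar [simp]: "peval (pvar i) z = z i"
  by (simp_all add: peval_msub rhom_id)

lemmas peval_simps [simp] = rhom_simps [OF rhom_peval]

section \<open>Euler operators and isolation of monomials\<close>

text \<open>
  The operators that are diagonal in the basis of monomials. They include the scaling of a variable
  and the Euler operators \<open>x\<^sub>j \<partial>/\<partial>x\<^sub>j - c\<close>.
\<close>
definition reweight :: "((nat \<Rightarrow>\<^sub>0 nat) \<Rightarrow> 'a) \<Rightarrow> 'a::field mpol \<Rightarrow> 'a mpol" where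
  "reweight w F = (\<Sum>e\<in>keys F. single e (w e * lookup F e))"

lemma lookup_reweight [simp]: "lookup (reweight w F) e = w e * lookup F e"
proof -
  have "(\<Sum>x\<in>keys F. lookup (single x (w x * lookup F x)) e) = (\<Sum>x\<in>keys F. if x = e then w x * lookup F x else 0)"
    by (intro sum.cong) (auto simp: lookup_single)
  then show ?thesis by (auto simp: reweight_def lookup_sum in_keys_iff)
qed

lemma keys_reweight: "keys (reweight w F) = {e \<in> keys F. w e \<noteq> 0}"
  by (auto simp: in_keys_iff)

text \<open>
  The standard argument with eigenvectors of diagonal operators: a family that is stable under enough
  of them contains with each member also one that has only monomials related to a prescribed \<open>e0\<close>,
  since an operator that kills an unrelated monomial and keeps \<open>e0\<close> shortens the polynomial. It replaces
  the decomposition into eigenspaces and is used for values, for orders of vanishing, and to split off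
  the part with a fixed monomial in the second block.
\<close>
lemma isolate:
  fixes L :: "'a::field mpol set"
  assumes "F \<in> L" "e0 \<in> keys F"
    and sep: "\<And>e. \<not> R e \<Longrightarrow> \<exists>w. w e = 0 \<and> w e0 \<noteq> 0 \<and> (\<forall>F\<in>L. reweight w F \<in> L)"
  shows "\<exists>F'\<in>L. e0 \<in> keys F' \<and> keys F' \<subseteq> {e \<in> keys F. R e}"
  using assms(1,2)
proof (induction "card (keys F)" arbitrary: F rule: less_induct)
  case less
  show ?case
  proof (cases "\<forall>e\<in>keys F. R e")
    case True then show ?thesis using less.prems by blast
  next
    case False
    then obtain e where e: "e \<in> keys F" "\<not> R e" by blast
    obtain w where w: "w e = 0" "w e0 \<noteq> 0" "reweight w F \<in> L" using sep [OF e(2)] less.prems by blast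
    have "keys (reweight w F) \<subset> keys F" using e w by (auto simp: keys_reweight)
    then have "card (keys (reweight w F)) < card (keys F)" by (simp add: psubset_card_mono)
    moreover have "e0 \<in> keys (reweight w F)" using w less.prems by (simp add: keys_reweight)
    ultimately obtain F' where "F'\<in>L" "e0 \<in> keys F'" "keys F' \<subseteq> {e \<in> keys (reweight w F). R e}"
      using less.hyps w by blast
    then show ?thesis by (auto simp: keys_reweight)
  qed
qed

lemma isolate_euler:
  fixes L :: "'a::field_char_0 mpol set"
  assumes "F \<in> L" "e0 \<in> keys F"
    and stable: "\<And>j c F. j \<in> T \<Longrightarrow> F \<in> L \<Longrightarrow> reweight (\<lambda>e. of_nat (lookup e j) - c) F \<in> L"
  shows "\<exists>F'\<in>L. e0 \<in> keys F' \<and> keys F' \<subseteq> {e \<in> keys F. \<forall>j\<in>T. lookup e j = lookup e0 j}"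
proof (rule isolate [OF assms(1,2)])
  fix e assume "\<not> (\<forall>j\<in>T. lookup e j = lookup e0 j)"
  then obtain j where "j \<in> T" "lookup e j \<noteq> lookup e0 j" by blast
  then show "\<exists>w. w e = 0 \<and> w e0 \<noteq> 0 \<and> (\<forall>F\<in>L. reweight w F \<in> L)"
    by (intro exI [of _ "\<lambda>d. of_nat (lookup d j) - of_nat (lookup e j)"] conjI ballI) (auto intro: stable)
qed

lemma keys_eq_singletonD: "keys F \<subseteq> {e0} \<Longrightarrow> F = mconst (lookup F e0) * monom_of e0"
  by (subst poly_mapping_expand [of F])
     (cases "keys F = {}"; auto simp: single_conv_monom subset_singleton_iff lookup_sum)

definition euler :: "nat \<Rightarrow> 'a::field mpol \<Rightarrow> 'a mpol" where
  "euler j = reweight (\<lambda>e. of_nat (lookup e j))"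

lemma euler_add: "euler j (F + G) = euler j F + euler j G"
  by (rule poly_mapping_eqI) (simp add: euler_def lookup_add algebra_simps)

lemma lookup_mconst_mult: "lookup (mconst c * F) e = c * lookup F e"
proof -
  have "mconst c * F = (\<Sum>d\<in>keys F. single d (c * lookup F d))"
    by (subst poly_mapping_expand [of F]) (simp add: sum_distrib_left mconst_def mult_single)
  also have "\<dots> = reweight (\<lambda>_. c) F" by (simp add: reweight_def)
  finally show ?thesis by simp
qed

lemma euler_single: "euler j (single e a) = mconst (of_nat (lookup e j)) * single e a"
  by (rule poly_mapping_eqI) (simp add: euler_def lookup_mconst_mult lookup_single when_def)

lemma euler_sum: "euler j (sum f A) = (\<Sum>x\<in>A. euler j (f x))"
  by (induction A rule: infinite_finite_induct) (simp_all add: euler_add, simp_all add: euler_def reweight_def)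

lemma euler_mult: "euler j (F * G) = euler j F * G + F * euler j G"
proof -
  have s: "euler j (single e a * single e' b) = euler j (single e a) * single e' b + single e a * euler j (single e' b)" for e e' a b
  proof -
    have "euler j (single e a * single e' b) = mconst (of_nat (lookup e j) + of_nat (lookup e' j)) * (single e a * single e' b)"
      by (simp add: mult_single euler_single lookup_add)
    then show ?thesis by (simp add: euler_single mconst_add algebra_simps)
  qed
  have "euler j (F * G) = euler j ((\<Sum>e\<in>keys F. single e (lookup F e)) * (\<Sum>e\<in>keys G. single e (lookup G e)))"
    by (simp flip: poly_mapping_expand)
  also have "\<dots> = (\<Sum>e\<in>keys F. euler j (single e (lookup F e))) * (\<Sum>e\<in>keys G. single e (lookup G e))
      + (\<Sum>e\<in>keys F. single e (lookup F e)) * (\<Sum>e\<in>keys G. euler j (single e (lookup G e)))"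
    by (simp add: sum_product euler_sum s sum.distrib)
  also have "\<dots> = euler j F * G + F * euler j G"
    by (simp add: euler_sum [symmetric] flip: poly_mapping_expand)
  finally show ?thesis .
qed

lemma euler_0 [simp]: "euler j 0 = 0" by (simp add: euler_def reweight_def)
lemma euler_mconst [simp]: "euler j (mconst c) = 0"
  by (simp add: mconst_def euler_single)
lemma euler_pvar: "euler j (pvar i) = (if i = j then pvar i else 0)"
  by (simp add: pvar_def euler_single lookup_single)

lemma reweight_euler_diff: "reweight (\<lambda>e. of_nat (lookup e j) - c) F = euler j F - mconst c * F"
  by (rule poly_mapping_eqI) (simp add: euler_def lookup_minus lookup_mconst_mult left_diff_distrib)

abbreviation eulerp :: "nat \<Rightarrow> 'a::field mpol poly \<Rightarrow> 'a mpol poly" where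
  "eulerp j \<equiv> map_poly (euler j)"

lemma eulerp_add: "eulerp j (p + q) = eulerp j p + eulerp j q"
  by (rule poly_eqI) (simp add: coeff_map_poly euler_add)
lemma eulerp_mult: "eulerp j (p * q) = eulerp j p * q + p * eulerp j q"
  by (rule poly_eqI) (simp add: coeff_map_poly euler_sum euler_mult coeff_mult sum.distrib)

text \<open>
  The extra variable \<open>\<tau>\<close> of \<open>'a mpol poly\<close> is the parameter of a one-parameter family; orders of
  vanishing are expressed by divisibility by its powers.
\<close>
abbreviation tau :: "'a::comm_ring_1 poly" where "tau \<equiv> [:0, 1:]"

lemma tau_power_dvd_iff: "tau ^ m dvd (p :: 'a::comm_ring_1 poly) \<longleftrightarrow> (\<forall>i<m. coeff p i = 0)"
proof -
  have "tau ^ m = (monom 1 m :: 'a poly)" by (simp add: monom_altdef)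
  then show ?thesis by (simp add: monom_1_dvd_iff')
qed

lemma tau_dvd_eulerp: "tau ^ m dvd p \<Longrightarrow> tau ^ m dvd eulerp j p"
  by (simp add: tau_power_dvd_iff coeff_map_poly)

abbreviation psub :: "(nat \<Rightarrow> 'a::field mpol poly) \<Rightarrow> 'a mpol \<Rightarrow> 'a mpol poly" where
  "psub \<equiv> msub (\<lambda>c. [:mconst c:])"

lemma rhom_pconst: "rhom (\<lambda>c. [:mconst c:])"
  using rhom_comp [OF rhom_pCons0 rhom_mconst] .
lemma rhom_psub: "rhom (psub u)" by (rule rhom_msub [OF rhom_pconst])
lemma psub_mconst [simp]: "psub u (mconst c) = [:mconst c:]"
  and psub_pvar [simp]: "psub u (pvar i) = u i"
  by (rule msub_mconst msub_pvar, rule rhom_pconst)+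
lemmas psub_simps [simp] = rhom_simps [OF rhom_psub]

text \<open>
  The chain rule for a substitution of which only \<open>u j\<close> involves the variable \<open>j\<close>: up to the common factor
  \<open>x\<^sub>j\<close>, both sides are \<open>u j\<close> times the derivative of \<open>u j\<close> times the image of \<open>\<partial>F/\<partial>x\<^sub>j\<close>.
\<close>
lemma euler_psub:
  assumes "\<And>i. i \<noteq> j \<Longrightarrow> eulerp j (u i) = 0"
  shows "eulerp j (u j) * psub u (euler j F) = u j * eulerp j (psub u F)"
proof (induction F rule: mpol_induct)
  case (mult F G)
  have "eulerp j (u j) * psub u (euler j (F * G)) =
      (eulerp j (u j) * psub u (euler j F)) * psub u G + psub u F * (eulerp j (u j) * psub u (euler j G))"
    by (simp add: euler_mult algebra_simps)
  also have "\<dots> = u j * eulerp j (psub u (F * G))"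
    unfolding mult by (simp add: eulerp_mult algebra_simps)
  finally show ?case .
qed (simp_all add: euler_add eulerp_add euler_pvar map_poly_pCons assms algebra_simps)

section \<open>A polynomial is determined by its values\<close>

lemma peval_reweight:
  "peval (reweight w F) z = (\<Sum>e\<in>keys F. w e * lookup F e * (\<Prod>i\<in>keys e. z i ^ lookup e i))"
proof -
  have "peval (reweight w F) z = (\<Sum>e\<in>keys F. lookup (reweight w F) e * (\<Prod>i\<in>keys e. z i ^ lookup e i))"
    unfolding peval_msub
    by (rule msub_superset) (auto simp: rhom_id keys_reweight)
  then show ?thesis by simp
qed

lemma monomial_scale:
  fixes z :: "nat \<Rightarrow> 'b::comm_semiring_1"
  shows "(\<Prod>j\<in>keys e. (z(i := c * z i)) j ^ lookup e j) = c ^ lookup e i * (\<Prod>j\<in>keys e. z j ^ lookup e j)"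
proof -
  have "(\<Prod>j\<in>keys e. (z(i := c * z i)) j ^ lookup e j)
      = (\<Prod>j\<in>keys e. (if j = i then c ^ lookup e i else 1) * z j ^ lookup e j)"
    by (intro prod.cong) (auto simp: power_mult_distrib)
  also have "\<dots> = c ^ lookup e i * (\<Prod>j\<in>keys e. z j ^ lookup e j)"
    by (auto simp: prod.distrib in_keys_iff)
  finally show ?thesis .
qed

lemma peval_scale:
  "peval F (z(i := c * z i)) = peval (reweight (\<lambda>e. c ^ lookup e i) F) z"
  unfolding peval_reweight by (subst peval_def, subst monomial_scale) (simp add: mult_ac)

text \<open>
  Vanishing everywhere is preserved by doubling a variable, and in characteristic zero the eigenvalues
  \<open>2\<^bsup>e\<^esup>\<close> separate the monomials. What is left by isolation is a single monomial, which does not vanish at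
  \<open>(1, ..., 1)\<close>.
\<close>
lemma mpol_eq_0I:
  fixes F :: "'a::field_char_0 mpol"
  assumes "\<And>z. peval F z = 0"
  shows "F = 0"
proof (rule ccontr)
  assume "F \<noteq> 0"
  then obtain e0 where e0: "e0 \<in> keys F" by (metis keys_eq_empty ex_in_conv)
  define L where "L = {F :: 'a mpol. \<forall>z. peval F z = 0}"
  have "\<exists>F'\<in>L. e0 \<in> keys F' \<and> keys F' \<subseteq> {e \<in> keys F. e = e0}"
  proof (rule isolate)
    show "F \<in> L" using assms by (simp add: L_def)
    show "e0 \<in> keys F" by fact
    fix e assume "e \<noteq> e0"
    then obtain i where i: "lookup e i \<noteq> lookup e0 i" by (meson poly_mapping_eqI)
    let ?w = "\<lambda>d. 2 ^ lookup d i - 2 ^ lookup e i :: 'a"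
    have "inj (\<lambda>k. 2 ^ k :: nat)" by (simp add: inj_def)
    then have "(2 ^ lookup e0 i :: nat) \<noteq> 2 ^ lookup e i" using i by simp
    then have "(of_nat (2 ^ lookup e0 i) :: 'a) \<noteq> of_nat (2 ^ lookup e i)" using of_nat_eq_iff by blast
    then have "?w e0 \<noteq> 0" by simp
    moreover have "reweight ?w G \<in> L" if "G \<in> L" for G
    proof -
      have "reweight ?w G = reweight (\<lambda>d. 2 ^ lookup d i) G - mconst (2 ^ lookup e i) * G"
        by (rule poly_mapping_eqI) (simp add: lookup_minus lookup_mconst_mult left_diff_distrib)
      then show ?thesis using that by (simp add: L_def peval_scale [symmetric])
    qed
    ultimately show "\<exists>w. w e = 0 \<and> w e0 \<noteq> 0 \<and> (\<forall>F\<in>L. reweight w F \<in> L)"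
      by (intro exI [of _ ?w] conjI ballI) (simp, blast, blast)
  qed
  then obtain F' where F': "F' \<in> L" "e0 \<in> keys F'" "keys F' \<subseteq> {e0}" by auto
  then have "keys F' = {e0}" by auto
  then have "peval F' (\<lambda>_. 1) = lookup F' e0" by (simp add: peval_def)
  then show False using F' by (auto simp: L_def in_keys_iff)
qed

lemma mpol_nonvanishing_point: "F \<noteq> 0 \<Longrightarrow> \<exists>z. peval (F :: 'a::field_char_0 mpol) z \<noteq> 0"
  using mpol_eq_0I by blast

section \<open>Bihomogeneous polynomials\<close>

abbreviation blocks :: "nat \<Rightarrow> nat set" where "blocks n \<equiv> block1 n \<union> block2 n"

definition bideg :: "nat \<Rightarrow> nat \<Rightarrow> nat \<Rightarrow> (nat \<Rightarrow>\<^sub>0 nat) \<Rightarrow> bool" where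
  "bideg n a b e \<longleftrightarrow> keys e \<subseteq> blocks n \<and>
      (\<Sum>i\<in>block1 n. lookup e i) = a \<and> (\<Sum>j\<in>block2 n. lookup e j) = b"

lemma bihom_iff: "bihom n a b F \<longleftrightarrow> (\<forall>e\<in>keys F. bideg n a b e)"
  by (simp add: bihom_def bideg_def)

lemma finite_block [simp]: "finite (block1 n)" "finite (block2 n)"
  by (simp_all add: block1_def block2_def)
lemma block_disjoint: "block1 n \<inter> block2 n = {}"
  by (auto simp: block1_def block2_def)
lemma block_disjointD: "i \<in> block1 n \<Longrightarrow> i \<notin> block2 n" "i \<in> block2 n \<Longrightarrow> i \<notin> block1 n"
  using block_disjoint by auto
lemma card_block: "card (block1 n) = n + 1" "card (block2 n) = n + 2"
  by (simp_all add: block1_def block2_def)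
lemma blocks_Un: "blocks n = {..2*n+2}"
  by (auto simp: block1_def block2_def)

lemma keys_plus_nat: "keys (e + e' :: nat \<Rightarrow>\<^sub>0 nat) = keys e \<union> keys e'"
  by (auto simp: in_keys_iff lookup_add)

lemma bideg_add_cancel:
  assumes "bideg n a b e" shows "bideg n (a + c) (b + d) (e + e') \<longleftrightarrow> bideg n c d e'"
  using assms by (auto simp: bideg_def keys_plus_nat lookup_add sum.distrib)
lemma bideg_add: "bideg n a b e \<Longrightarrow> bideg n c d e' \<Longrightarrow> bideg n (a + c) (b + d) (e + e')"
  by (simp add: bideg_add_cancel)

lemma bihom_0 [simp]: "bihom n a b 0" by (simp add: bihom_def)
lemma bihom_add: "bihom n a b F \<Longrightarrow> bihom n a b G \<Longrightarrow> bihom n a b (F + G)"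
  unfolding bihom_iff using Poly_Mapping.keys_add [of F G] by blast
lemma bihom_uminus: "bihom n a b F \<Longrightarrow> bihom n a b (- F)"
  by (simp add: bihom_iff in_keys_iff)
lemma bihom_diff: "bihom n a b F \<Longrightarrow> bihom n a b G \<Longrightarrow> bihom n a b (F - G)"
  using bihom_add [OF _ bihom_uminus] by fastforce
lemma bihom_mult: "bihom n a b F \<Longrightarrow> bihom n c d G \<Longrightarrow> bihom n (a + c) (b + d) (F * G)"
  unfolding bihom_iff using Poly_Mapping.keys_mult [of F G] bideg_add by fastforce
lemma bihom_mconst: "bihom n 0 0 (mconst c)"
  by (simp add: bihom_def mconst_def)
lemma bihom_1 [simp]: "bihom n 0 0 1" using bihom_mconst [of n 1] by simp
lemma bihom_mconst_mult: "bihom n a b F \<Longrightarrow> bihom n a b (mconst c * F)"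
  using bihom_mult [OF bihom_mconst] by fastforce
lemma bihom_pvar1: "i \<in> block1 n \<Longrightarrow> bihom n 1 0 (pvar i)"
  using block_disjointD [of i n] by (auto simp: bihom_def pvar_def lookup_single when_def)
lemma bihom_pvar2: "i \<in> block2 n \<Longrightarrow> bihom n 0 1 (pvar i)"
  using block_disjointD [of i n] by (auto simp: bihom_def pvar_def lookup_single when_def)
lemma bihom_sum: "(\<And>x. x \<in> A \<Longrightarrow> bihom n a b (f x)) \<Longrightarrow> bihom n a b (sum f A)"
  by (induction A rule: infinite_finite_induct) (auto intro: bihom_add)
lemma bihom_power: "bihom n a b F \<Longrightarrow> bihom n (a * k) (b * k) (F ^ k)"
  using bihom_mult by (induction k) fastforce+
lemma bihom_prod: "(\<And>x. x \<in> A \<Longrightarrow> bihom n (g x) (h x) (f x)) \<Longrightarrow> bihom n (sum g A) (sum h A) (prod f A)"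
  by (induction A rule: infinite_finite_induct) (auto intro: bihom_mult)
lemma bihom_reweight: "bihom n a b F \<Longrightarrow> bihom n a b (reweight w F)"
  by (auto simp: bihom_iff keys_reweight)

text \<open>
  The component of \<open>Q\<close> in the expected bidegree already has the product \<open>A\<close> with \<open>B\<close>, because the other
  components contribute to other bidegrees.
\<close>
lemma bihom_quotient:
  assumes B: "bihom n a b B" and A: "bihom n a' b' A" and AB: "A = Q * B" and "A \<noteq> 0"
  shows "\<exists>c d. a' = a + c \<and> b' = b + d \<and> bihom n c d Q"
proof -
  obtain e where e: "e \<in> keys A" using \<open>A \<noteq> 0\<close> by (metis keys_eq_empty ex_in_conv)
  then obtain e1 e2 where "e = e1 + e2" "e1 \<in> keys Q" "e2 \<in> keys B"
    unfolding AB using Poly_Mapping.keys_mult [of Q B] by blast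
  moreover from this have "bideg n a b e2" "bideg n a' b' e" using A B e by (auto simp: bihom_iff)
  ultimately have "a' = a + (\<Sum>i\<in>block1 n. lookup e1 i)" "b' = b + (\<Sum>i\<in>block2 n. lookup e1 i)"
    by (auto simp: bideg_def lookup_add sum.distrib)
  then obtain c d where cd: "a' = a + c" "b' = b + d" by blast
  define Q1 where "Q1 = reweight (\<lambda>e. if bideg n c d e then 1 else 0) Q"
  define Q2 where "Q2 = reweight (\<lambda>e. if bideg n c d e then 0 else 1) Q"
  have Q: "Q = Q1 + Q2" by (rule poly_mapping_eqI) (simp add: Q1_def Q2_def lookup_add)
  have Q1: "bihom n c d Q1" by (auto simp: bihom_iff Q1_def keys_reweight)
  have "Q2 * B = A - Q1 * B" by (simp add: AB Q algebra_simps)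
  moreover have "bihom n a' b' (A - Q1 * B)"
    using bihom_diff [OF A] bihom_mult [OF Q1 B] cd by (simp add: add.commute)
  ultimately have h: "bihom n a' b' (Q2 * B)" by simp
  have "keys (Q2 * B) = {}"
  proof (rule ccontr)
    assume "keys (Q2 * B) \<noteq> {}"
    then obtain e where e: "e \<in> keys (Q2 * B)" by blast
    then obtain e1 e2 where *: "e = e1 + e2" "e1 \<in> keys Q2" "e2 \<in> keys B"
      using Poly_Mapping.keys_mult [of Q2 B] by blast
    have "bideg n c d e1"
      using bideg_add_cancel [of n a b e2 c d e1] h e * B cd by (auto simp: bihom_iff add.commute)
    then show False using * by (simp add: Q2_def keys_reweight)
  qed
  then have "Q2 * B = 0" by simp
  moreover have "B \<noteq> 0" using AB \<open>A \<noteq> 0\<close> by auto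
  ultimately have "Q2 = 0" by simp
  then show ?thesis using Q Q1 cd by auto
qed

lemma msub_cong_bihom:
  assumes "bihom n a b F" "\<And>i. i \<in> blocks n \<Longrightarrow> \<sigma> i = \<rho> i"
  shows "msub c \<sigma> F = msub c \<rho> F"
  unfolding msub_def
proof (intro sum.cong refl arg_cong2 [of _ _ _ _ "(*)"] prod.cong)
  fix e i assume "e \<in> keys F" "i \<in> keys e"
  then have "i \<in> blocks n" using assms(1) by (auto simp: bihom_def)
  then show "\<sigma> i ^ lookup e i = \<rho> i ^ lookup e i" by (simp only: assms(2))
qed

lemma peval_cong_bihom:
  assumes "bihom n a b F" "\<And>i. i \<in> blocks n \<Longrightarrow> z i = z' i"
  shows "peval F z = peval F z'"
  unfolding peval_msub using assms by (rule msub_cong_bihom)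

lemma bideg_monomial_value:
  fixes z :: "nat \<Rightarrow> 'b::comm_semiring_1"
  assumes "bideg n a b e"
  shows "(\<Prod>i\<in>keys e. z i ^ lookup e i) =
     (\<Prod>i\<in>block1 n. z i ^ lookup e i) * (\<Prod>i\<in>block2 n. z i ^ lookup e i)"
proof -
  have "(\<Prod>i\<in>keys e. z i ^ lookup e i) = (\<Prod>i\<in>blocks n. z i ^ lookup e i)"
    using assms by (intro prod.mono_neutral_left) (auto simp: bideg_def in_keys_iff)
  also have "\<dots> = (\<Prod>i\<in>block1 n. z i ^ lookup e i) * (\<Prod>i\<in>block2 n. z i ^ lookup e i)"
    by (rule prod.union_disjoint) (simp_all add: block_disjoint)
  finally show ?thesis .
qed

lemma peval_bihom_scale:
  assumes F: "bihom n a b F"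
  shows "peval F (\<lambda>i. if i \<in> block1 n then s * z i else t * z i) = s ^ a * t ^ b * peval F z"
  unfolding peval_def sum_distrib_left
proof (intro sum.cong refl)
  let ?z = "\<lambda>i. if i \<in> block1 n then s * z i else t * z i"
  fix e assume "e \<in> keys F"
  then have e: "bideg n a b e" using F by (simp add: bihom_iff)
  have 1: "(\<Prod>i\<in>block1 n. ?z i ^ lookup e i) = s ^ a * (\<Prod>i\<in>block1 n. z i ^ lookup e i)"
    using e by (auto simp: bideg_def power_mult_distrib prod.distrib power_sum)
  have "(\<Prod>i\<in>block2 n. ?z i ^ lookup e i) = (\<Prod>i\<in>block2 n. t ^ lookup e i * z i ^ lookup e i)"
    by (intro prod.cong refl) (auto dest: block_disjointD simp: power_mult_distrib)
  then have 2: "(\<Prod>i\<in>block2 n. ?z i ^ lookup e i) = t ^ b * (\<Prod>i\<in>block2 n. z i ^ lookup e i)"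
    using e by (auto simp: bideg_def prod.distrib power_sum)
  show "lookup F e * (\<Prod>i\<in>keys e. ?z i ^ lookup e i) = s ^ a * t ^ b * (lookup F e * (\<Prod>i\<in>keys e. z i ^ lookup e i))"
    unfolding bideg_monomial_value [OF e] 1 2 by (simp add: mult_ac)
qed

section \<open>Regular outside finitely many points implies polynomial\<close>

text \<open>
  The hypothesis says that \<open>q / p\<close> has no poles; remove the roots of \<open>p\<close> one by one.
\<close>
lemma alg_closed_dvdI:
  fixes p q :: "'a::alg_closed_field poly"
  assumes "p \<noteq> 0" "\<And>w. \<exists>a b. q * b = a * p \<and> poly b w \<noteq> 0"
  shows "p dvd q"
  using assms
proof (induction "Polynomial.degree p" arbitrary: p q rule: less_induct)
  case less
  show ?case
  proof (cases "Polynomial.degree p = 0")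
    case True then show ?thesis using less.prems(1) by (metis degree_eq_zeroE is_unit_const_poly_iff is_unit_iff_degree unit_imp_dvd)
  next
    case False
    then obtain w0 where "poly p w0 = 0" using alg_closed_imp_poly_has_root [of p] by auto
    then obtain p1 where p1: "p = [:- w0, 1:] * p1" by (metis poly_eq_0_iff_dvd dvdE)
    obtain a b where "q * b = a * p" "poly b w0 \<noteq> 0" using less.prems(2) by blast
    then have "poly q w0 = 0" by (metis \<open>poly p w0 = 0\<close> mult_eq_0_iff poly_mult)
    then obtain q1 where q1: "q = [:- w0, 1:] * q1" by (metis poly_eq_0_iff_dvd dvdE)
    have "p1 \<noteq> 0" using less.prems(1) p1 by auto
    then have "Polynomial.degree p = Suc (Polynomial.degree p1)" unfolding p1 by (subst degree_mult_eq) auto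
    moreover have "\<exists>a b. q1 * b = a * p1 \<and> poly b w \<noteq> 0" for w
    proof -
      obtain a b where ab: "q * b = a * p" "poly b w \<noteq> 0" using less.prems(2) by blast
      then have "[:- w0, 1:] * (q1 * b) = [:- w0, 1:] * (a * p1)"
        unfolding p1 q1 by (simp only: mult_ac)
      moreover have "[:- w0, 1:] \<noteq> 0" by simp
      ultimately have "q1 * b = a * p1" using mult_left_cancel by blast
      then show ?thesis using ab by blast
    qed
    ultimately have "p1 dvd q1" using less.hyps \<open>p1 \<noteq> 0\<close> by simp
    then show ?thesis unfolding p1 q1 by (rule mult_dvd_mono [OF dvd_refl])
  qed
qed

text \<open>
  A substitute for the leading coefficient that tolerates \<open>c = 0\<close> and is therefore compatible with
  sums.
\<close>
definition lead_at :: "nat \<Rightarrow> 'r::comm_ring_1 \<Rightarrow> 'r poly \<Rightarrow> bool" where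
  "lead_at d c p \<longleftrightarrow> Polynomial.degree p \<le> d \<and> coeff p d = c"

lemma lead_at_mult:
  assumes "lead_at d c p" "lead_at d' c' q" shows "lead_at (d + d') (c * c') (p * q)"
proof -
  have deg: "Polynomial.degree p \<le> d" "Polynomial.degree q \<le> d'" using assms by (auto simp: lead_at_def)
  have "coeff (p * q) (d + d') = (\<Sum>i\<le>d+d'. coeff p i * coeff q (d + d' - i))" by (simp add: coeff_mult)
  also have "\<dots> = (\<Sum>i\<in>{d}. coeff p i * coeff q (d + d' - i))"
  proof (rule sum.mono_neutral_right)
    show "\<forall>i\<in>{..d + d'} - {d}. coeff p i * coeff q (d + d' - i) = 0"
    proof
      fix i assume i: "i \<in> {..d + d'} - {d}"
      show "coeff p i * coeff q (d + d' - i) = 0"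
      proof (cases "i > d")
        case True then show ?thesis using deg by (simp add: coeff_eq_0)
      next
        case False then have "d + d' - i > d'" using i by auto
        then show ?thesis using deg by (simp add: coeff_eq_0)
      qed
    qed
  qed auto
  finally have "coeff (p * q) (d + d') = c * c'" using assms by (simp add: lead_at_def)
  moreover have "Polynomial.degree (p * q) \<le> d + d'" using degree_mult_le [of p q] deg by linarith
  ultimately show ?thesis by (simp add: lead_at_def)
qed

lemma lead_at_1: "lead_at 0 1 1" by (simp add: lead_at_def)
lemma lead_at_power: "lead_at d c p \<Longrightarrow> lead_at (d * k) (c ^ k) (p ^ k)"
  by (induction k) (auto simp: lead_at_1 intro: lead_at_mult)
lemma lead_at_prod: "finite A \<Longrightarrow> (\<And>x. x \<in> A \<Longrightarrow> lead_at (d x) (c x) (p x)) \<Longrightarrow> lead_at (sum d A) (prod c A) (prod p A)"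
  by (induction A rule: finite_induct) (auto simp: lead_at_1 intro: lead_at_mult)
lemma lead_at_sum: "finite A \<Longrightarrow> (\<And>x. x \<in> A \<Longrightarrow> lead_at d (c x) (p x)) \<Longrightarrow> lead_at d (sum c A) (sum p A)"
  unfolding lead_at_def by (auto intro!: degree_sum_le simp: coeff_sum)

text \<open>
  Restriction to the line \<open>z + w v\<close> through a variable point \<open>z\<close> (\<open>line\<close>) or a given one (\<open>line_at\<close>), as
  a polynomial in \<open>w\<close>.
\<close>
definition line :: "(nat \<Rightarrow> 'a) \<Rightarrow> 'a::field mpol \<Rightarrow> 'a mpol poly" where
  "line v = psub (\<lambda>i. [:pvar i, mconst (v i):])"
definition line_at :: "(nat \<Rightarrow> 'a) \<Rightarrow> (nat \<Rightarrow> 'a) \<Rightarrow> 'a::field mpol \<Rightarrow> 'a poly" where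
  "line_at z v = msub (\<lambda>c. [:c:]) (\<lambda>i. [:z i, v i:])"

lemma rhom_line_at: "rhom (line_at z v)"
  unfolding line_at_def by (rule rhom_msub [OF rhom_pCons0])

lemma map_poly_line: "map_poly (\<lambda>F. peval F z) (line v F) = line_at z v F"
  unfolding line_def
  by (rule mpol_hom_eq [OF rhom_comp [OF rhom_map_poly [OF rhom_peval] rhom_psub] rhom_line_at])
     (simp_all add: line_at_def rhom_pCons0 map_poly_pCons)

lemma poly_line_0: "poly (line v F) 0 = F"
  unfolding line_def
  by (rule mpol_hom_eq [OF rhom_comp [OF rhom_poly rhom_psub] rhom_id]) simp_all

lemma poly_line_at: "poly (line_at z v F) w = peval F (\<lambda>i. z i + w * v i)"
  by (rule mpol_hom_eq [OF rhom_comp [OF rhom_poly rhom_line_at] rhom_peval])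
     (simp_all add: line_at_def rhom_pCons0)

text \<open>
  The leading coefficient along a line depends only on the direction \<open>v\<close>. This makes division by the
  restriction of \<open>F\<close> possible over the polynomial ring as soon as \<open>F\<close> does not vanish at \<open>v\<close>.
\<close>
lemma lead_at_line:
  assumes F: "bihom n a b F" shows "lead_at (a + b) (mconst (peval F v)) (line v F)"
proof -
  have "mconst (peval F v) = (\<Sum>e\<in>keys F. mconst (lookup F e) * (\<Prod>i\<in>keys e. mconst (v i) ^ lookup e i))"
    by (simp add: peval_def rhom_simps [OF rhom_mconst])
  moreover have "lead_at (a + b) \<dots> (line v F)"
    unfolding line_def msub_def
  proof (rule lead_at_sum)
    fix e assume "e \<in> keys F"
    then have e: "bideg n a b e" using F by (simp add: bihom_iff)
    have "sum (lookup e) (keys e) = sum (lookup e) (blocks n)"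
      using e by (intro sum.mono_neutral_left) (auto simp: bideg_def in_keys_iff)
    also have "\<dots> = a + b"
      using e by (subst sum.union_disjoint) (auto simp: bideg_def block_disjoint)
    finally have "sum (\<lambda>i. 1 * lookup e i) (keys e) = a + b" by simp
    moreover have "lead_at (sum (\<lambda>i. 1 * lookup e i) (keys e)) (\<Prod>i\<in>keys e. mconst (v i) ^ lookup e i)
        (\<Prod>i\<in>keys e. [:pvar i, mconst (v i):] ^ lookup e i)"
      by (intro lead_at_prod finite_keys lead_at_power) (simp add: lead_at_def)
    moreover have "lead_at 0 (mconst (lookup F e)) [:mconst (lookup F e):]" by (simp add: lead_at_def)
    ultimately show "lead_at (a + b) (mconst (lookup F e) * (\<Prod>i\<in>keys e. mconst (v i) ^ lookup e i))
        ([:mconst (lookup F e):] * (\<Prod>i\<in>keys e. [:pvar i, mconst (v i):] ^ lookup e i))"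
      using lead_at_mult by fastforce
  qed simp
  ultimately show ?thesis by simp
qed

text \<open>
  Two vectors in three-dimensional space lie on a common plane through the origin. Its equation is a linear
  form that vanishes at \<open>p\<close> and is constant in the direction \<open>v\<close>.
\<close>
lemma common_annihilator:
  fixes v p :: "nat \<Rightarrow> 'a::field"
  assumes "v a \<noteq> 0" "a \<noteq> b" "a \<noteq> c" "b \<noteq> c"
  shows "\<exists>la lb lc. (lb \<noteq> 0 \<or> lc \<noteq> 0) \<and> la * v a + lb * v b + lc * v c = 0 \<and> la * p a + lb * p b + lc * p c = 0"
proof -
  define pb where "pb = v a * p b - v b * p a"
  define pt_adapted where "pt_adapted = v a * p c - v c * p a"
  show ?thesis
  proof (cases "pb = 0 \<and> pt_adapted = 0")
    case True
    then show ?thesis using assms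
      by (intro exI [of _ "- v b"] exI [of _ "v a"] exI [of _ 0]) (auto simp: pb_def algebra_simps)
  next
    case False
    then show ?thesis using assms
      by (intro exI [of _ "pb * v c - pt_adapted * v b"] exI [of _ "pt_adapted * v a"] exI [of _ "- pb * v a"])
         (auto simp: pb_def pt_adapted_def algebra_simps)
  qed
qed

text \<open>
  An algebraic form of the extension of sections over a finite set of points. A factorial ring
  and points of codimension one are avoided by working on lines: the remainder \<open>r\<close> of \<open>A\<close> modulo \<open>B\<close>
  along the direction \<open>v\<close> vanishes on each line on which \<open>B\<close> divides \<open>A\<close>, in particular on each line that
  consists of points of the product other than the \<open>p i\<close>. The lines through the points \<open>z\<close>
  with \<open>N z \<noteq> 0\<close> are of this kind, so \<open>r N\<close> vanishes identically.
\<close>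
lemma regular_imp_dvd:
  fixes A B :: "'a::{alg_closed_field, field_char_0} mpol" and n s :: nat and p :: "nat \<Rightarrow> nat \<Rightarrow> 'a"
  assumes n: "n \<ge> 1" and A: "bihom n a' b' A" and B: "bihom n a b B" "B \<noteq> 0"
    and reg: "\<And>z. z \<in> biproj n \<Longrightarrow> (\<forall>i\<in>{1..s}. z \<notin> point_class n (p i)) \<Longrightarrow>
                \<exists>A' B'. A * B' = A' * B \<and> peval B' z \<noteq> 0"
  shows "B dvd A"
proof -
  let ?q = "n + 1"
  have idx: "0 \<in> block1 n" "1 \<in> block1 n" "?q \<in> block2 n" "?q + 1 \<in> block2 n" "?q + 2 \<in> block2 n"
    using n by (auto simp: block1_def block2_def)
  have "B * pvar 0 * pvar ?q \<noteq> 0" using B by simp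
  then obtain v where "peval (B * pvar 0 * pvar ?q) v \<noteq> 0"
    using mpol_nonvanishing_point by blast
  then have v: "peval B v \<noteq> 0" "v 0 \<noteq> 0" "v ?q \<noteq> 0" by simp_all
  define tr :: "(nat \<Rightarrow> 'a) \<Rightarrow> nat \<Rightarrow> 'a" where "tr z = (\<lambda>i. if i > 2 * n + 2 then 0 else z i)" for z
  have tr: "tr z i = z i" if "i \<in> blocks n" for z i
    using that by (simp add: tr_def blocks_Un)
  have "\<forall>i. \<exists>la lb lc. (lb \<noteq> 0 \<or> lc \<noteq> 0) \<and> la * v ?q + lb * v (?q+1) + lc * v (?q+2) = 0
          \<and> la * p i ?q + lb * p i (?q+1) + lc * p i (?q+2) = 0"
    using common_annihilator [of v ?q "?q+1" "?q+2"] v(3) by simp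
  then obtain la lb lc where l: "\<And>i. lb i \<noteq> 0 \<or> lc i \<noteq> 0"
      "\<And>i. la i * v ?q + lb i * v (?q+1) + lc i * v (?q+2) = 0"
      "\<And>i. la i * p i ?q + lb i * p i (?q+1) + lc i * p i (?q+2) = 0" by metis
  \<comment> \<open>Likewise \<open>lf i\<close> is constant along \<open>v\<close> and vanishes at \<open>p i\<close>: a line on which it is not zero avoids \<open>p i\<close>.\<close>
  define lf where "lf i = mconst (la i) * pvar ?q + mconst (lb i) * pvar (?q+1) + mconst (lc i) * pvar (?q+2)" for i
  have lf: "lf i \<noteq> 0" for i
  proof
    assume 0: "lf i = 0"
    have "peval (lf i) (\<lambda>j. if j = ?q+1 then 1 else 0) = lb i" "peval (lf i) (\<lambda>j. if j = ?q+2 then 1 else 0) = lc i"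
      by (simp_all add: lf_def)
    then show False using 0 l(1) [of i] by simp
  qed
  \<comment> \<open>A value of \<open>l0\<close> is constant along the direction \<open>v\<close>; if it is not zero, the first block of coordinates never vanishes.\<close>
  define l0 where "l0 = mconst (v 0) * pvar 1 - mconst (v 1) * pvar 0"
  have l0: "l0 \<noteq> 0"
  proof
    assume 0: "l0 = 0"
    have "peval l0 (\<lambda>j. if j = 1 then 1 else 0) = v 0" by (simp add: l0_def)
    then show False using 0 v by simp
  qed
  \<comment> \<open>The index \<open>0\<close> also guarantees that some \<open>lf i\<close> is present when \<open>s = 0\<close>; it keeps the second block from vanishing.\<close>
  define N where "N = l0 * (\<Prod>i\<in>{0..s}. lf i)"
  have N: "N \<noteq> 0" using lf l0 by (simp add: N_def)
  have div_at: "line_at z v B dvd line_at z v A" if z: "peval N z \<noteq> 0" for z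
  proof -
    define z' where "z' = tr z"
    define v' where "v' = tr v"
    have eq: "line_at z v F = line_at z' v' F" if "bihom n a b F" for a b F
      unfolding line_at_def by (rule msub_cong_bihom [OF that]) (simp add: z'_def v'_def tr)
    have lz: "peval l0 z \<noteq> 0" "\<And>i. i \<le> s \<Longrightarrow> peval (lf i) z \<noteq> 0"
      using z by (auto simp: N_def)
    have "line_at z' v' B dvd line_at z' v' A"
    proof (rule alg_closed_dvdI)
      have "coeff (line v B) (a + b) = mconst (peval B v)" using lead_at_line [OF B(1)] by (simp add: lead_at_def)
      then have "coeff (line_at z v B) (a + b) = peval B v"
        by (simp add: map_poly_line [symmetric] coeff_map_poly)
      then show "line_at z' v' B \<noteq> 0" using v eq [OF B(1)] by auto
      fix w
      define y where "y = (\<lambda>i. z' i + w * v' i)"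
      have y: "y i = z i + w * v i" if "i \<in> blocks n" for i
        using that by (simp add: y_def z'_def v'_def tr)
      have "v 0 * y 1 - v 1 * y 0 \<noteq> 0"
        using lz(1) y idx by (simp add: l0_def algebra_simps)
      then have y1: "\<exists>i\<in>block1 n. y i \<noteq> 0" using idx by (metis mult_zero_right diff_self)
      have ly: "la i * y ?q + lb i * y (?q+1) + lc i * y (?q+2) \<noteq> 0" if "i \<le> s" for i
      proof -
        have "la i * y ?q + lb i * y (?q+1) + lc i * y (?q+2)
            = peval (lf i) z + w * (la i * v ?q + lb i * v (?q+1) + lc i * v (?q+2))"
          using y idx by (simp add: lf_def algebra_simps)
        then show ?thesis using lz(2) [OF that] l(2) by simp
      qed
      then have y2: "\<exists>i\<in>block2 n. y i \<noteq> 0"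
        using idx ly [of 0] by (metis mult_zero_right add_0 zero_le)
      have "y \<in> biproj n" using y1 y2 by (simp add: biproj_def y_def z'_def v'_def tr_def)
      moreover have "y \<notin> point_class n (p i)" if "i \<in> {1..s}" for i
      proof
        assume "y \<in> point_class n (p i)"
        then obtain r t where "y = (\<lambda>j. if j \<in> block1 n then r * p i j else t * p i j)"
          by (auto simp: point_class_def)
        then have "\<And>j. j \<in> block2 n \<Longrightarrow> y j = t * p i j"
          by (simp add: block_disjointD)
        then have "la i * y ?q + lb i * y (?q+1) + lc i * y (?q+2)
            = t * (la i * p i ?q + lb i * p i (?q+1) + lc i * p i (?q+2))"
          using idx by (simp add: algebra_simps)
        then show False using ly l(3) that by simp
      qed
      ultimately obtain A' B' where AB: "A * B' = A' * B" "peval B' y \<noteq> 0" using reg by blast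
      have "line_at z' v' A * line_at z' v' B' = line_at z' v' A' * line_at z' v' B"
        using AB(1) by (metis rhom_mult [OF rhom_line_at])
      moreover have "poly (line_at z' v' B') w \<noteq> 0" using AB(2) by (simp add: poly_line_at y_def)
      ultimately show "\<exists>a b. line_at z' v' A * b = a * line_at z' v' B \<and> poly b w \<noteq> 0" by blast
    qed
    then show ?thesis using eq A B by simp
  qed
  have lead: "Polynomial.degree (line v B) \<le> a + b" "coeff (line v B) (a + b) = mconst (peval B v)"
    using lead_at_line [OF B(1)] by (auto simp: lead_at_def)
  then have nz: "line v B \<noteq> 0" using v by auto
  have deg: "Polynomial.degree (line v B) = a + b"
    using lead v by (metis le_degree mconst_eq_0 le_antisym)
  \<comment> \<open>The leading coefficient is a nonzero constant, so pseudo-division is division up to a unit.\<close>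
  obtain q r where qr: "pseudo_divmod (line v A) (line v B) = (q, r)" by force
  obtain k where k: "smult (mconst (peval B v) ^ k) (line v A) = line v B * q + r"
    and r: "r = 0 \<or> Polynomial.degree r < a + b"
    using pseudo_divmod [OF nz qr] deg lead by metis
  have "r = 0"
  proof (rule poly_eqI)
    fix j
    have "coeff r j * N = 0"
    proof (rule mpol_eq_0I)
      fix z
      show "peval (coeff r j * N) z = 0"
      proof (cases "peval N z = 0")
        case False
        let ?m = "map_poly (\<lambda>F. peval F z)"
        have rm: "rhom ?m" by (rule rhom_map_poly [OF rhom_peval])
        have "?m (smult (mconst (peval B v) ^ k) (line v A)) = smult (peval B v ^ k) (line_at z v A)"
          by (simp add: poly_eq_iff coeff_map_poly map_poly_line [symmetric])
        then have "smult (peval B v ^ k) (line_at z v A) = line_at z v B * ?m q + ?m r"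
          unfolding k by (simp add: rhom_simps [OF rm] map_poly_line)
        then have "?m r = smult (peval B v ^ k) (line_at z v A) - line_at z v B * ?m q" by simp
        then have dvd: "line_at z v B dvd ?m r"
          using div_at [OF False] by (metis dvd_diff dvd_smult dvd_triv_left)
        have cB: "coeff (line_at z v B) (a + b) = peval B v"
          using lead by (simp add: map_poly_line [symmetric] coeff_map_poly)
        have "?m r = 0"
        proof (rule ccontr)
          assume nz: "?m r \<noteq> 0"
          then have "Polynomial.degree r < a + b" using r by auto
          moreover have "Polynomial.degree (?m r) \<le> Polynomial.degree r" by (rule degree_le) (simp add: coeff_map_poly coeff_eq_0)
          moreover have "a + b \<le> Polynomial.degree (line_at z v B)" using cB v by (metis le_degree)
          ultimately show False using dvd_imp_degree_le [OF dvd nz] by linarith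
        qed
        then have "peval (coeff r j) z = 0" by (metis coeff_0 coeff_map_poly peval_simps(1))
        then show ?thesis by simp
      qed simp
    qed
    then show "coeff r j = coeff 0 j" using N by simp
  qed
  then have "poly (smult (mconst (peval B v) ^ k) (line v A)) 0 = poly (line v B * q) 0" using k by simp
  then have *: "mconst (peval B v) ^ k * A = B * poly q 0" by (simp add: poly_line_0)
  have "mconst (inverse (peval B v) ^ k) * (mconst (peval B v) ^ k * A) = A"
    using v by (simp add: rhom_power [OF rhom_mconst, symmetric] mult.assoc [symmetric] mconst_mult [symmetric] power_mult_distrib [symmetric])
  then have "A = B * (mconst (inverse (peval B v) ^ k) * poly q 0)" unfolding * by (simp add: mult_ac)
  then show ?thesis by (metis dvd_triv_left)
qed

section \<open>Order of vanishing\<close>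

lemma tau_power_dvd_mult_cancel:
  fixes p q :: "'a::idom poly"
  assumes "tau ^ m dvd q * p" "poly q 0 \<noteq> 0"
  shows "tau ^ m dvd p"
proof (cases "p = 0")
  case False
  then have qp: "q * p \<noteq> 0" using assms(2) by auto
  have "m \<le> order 0 (q * p)" using assms(1) qp order_divides [of 0 m "q * p"] by simp
  also have "\<dots> = order 0 p" using qp assms(2) by (simp add: order_mult order_root)
  finally show ?thesis using order_divides [of 0 m p] by simp
qed simp

lemma tau_power_dvd_le:
  fixes q :: "'a::idom poly"
  assumes "tau ^ m dvd tau ^ k * q" "poly q 0 \<noteq> 0" shows "m \<le> k"
proof -
  have "tau ^ m dvd (tau ^ k :: 'a poly)"
    by (rule tau_power_dvd_mult_cancel [of m q]) (use assms in \<open>simp_all add: mult.commute\<close>)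
  moreover have "tau ^ k = (monom 1 k :: 'a poly)" by (simp add: monom_altdef)
  ultimately show ?thesis unfolding tau_power_dvd_iff by (auto simp: not_le [symmetric])
qed

lemma psub_monom_of:
  assumes "\<And>i. i \<in> keys e \<Longrightarrow> u i = tau ^ w i * q i"
  shows "psub u (monom_of e) = tau ^ (\<Sum>i\<in>keys e. w i * lookup e i) * (\<Prod>i\<in>keys e. q i ^ lookup e i)"
proof -
  have "psub u (monom_of e) = (\<Prod>i\<in>keys e. u i ^ lookup e i)"
    by (simp add: monom_of_def msub_single rhom_pconst one_pCons)
  also have "\<dots> = (\<Prod>i\<in>keys e. tau ^ (w i * lookup e i) * q i ^ lookup e i)"
    by (intro prod.cong) (simp_all add: assms power_mult_distrib power_mult)
  finally show ?thesis by (simp add: prod.distrib power_sum)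
qed

text \<open>
  The Taylor expansion \<open>F(p + \<tau> x)\<close>. For bihomogeneous \<open>F\<close> the order in \<open>\<tau>\<close> is the multiplicity at the
  point \<open>p\<close> of the product, since the cone over the product is, locally at \<open>p\<close>, the product times a torus.
\<close>
definition theta :: "(nat \<Rightarrow> 'a) \<Rightarrow> 'a::field mpol \<Rightarrow> 'a mpol poly" where
  "theta p = psub (\<lambda>i. [:mconst (p i), pvar i:])"

lemma rhom_theta: "rhom (theta p)" by (simp add: theta_def rhom_psub)
lemmas theta_simps [simp] = rhom_simps [OF rhom_theta]
lemma theta_mconst [simp]: "theta p (mconst c) = [:mconst c:]"
  and theta_pvar [simp]: "theta p (pvar i) = [:mconst (p i), pvar i:]"
  by (simp_all add: theta_def)

text \<open>
  Specializing to \<open>\<tau> = 1\<close> and translating back recovers \<open>F\<close>.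
\<close>
lemma theta_eq_0_iff [simp]: "theta p F = 0 \<longleftrightarrow> F = 0"
proof
  let ?h = "\<lambda>F. msub mconst (\<lambda>i. pvar i - mconst (p i)) (poly (theta p F) 1)"
  have "?h F = F"
    by (rule mpol_hom_eq [OF rhom_comp [OF rhom_msub [OF rhom_mconst] rhom_comp [OF rhom_poly rhom_theta]] rhom_id])
       (simp_all add: rhom_mconst rhom_simps [OF rhom_msub [OF rhom_mconst]])
  moreover have "msub mconst (\<lambda>i. pvar i - mconst (p i)) 0 = 0" by (simp add: msub_def)
  moreover assume "theta p F = 0"
  ultimately show "F = 0" by simp
qed simp

lemma poly_theta_0: "poly (theta p F) 0 = mconst (peval F p)"
  by (rule mpol_hom_eq [OF rhom_comp [OF rhom_poly rhom_theta] rhom_comp [OF rhom_mconst rhom_peval]]) simp_all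

lemma theta_cong_bihom:
  "bihom n a b F \<Longrightarrow> (\<And>i. i \<in> blocks n \<Longrightarrow> p i = q i) \<Longrightarrow> theta p F = theta q F"
  unfolding theta_def by (erule msub_cong_bihom) simp

text \<open>
  When \<open>u j\<close> is an eigenvector of the Euler operator of \<open>j\<close>, the substitution commutes with this operator,
  which therefore preserves the order in \<open>\<tau>\<close>.
\<close>
lemma tau_dvd_reweight_psub:
  assumes "tau ^ m dvd psub u F" "eulerp j (u j) = u j" "u j \<noteq> 0" "\<And>i. i \<noteq> j \<Longrightarrow> eulerp j (u i) = 0"
  shows "tau ^ m dvd psub u (reweight (\<lambda>e. of_nat (lookup e j) - c) F)"
proof -
  have "u j * psub u (euler j F) = u j * eulerp j (psub u F)"
    using euler_psub [of j u F] assms by simp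
  then have "psub u (euler j F) = eulerp j (psub u F)" using assms(3) by simp
  then show ?thesis
    using tau_dvd_eulerp [OF assms(1)] assms(1)
    by (auto simp: reweight_euler_diff intro!: dvd_diff dvd_smult)
qed

definition unit_point :: "nat \<Rightarrow> nat \<Rightarrow> nat \<Rightarrow> 'a::field" where
  "unit_point a b = (\<lambda>j. if j = a \<or> j = b then 1 else 0)"

lemma bideg_weight_unit_point:
  assumes "bideg n d1 d2 e" "a \<in> block1 n" "b \<in> block2 n"
  shows "(\<Sum>i\<in>keys e. (if i = a \<or> i = b then 0 else 1) * lookup e i) + lookup e a + lookup e b = d1 + d2"
proof -
  have ab: "a \<noteq> b" using assms block_disjointD by blast
  have "(\<Sum>i\<in>keys e. (if i = a \<or> i = b then 0 else 1) * lookup e i)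
      = (\<Sum>i\<in>blocks n. (if i = a \<or> i = b then 0 else 1) * lookup e i)"
    using assms by (intro sum.mono_neutral_left) (auto simp: bideg_def in_keys_iff)
  moreover have "\<dots> + (\<Sum>i\<in>blocks n. (if i = a then lookup e i else 0))
         + (\<Sum>i\<in>blocks n. (if i = b then lookup e i else 0)) =
      (\<Sum>i\<in>blocks n. lookup e i)"
    unfolding sum.distrib [symmetric] using ab by (intro sum.cong) auto
  moreover have "(\<Sum>i\<in>blocks n. lookup e i) = d1 + d2"
    using assms by (subst sum.union_disjoint) (auto simp: bideg_def block_disjoint)
  ultimately show ?thesis using assms by simp
qed

lemma theta_unit_point_monom_of:
  fixes a b :: nat and e :: "nat \<Rightarrow>\<^sub>0 nat"
  defines "q \<equiv> (\<lambda>i. if i = a \<or> i = b then [:1, pvar i:] else [:pvar i:]) :: nat \<Rightarrow> 'a::field mpol poly"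
  shows "theta (unit_point a b) (monom_of e) =
     tau ^ (\<Sum>i\<in>keys e. (if i = a \<or> i = b then 0 else 1) * lookup e i) * (\<Prod>i\<in>keys e. q i ^ lookup e i)"
    and "poly (\<Prod>i\<in>keys e. q i ^ lookup e i) 0 \<noteq> 0"
proof -
  show "theta (unit_point a b) (monom_of e) =
     tau ^ (\<Sum>i\<in>keys e. (if i = a \<or> i = b then 0 else 1) * lookup e i) * (\<Prod>i\<in>keys e. q i ^ lookup e i)"
    unfolding theta_def by (rule psub_monom_of) (simp add: q_def unit_point_def)
  show "poly (\<Prod>i\<in>keys e. q i ^ lookup e i) 0 \<noteq> 0"
    by (simp add: poly_prod q_def)
qed

text \<open>
  At a coordinate point the order of \<open>G\<close> is the least order of its monomials: the condition is stable
  under the Euler operators of all variables other than \<open>a\<close> and \<open>b\<close>, and the exponents of these variables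
  determine a monomial of given bidegree. Hence the monomial \<open>e0\<close> alone satisfies the condition.
\<close>
lemma monomial_bound:
  fixes G :: "'a::field_char_0 mpol"
  assumes G: "bihom n d1 d2 G" and ab: "a \<in> block1 n" "b \<in> block2 n"
    and m: "tau ^ m dvd theta (unit_point a b) G" and e0: "e0 \<in> keys G"
  shows "lookup e0 a + lookup e0 b + m \<le> d1 + d2"
proof -
  define L where "L = {G :: 'a mpol. bihom n d1 d2 G \<and> tau ^ m dvd theta (unit_point a b) G}"
  have "\<exists>G'\<in>L. e0 \<in> keys G' \<and> keys G' \<subseteq> {e \<in> keys G. \<forall>j\<in>- {a, b}. lookup e j = lookup e0 j}"
  proof (rule isolate_euler)
    show "G \<in> L" "e0 \<in> keys G" using G m e0 by (auto simp: L_def)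
    fix j and c :: 'a and F :: "'a mpol" assume j: "j \<in> - {a, b}" and F: "F \<in> L"
    let ?F = "reweight (\<lambda>e. of_nat (lookup e j) - c) F"
    have "tau ^ m dvd theta (unit_point a b) ?F"
      unfolding theta_def
      by (rule tau_dvd_reweight_psub)
         (use F j in \<open>auto simp: L_def theta_def unit_point_def map_poly_pCons euler_pvar\<close>)
    then show "?F \<in> L" using F by (auto simp: L_def intro: bihom_reweight)
  qed
  then obtain G' where G': "G' \<in> L" "e0 \<in> keys G'"
    and agree: "\<And>e. e \<in> keys G' \<Longrightarrow> e \<in> keys G \<and> (\<forall>j\<in>- {a, b}. lookup e j = lookup e0 j)" by blast
  have "keys G' \<subseteq> {e0}"
  proof
    fix e assume "e \<in> keys G'"
    then have e: "bideg n d1 d2 e" and be0: "bideg n d1 d2 e0"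
      and *: "\<And>j. j \<noteq> a \<Longrightarrow> j \<noteq> b \<Longrightarrow> lookup e j = lookup e0 j"
      using agree G e0 by (auto simp: bihom_iff)
    have blk1: "lookup e j = lookup e0 j" if "j \<in> block1 n" "j \<noteq> a" for j
      using ab block_disjointD(1) [OF that(1)] that by (intro *) auto
    have blk2: "lookup e j = lookup e0 j" if "j \<in> block2 n" "j \<noteq> b" for j
      using ab block_disjointD(2) [OF that(1)] that by (intro *) auto
    have "(\<Sum>i\<in>block1 n. lookup e i) = lookup e a + (\<Sum>i\<in>block1 n - {a}. lookup e0 i)"
      using ab blk1 by (subst sum.remove [of _ a]) (auto intro!: sum.cong)
    moreover have "(\<Sum>i\<in>block1 n. lookup e0 i) = lookup e0 a + (\<Sum>i\<in>block1 n - {a}. lookup e0 i)"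
      using ab by (subst sum.remove [of _ a]) auto
    ultimately have 1: "lookup e a = lookup e0 a" using e be0 by (simp add: bideg_def)
    have "(\<Sum>i\<in>block2 n. lookup e i) = lookup e b + (\<Sum>i\<in>block2 n - {b}. lookup e0 i)"
      using ab blk2 by (subst sum.remove [of _ b]) (auto intro!: sum.cong)
    moreover have "(\<Sum>i\<in>block2 n. lookup e0 i) = lookup e0 b + (\<Sum>i\<in>block2 n - {b}. lookup e0 i)"
      using ab by (subst sum.remove [of _ b]) auto
    ultimately have 2: "lookup e b = lookup e0 b" using e be0 by (simp add: bideg_def)
    show "e \<in> {e0}" using * 1 2 by (metis poly_mapping_eqI singletonI)
  qed
  then have "G' = mconst (lookup G' e0) * monom_of e0" by (rule keys_eq_singletonD)
  then have "tau ^ m dvd theta (unit_point a b) (mconst (lookup G' e0) * monom_of e0)"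
    using G' by (simp add: L_def)
  then have dvd: "tau ^ m dvd [:mconst (lookup G' e0):] * theta (unit_point a b) (monom_of e0)" by simp
  have "tau ^ m dvd theta (unit_point a b) (monom_of e0 :: 'a mpol)"
    by (rule tau_power_dvd_mult_cancel [OF dvd]) (use G' in \<open>simp add: in_keys_iff\<close>)
  then have "m \<le> (\<Sum>i\<in>keys e0. (if i = a \<or> i = b then 0 else 1) * lookup e0 i)"
    unfolding theta_unit_point_monom_of(1)
    by (rule tau_power_dvd_le) (rule theta_unit_point_monom_of(2))
  then show ?thesis
    using bideg_weight_unit_point [of n d1 d2 e0 a b] ab e0 G by (auto simp: bihom_iff)
qed

lemma monomial_bound_converse:
  fixes G :: "'a::field_char_0 mpol"
  assumes G: "bihom n d1 d2 G" and ab: "a \<in> block1 n" "b \<in> block2 n"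
    and bnd: "\<And>e. e \<in> keys G \<Longrightarrow> lookup e a + lookup e b + m \<le> d1 + d2"
  shows "tau ^ m dvd theta (unit_point a b) G"
proof -
  have "tau ^ m dvd theta (unit_point a b) (mconst (lookup G e) * monom_of e)" if e: "e \<in> keys G" for e
  proof -
    have "m \<le> (\<Sum>i\<in>keys e. (if i = a \<or> i = b then 0 else 1) * lookup e i)"
      using bnd [OF e] bideg_weight_unit_point [of n d1 d2 e a b] ab e G by (auto simp: bihom_iff)
    then have "tau ^ m dvd (tau ^ (\<Sum>i\<in>keys e. (if i = a \<or> i = b then 0 else 1) * lookup e i) :: 'a mpol poly)"
      by (rule le_imp_power_dvd)
    then show ?thesis by (auto simp: theta_unit_point_monom_of(1) intro!: dvd_smult dvd_mult2)
  qed
  then have "tau ^ m dvd (\<Sum>e\<in>keys G. theta (unit_point a b) (mconst (lookup G e) * monom_of e))"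
    by (rule dvd_sum)
  also have "\<dots> = theta (unit_point a b) (\<Sum>e\<in>keys G. single e (lookup G e))"
    by (simp add: single_conv_monom)
  also have "(\<Sum>e\<in>keys G. single e (lookup G e)) = G" by (rule poly_mapping_expand [symmetric])
  finally show ?thesis .
qed

section \<open>Lowering the exponent of the last coordinate\<close>

lemma keys_pvar_mult:
  "e \<in> keys (pvar j * F) \<Longrightarrow> \<exists>d\<in>keys F. e = d + single j 1"
  using Poly_Mapping.keys_mult [of "pvar j" F] by (auto simp: pvar_def add.commute)

lemma lookup_pvar_mult: "lookup (pvar j * F) (e + single j 1) = lookup F e"
proof -
  have "pvar j * F = (\<Sum>d\<in>keys F. single (d + single j 1) (lookup F d))"
    by (subst poly_mapping_expand [of F]) (simp add: sum_distrib_left pvar_def mult_single add.commute)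
  then have "lookup (pvar j * F) (e + single j 1) = (\<Sum>d\<in>keys F. if d = e then lookup F d else 0)"
    by (auto simp: lookup_sum lookup_single when_def intro!: sum.cong)
  then show ?thesis by (auto simp: in_keys_iff)
qed

text \<open>
  The witness \<open>H\<close> is \<open>x\<^sub>j G / x\<^sub>k\<close>.
\<close>
lemma exchange_variable:
  assumes "\<And>e. e \<in> keys G \<Longrightarrow> lookup e k \<ge> 1"
  shows "\<exists>H. pvar k * H = pvar j * G"
proof -
  define H where "H = (\<Sum>e\<in>keys G. single (e - single k 1 + single j 1) (lookup G e))"
  have "pvar k * H = (\<Sum>e\<in>keys G. single (e + single j 1) (lookup G e))"
    unfolding H_def sum_distrib_left
  proof (intro sum.cong refl)
    fix e assume e: "e \<in> keys G"
    have "single k 1 + (e - single k 1 + single j 1) = e + single j 1"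
      using assms [OF e] by (intro poly_mapping_eqI) (auto simp: lookup_add lookup_minus lookup_single when_def)
    then show "pvar k * single (e - single k 1 + single j 1) (lookup G e) = single (e + single j 1) (lookup G e)"
      by (simp add: pvar_def mult_single)
  qed
  also have "\<dots> = pvar j * G"
    by (subst (3) poly_mapping_expand [of G]) (simp add: sum_distrib_left pvar_def mult_single add.commute)
  finally show ?thesis by blast
qed

text \<open>
  The conditions on a section written in adapted coordinates: at the points of \<open>I\<close>, which are coordinate
  points, on the exponents; at the other points \<open>P q\<close> on the order of vanishing.
\<close>
definition admissible where
  "admissible n d1 d2 I s1 s2 m Q mq P G \<longleftrightarrow> bihom n d1 d2 G \<and>
     (\<forall>i\<in>I. \<forall>e\<in>keys G. int (lookup e (s1 i) + lookup e (s2 i)) + m i \<le> int (d1 + d2)) \<and>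
     (\<forall>q\<in>Q. tau ^ mq q dvd theta (P q) G)"

text \<open>
  First pass to a polynomial whose monomials all agree with \<open>e0\<close> in the second block: since the points \<open>P q\<close>
  have only the \<open>N\<close>-th coordinate in this block, the Euler operators of its other variables preserve
  admissibility. If the conditions were sharp for \<open>e0\<close> at all points of \<open>I\<close>, adding them up would give the value
  \<open>(\<Sum>i\<in>I. m i) - n (d1 + d2)\<close> for the last exponent, which is too small. So there is slack at some
  \<open>i\<close>, and \<open>y\<^sub>i / y\<^sub>N\<close> can be applied after the monomials without slack at \<open>i\<close> have been killed.
\<close>
lemma lower_last_exponent_step:
  fixes G :: "'a::field_char_0 mpol"
  assumes s1: "bij_betw s1 I (block1 n)" and s2: "bij_betw s2 I (block2 n - {N})" and N: "N \<in> block2 n"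
    and P: "\<And>q j. q \<in> Q \<Longrightarrow> j \<in> block2 n - {N} \<Longrightarrow> P q j = 0" "\<And>q. q \<in> Q \<Longrightarrow> P q N \<noteq> 0"
    and G: "admissible n d1 d2 I s1 s2 m Q mq P G" and e0: "e0 \<in> keys G"
    and big: "int (lookup e0 N) > max 0 ((\<Sum>i\<in>I. m i) - int n * int (d1 + d2))"
  shows "\<exists>G' e. admissible n d1 d2 I s1 s2 m Q mq P G' \<and> e \<in> keys G' \<and> lookup e N < lookup e0 N"
proof -
  let ?adm = "admissible n d1 d2 I s1 s2 m Q mq P"
  have s1b: "s1 i \<in> block1 n" if "i \<in> I" for i using s1 that by (auto simp: bij_betw_def)
  have s2b: "s2 i \<in> block2 n" "s2 i \<noteq> N" if "i \<in> I" for i using s2 that by (auto simp: bij_betw_def)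
  have cardI: "card I = n + 1" using bij_betw_same_card [OF s1] by (simp add: card_block)
  have be0: "bideg n d1 d2 e0" using G e0 by (simp add: admissible_def bihom_iff)
  have "\<exists>G'\<in>{G. ?adm G}. e0 \<in> keys G' \<and> keys G' \<subseteq> {e \<in> keys G. \<forall>j\<in>block2 n - {N}. lookup e j = lookup e0 j}"
  proof (rule isolate_euler)
    show "G \<in> {G. ?adm G}" "e0 \<in> keys G" using G e0 by auto
    fix j and c :: 'a and F :: "'a mpol" assume j: "j \<in> block2 n - {N}" and "F \<in> {G. ?adm G}"
    then have F: "?adm F" by simp
    let ?F = "reweight (\<lambda>e. of_nat (lookup e j) - c) F"
    have "tau ^ mq q dvd theta (P q) ?F" if "q \<in> Q" for q
      unfolding theta_def
      by (rule tau_dvd_reweight_psub)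
         (use F j P that in \<open>auto simp: admissible_def theta_def map_poly_pCons euler_pvar\<close>)
    then show "?F \<in> {G. ?adm G}" using F by (auto simp: admissible_def keys_reweight intro: bihom_reweight)
  qed
  then obtain G1 where G1: "?adm G1" "e0 \<in> keys G1"
    and agree: "\<And>e j. e \<in> keys G1 \<Longrightarrow> j \<in> block2 n - {N} \<Longrightarrow> lookup e j = lookup e0 j" by blast
  have agreeN: "lookup e N = lookup e0 N" if e: "e \<in> keys G1" for e
  proof -
    have "bideg n d1 d2 e" using G1 e by (simp add: admissible_def bihom_iff)
    moreover have "(\<Sum>j\<in>block2 n. lookup e j) = lookup e N + (\<Sum>j\<in>block2 n - {N}. lookup e0 j)"
      using N agree [OF e] by (subst sum.remove [of _ N]) auto
    moreover have "(\<Sum>j\<in>block2 n. lookup e0 j) = lookup e0 N + (\<Sum>j\<in>block2 n - {N}. lookup e0 j)"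
      using N by (subst sum.remove [of _ N]) auto
    ultimately show ?thesis using be0 by (simp add: bideg_def)
  qed
  have "\<exists>i\<in>I. int (lookup e0 (s1 i) + lookup e0 (s2 i)) + m i < int (d1 + d2)"
  proof (rule ccontr)
    assume neg: "\<not> (\<exists>i\<in>I. int (lookup e0 (s1 i) + lookup e0 (s2 i)) + m i < int (d1 + d2))"
    have "int (lookup e0 (s1 i) + lookup e0 (s2 i)) + m i = int (d1 + d2)" if "i \<in> I" for i
      using neg G e0 that by (fastforce simp: admissible_def)
    then have "(\<Sum>i\<in>I. int (lookup e0 (s1 i) + lookup e0 (s2 i)) + m i) = int (n + 1) * int (d1 + d2)"
      using cardI by simp
    moreover have "(\<Sum>i\<in>I. int (lookup e0 (s1 i) + lookup e0 (s2 i)) + m i) =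
        (\<Sum>i\<in>I. int (lookup e0 (s1 i))) + (\<Sum>i\<in>I. int (lookup e0 (s2 i))) + (\<Sum>i\<in>I. m i)"
      by (simp add: sum.distrib)
    moreover have "(\<Sum>i\<in>I. lookup e0 (s1 i)) = d1"
      using sum.reindex_bij_betw [OF s1, of "lookup e0"] be0 by (simp add: bideg_def)
    then have "(\<Sum>i\<in>I. int (lookup e0 (s1 i))) = int d1" by (metis of_nat_sum)
    moreover have "(\<Sum>i\<in>I. lookup e0 (s2 i)) + lookup e0 N = d2"
      using sum.reindex_bij_betw [OF s2, of "lookup e0"] be0 N sum.remove [of "block2 n" N "lookup e0"]
      by (simp add: bideg_def)
    then have "(\<Sum>i\<in>I. int (lookup e0 (s2 i))) + int (lookup e0 N) = int d2" by (metis of_nat_sum of_nat_add)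
    ultimately have "(\<Sum>i\<in>I. m i) - int n * int (d1 + d2) = int (lookup e0 N)" by (simp add: algebra_simps)
    then show False using big by simp
  qed
  then obtain i where i: "i \<in> I" "int (lookup e0 (s1 i) + lookup e0 (s2 i)) + m i < int (d1 + d2)" by blast
  \<comment> \<open>The largest exponent of \<open>x\<^sub>i\<close> that the condition at \<open>i\<close> allows next to the common exponent of \<open>y\<^sub>i\<close>.\<close>
  define g where "g = int (d1 + d2) - m i - int (lookup e0 (s2 i))"
  define w where "w = (\<lambda>e. of_nat (lookup e (s1 i)) - of_int g :: 'a)"
  define G2 where "G2 = reweight w G1"
  have w_eq_0: "w e = 0 \<longleftrightarrow> int (lookup e (s1 i)) = g" for e
  proof -
    have "(of_nat (lookup e (s1 i)) :: 'a) = of_int (int (lookup e (s1 i)))" by simp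
    then show ?thesis unfolding w_def by (simp only: right_minus_eq of_int_eq_iff)
  qed
  have keysG2: "keys G2 = {e \<in> keys G1. int (lookup e (s1 i)) \<noteq> g}"
    unfolding G2_def keys_reweight w_eq_0 ..
  have "lookup e N \<ge> 1" if "e \<in> keys G2" for e using that agreeN big by (auto simp: keysG2)
  then obtain G3 where G3: "pvar N * G3 = pvar (s2 i) * G2" using exchange_variable by metis
  have keysG3: "\<exists>d\<in>keys G2. e + single N 1 = d + single (s2 i) 1" if "e \<in> keys G3" for e
  proof -
    have "e + single N 1 \<in> keys (pvar N * G3)" using that by (simp only: in_keys_iff lookup_pvar_mult not_False_eq_True)
    then show ?thesis unfolding G3 by (rule keys_pvar_mult)
  qed
  have neq: "s1 k \<noteq> N" "s1 k \<noteq> s2 l" if "k \<in> I" "l \<in> I" for k l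
    using s1b s2b N that block_disjointD by metis+
  have lk: "lookup e j + (1 when N = j) = lookup d j + (1 when s2 i = j)"
    if "e + single N 1 = d + single (s2 i) 1" for e d j
    using arg_cong [OF that, of "\<lambda>x. lookup x j"] by (simp add: lookup_add lookup_single)
  have "?adm G3"
    unfolding admissible_def
  proof (intro conjI ballI)
    show "bihom n d1 d2 G3"
      unfolding bihom_iff
    proof
      fix e assume "e \<in> keys G3"
      then obtain d where d: "d \<in> keys G2" "e + single N 1 = d + single (s2 i) 1" using keysG3 by blast
      have "bideg n d1 d2 d" using d G1 by (auto simp: keysG2 admissible_def bihom_iff)
      moreover have "bideg n 0 1 (single k 1)" if "k \<in> block2 n" for k
        using bihom_pvar2 [OF that, where 'a = 'a] by (simp add: bihom_iff pvar_def)
      ultimately have "bideg n (0 + d1) (1 + d2) (single N 1 + e)" "bideg n 0 1 (single N 1)"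
        using bideg_add [of n 0 1 "single (s2 i) 1" d1 d2 d] d s2b i N by (simp_all add: add.commute)
      then show "bideg n d1 d2 e" using bideg_add_cancel by blast
    qed
  next
    fix k e assume k: "k \<in> I" and "e \<in> keys G3"
    then obtain d where d: "d \<in> keys G2" "e + single N 1 = d + single (s2 i) 1" using keysG3 by blast
    have e1: "lookup e (s1 k) = lookup d (s1 k)"
      using lk [OF d(2), of "s1 k"] neq [OF k i(1)] by (auto simp: when_def)
    have e2: "lookup e (s2 k) = lookup d (s2 k) + (if k = i then 1 else 0)"
      using lk [OF d(2), of "s2 k"] s2b [OF k] i k bij_betw_imp_inj_on [OF s2] by (auto simp: when_def inj_on_eq_iff)
    have bd: "int (lookup d (s1 k) + lookup d (s2 k)) + m k \<le> int (d1 + d2)"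
      using d k G1 by (auto simp: keysG2 admissible_def)
    show "int (lookup e (s1 k) + lookup e (s2 k)) + m k \<le> int (d1 + d2)"
    proof (cases "k = i")
      case True
      have "int (lookup d (s1 i)) \<noteq> g" "lookup d (s2 i) = lookup e0 (s2 i)"
        using d agree i s2b by (auto simp: keysG2)
      then show ?thesis using bd e1 e2 True by (simp add: g_def)
    qed (use bd e1 e2 in simp)
  next
    fix q assume q: "q \<in> Q"
    let ?x = "pvar (s1 i) :: 'a mpol"
    have 1: "tau ^ mq q dvd theta (P q) G1" using G1 q by (simp add: admissible_def)
    \<comment> \<open>The operator costs at most a factor \<open>\<tau>\<close>; the factor \<open>y\<^sub>i\<close>, which vanishes at \<open>P q\<close>, gives it back, and \<open>y\<^sub>N\<close> is a unit there.\<close>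
    have eu: "eulerp (s1 i) (theta (P q) ?x) * theta (P q) (euler (s1 i) G1) =
        theta (P q) ?x * eulerp (s1 i) (theta (P q) G1)"
      using euler_psub [of "s1 i" "\<lambda>i. [:mconst (P q i), pvar i:]" G1]
      by (simp add: theta_def map_poly_pCons euler_pvar)
    have "eulerp (s1 i) (theta (P q) ?x) = [:0, ?x:]" by (simp add: map_poly_pCons euler_pvar)
    then have "tau ^ mq q dvd [:0, ?x:] * theta (P q) (euler (s1 i) G1)"
      using eu tau_dvd_eulerp [OF 1, of "s1 i"] by (metis dvd_mult)
    moreover have "theta (P q) G2 = theta (P q) (euler (s1 i) G1) - [:mconst (of_int g):] * theta (P q) G1"
      by (simp add: G2_def w_def reweight_euler_diff)
    then have "[:0, ?x:] * theta (P q) G2 = [:0, ?x:] * theta (P q) (euler (s1 i) G1)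
        - [:0, ?x:] * [:mconst (of_int g):] * theta (P q) G1"
      by (simp only: right_diff_distrib mult.assoc)
    ultimately have "tau ^ mq q dvd [:0, ?x:] * theta (P q) G2"
      using dvd_diff [OF _ dvd_mult [OF 1]] by metis
    then have "tau ^ mq q dvd [:0, ?x:] * theta (P q) G2 * [:pvar (s2 i):]" by (rule dvd_mult2)
    also have "[:0, ?x:] * theta (P q) G2 * [:pvar (s2 i):] = [:?x:] * ([:0, pvar (s2 i):] * theta (P q) G2)"
      by (simp add: mult_ac)
    also have "[:0, pvar (s2 i):] * theta (P q) G2 = theta (P q) (pvar N * G3)"
      unfolding G3 using P(1) [OF q] s2b i by simp
    also have "[:?x:] * theta (P q) (pvar N * G3) = ([:?x:] * theta (P q) (pvar N)) * theta (P q) G3"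
      by (simp only: theta_simps mult.assoc)
    finally show "tau ^ mq q dvd theta (P q) G3"
      by (rule tau_power_dvd_mult_cancel) (use P(2) [OF q] in simp)
  qed
  moreover have "\<exists>e\<in>keys G3. lookup e N < lookup e0 N"
  proof -
    have "e0 \<in> keys G2" using G1 i by (auto simp: keysG2 g_def)
    then have "G2 \<noteq> 0" by auto
    then have "pvar N * G3 \<noteq> 0" unfolding G3 by simp
    then obtain e where e: "e \<in> keys G3" by (metis keys_eq_empty ex_in_conv mult_zero_right)
    then obtain d where d: "d \<in> keys G2" "e + single N 1 = d + single (s2 i) 1" using keysG3 by blast
    have "lookup e N + 1 = lookup d N" using lk [OF d(2), of N] s2b i by (auto simp: when_def)
    moreover have "lookup d N = lookup e0 N" using agreeN d by (auto simp: keysG2)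
    ultimately show ?thesis using e by force
  qed
  ultimately show ?thesis by blast
qed

lemma lower_last_exponent:
  fixes G :: "'a::field_char_0 mpol"
  assumes s1: "bij_betw s1 I (block1 n)" and s2: "bij_betw s2 I (block2 n - {N})" and N: "N \<in> block2 n"
    and P: "\<And>q j. q \<in> Q \<Longrightarrow> j \<in> block2 n - {N} \<Longrightarrow> P q j = 0" "\<And>q. q \<in> Q \<Longrightarrow> P q N \<noteq> 0"
    and G: "admissible n d1 d2 I s1 s2 m Q mq P G" and "e \<in> keys G"
  shows "\<exists>G' e. admissible n d1 d2 I s1 s2 m Q mq P G' \<and> e \<in> keys G' \<and>
            int (lookup e N) \<le> max 0 ((\<Sum>i\<in>I. m i) - int n * int (d1 + d2))"
  using assms(6,7)
proof (induction "lookup e N" arbitrary: G e rule: less_induct)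
  case less
  show ?case
  proof (cases "int (lookup e N) > max 0 ((\<Sum>i\<in>I. m i) - int n * int (d1 + d2))")
    case True
    from lower_last_exponent_step [OF s1 s2 N P less.prems this] less.hyps show ?thesis by blast
  next
    case False
    then have "int (lookup e N) \<le> max 0 ((\<Sum>i\<in>I. m i) - int n * int (d1 + d2))" by (simp only: not_less)
    then show ?thesis using less.prems by blast
  qed
qed

section \<open>Coordinates adapted to the points\<close>

text \<open>
  The Steinitz exchange: \<open>B\<close> is a matrix with inverse \<open>L\<close> whose columns \<open>\<sigma> i\<close> are the given vectors. A new vector
  replaces a column outside \<open>\<sigma> ` I\<close> in which it has a nonzero coordinate \<open>c k\<close>.
\<close>
lemma extend_to_basis:
  fixes p :: "nat \<Rightarrow> nat \<Rightarrow> 'a::field"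
  assumes J: "finite J" and "finite I" "independent_in J p I"
  shows "\<exists>\<sigma> B L. inj_on \<sigma> I \<and> \<sigma> ` I \<subseteq> J \<and>
     (\<forall>j\<in>J. \<forall>k\<in>J. (\<Sum>l\<in>J. B j l * L l k) = (if j = k then 1 else 0)) \<and>
     (\<forall>j\<in>J. \<forall>k\<in>J. (\<Sum>l\<in>J. L j l * B l k) = (if j = k then 1 else 0)) \<and>
     (\<forall>i\<in>I. \<forall>j\<in>J. B j (\<sigma> i) = p i j)"
  using assms(2,3)
proof (induction I rule: finite_induct)
  case empty
  let ?D = "\<lambda>j k :: nat. if j = k then 1 else 0 :: 'a"
  have "(\<Sum>l\<in>J. ?D j l * ?D l k) = ?D j k" if "j \<in> J" for j k
  proof -
    have "(\<Sum>l\<in>J. ?D j l * ?D l k) = (\<Sum>l\<in>J. if j = l then ?D l k else 0)"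
      by (intro sum.cong) auto
    then show ?thesis using J that by simp
  qed
  then show ?case by (intro exI [of _ id] exI [of _ ?D]) simp
next
  case (insert i0 I)
  have "independent_in J p I"
    unfolding independent_in_def
  proof (intro allI impI ballI)
    fix c i assume c: "\<forall>j\<in>J. (\<Sum>i\<in>I. c i * p i j) = 0" and i: "i \<in> I"
    have eq: "(\<Sum>i\<in>insert i0 I. (c(i0 := 0)) i * p i j) = (\<Sum>i\<in>I. c i * p i j)" for j
      using insert.hyps by (auto intro!: sum.cong)
    have "\<forall>j\<in>J. (\<Sum>i\<in>insert i0 I. (c(i0 := 0)) i * p i j) = 0"
      using c by (simp only: eq)
    then have "\<forall>i\<in>insert i0 I. (c(i0 := 0)) i = 0"
      using insert.prems [unfolded independent_in_def, THEN spec, of "c(i0 := 0)"] by blast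
    then show "c i = 0" using i insert.hyps by (metis fun_upd_other insertCI)
  qed
  from insert.IH [OF this] obtain \<sigma> B L where inj: "inj_on \<sigma> I" "\<sigma> ` I \<subseteq> J"
    and BL_all: "\<forall>j\<in>J. \<forall>k\<in>J. (\<Sum>l\<in>J. B j l * L l k) = (if j = k then 1 else 0)"
    and LB_all: "\<forall>j\<in>J. \<forall>k\<in>J. (\<Sum>l\<in>J. L j l * B l k) = (if j = k then 1 else 0)"
    and Bp_all: "\<forall>i\<in>I. \<forall>j\<in>J. B j (\<sigma> i) = p i j"
    by (elim exE conjE) (rule that; assumption)
  note BL = BL_all [rule_format] and LB = LB_all [rule_format] and Bp = Bp_all [rule_format]
  define c where "c k = (\<Sum>j\<in>J. L k j * p i0 j)" for k
  have pB: "(\<Sum>k\<in>J. B j k * c k) = p i0 j" if j: "j \<in> J" for j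
  proof -
    have "(\<Sum>k\<in>J. B j k * c k) = (\<Sum>k\<in>J. \<Sum>m\<in>J. B j k * L k m * p i0 m)"
      by (simp add: c_def sum_distrib_left mult.assoc)
    also have "\<dots> = (\<Sum>m\<in>J. (\<Sum>k\<in>J. B j k * L k m) * p i0 m)"
      by (subst sum.swap) (simp add: sum_distrib_right)
    also have "\<dots> = (\<Sum>m\<in>J. if j = m then p i0 m else 0)"
      by (intro sum.cong refl) (simp add: BL j)
    finally show ?thesis using J j by simp
  qed
  have "\<exists>k\<in>J - \<sigma> ` I. c k \<noteq> 0"
  proof (rule ccontr)
    assume "\<not> (\<exists>k\<in>J - \<sigma> ` I. c k \<noteq> 0)"
    then have 0: "c k = 0" if "k \<in> J - \<sigma> ` I" for k using that by blast
    have p0: "p i0 j = (\<Sum>i\<in>I. c (\<sigma> i) * p i j)" if j: "j \<in> J" for j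
    proof -
      have "p i0 j = (\<Sum>k\<in>\<sigma> ` I. B j k * c k)"
        unfolding pB [OF j, symmetric]
        by (rule sum.mono_neutral_right) (use J inj 0 in auto)
      also have "\<dots> = (\<Sum>i\<in>I. c (\<sigma> i) * p i j)"
        by (subst sum.reindex [OF inj(1)]) (simp add: Bp j mult.commute)
      finally show ?thesis .
    qed
    let ?d = "\<lambda>i. if i = i0 then - 1 else c (\<sigma> i)"
    have eq: "(\<Sum>i\<in>I. ?d i * p i j) = (\<Sum>i\<in>I. c (\<sigma> i) * p i j)" for j
      by (intro sum.cong refl) (use insert.hyps in auto)
    have "(\<Sum>i\<in>insert i0 I. ?d i * p i j) = 0" if "j \<in> J" for j
      using p0 [OF that] insert.hyps by (simp add: eq)
    then have "\<forall>i\<in>insert i0 I. ?d i = 0"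
      using insert.prems [unfolded independent_in_def, THEN spec, of ?d] by blast
    then show False by simp
  qed
  then obtain k where k: "k \<in> J" "k \<notin> \<sigma> ` I" "c k \<noteq> 0" by blast
  \<comment> \<open>Exchanging the column \<open>k\<close> of \<open>B\<close> changes the inverse by a row operation with pivot \<open>c k\<close>.\<close>
  define B' where "B' j l = (if l = k then p i0 j else B j l)" for j l
  define L' where "L' l j = (if l = k then L k j / c k else L l j - c l / c k * L k j)" for l j
  have BL': "(\<Sum>l\<in>J. B' j l * L' l m) = (if j = m then 1 else 0)" if j: "j \<in> J" and m: "m \<in> J" for j m
  proof -
    define x where "x = L k m / c k"
    have "(\<Sum>l\<in>J. B' j l * L' l m) = p i0 j * x + (\<Sum>l\<in>J - {k}. B j l * L l m - B j l * c l * x)"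
      using J k by (subst sum.remove [of _ k]) (auto simp: B'_def L'_def x_def algebra_simps intro!: sum.cong)
    also have "(\<Sum>l\<in>J - {k}. B j l * L l m - B j l * c l * x)
        = (\<Sum>l\<in>J. B j l * L l m) - B j k * L k m - ((\<Sum>l\<in>J. B j l * c l) - B j k * c k) * x"
      using J k by (simp add: sum_subtractf sum_diff1 sum_distrib_right left_diff_distrib)
    finally have "(\<Sum>l\<in>J. B' j l * L' l m)
        = p i0 j * x + ((if j = m then 1 else 0) - B j k * L k m - (p i0 j - B j k * c k) * x)"
      by (simp only: BL [OF j m] pB [OF j])
    moreover have "c k * x = L k m" using k by (simp add: x_def)
    ultimately show ?thesis by (simp add: left_diff_distrib mult.assoc)
  qed
  have LB': "(\<Sum>j\<in>J. L' l j * B' j m) = (if l = m then 1 else 0)" if l: "l \<in> J" and m: "m \<in> J" for l m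
  proof -
    have 1: "(\<Sum>j\<in>J. L' l j * x j) = (if l = k then (\<Sum>j\<in>J. L k j * x j) / c k
         else (\<Sum>j\<in>J. L l j * x j) - c l / c k * (\<Sum>j\<in>J. L k j * x j))" for x
      by (simp add: L'_def sum_divide_distrib sum_subtractf sum_distrib_left algebra_simps)
    show ?thesis
    proof (cases "m = k")
      case True
      then have "(\<Sum>j\<in>J. L' l j * B' j m) = (\<Sum>j\<in>J. L' l j * p i0 j)" by (simp add: B'_def)
      also have "\<dots> = (if l = k then 1 else 0)"
        unfolding 1 c_def [symmetric] using k by simp
      finally show ?thesis using True by simp
    next
      case False
      then have "(\<Sum>j\<in>J. L' l j * B' j m) = (\<Sum>j\<in>J. L' l j * B j m)" by (simp add: B'_def)
      also have "\<dots> = (if l = m then 1 else 0)"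
        unfolding 1 using k l m False by (simp add: LB)
      finally show ?thesis .
    qed
  qed
  show ?case
  proof (rule exI [of _ "\<sigma>(i0 := k)"], rule exI [of _ B'], rule exI [of _ L'], intro conjI ballI)
    show "inj_on (\<sigma>(i0 := k)) (insert i0 I)"
      using inj(1) k(2) insert.hyps by (auto simp: inj_on_def)
    show "(\<sigma>(i0 := k)) ` insert i0 I \<subseteq> J" using inj k insert.hyps by auto
    show "B' j ((\<sigma>(i0 := k)) i) = p i j" if "i \<in> insert i0 I" "j \<in> J" for i j
      using that k(2) Bp insert.hyps by (auto simp: B'_def)
  qed (use BL' LB' in auto)
qed

text \<open>
  The rows of a pair of matrices as linear forms in the variables of their block. Other variables are kept,
  so that the substitution is an automorphism of the whole polynomial ring.
\<close>
definition linform :: "nat \<Rightarrow> (nat \<Rightarrow> nat \<Rightarrow> 'a) \<Rightarrow> nat \<Rightarrow> 'a::field mpol" where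
  "linform n C j =
     (if j \<in> block1 n then \<Sum>k\<in>block1 n. mconst (C j k) * pvar k
      else if j \<in> block2 n then \<Sum>k\<in>block2 n. mconst (C j k) * pvar k
      else pvar j)"

lemma linform1: "j \<in> block1 n \<Longrightarrow> linform n C j = (\<Sum>k\<in>block1 n. mconst (C j k) * pvar k)"
  and linform2: "j \<in> block2 n \<Longrightarrow> linform n C j = (\<Sum>k\<in>block2 n. mconst (C j k) * pvar k)"
  and linform3: "j \<notin> block1 n \<Longrightarrow> j \<notin> block2 n \<Longrightarrow> linform n C j = pvar j"
  using block_disjointD [of j n] by (auto simp: linform_def)

lemma bihom_linform1: "j \<in> block1 n \<Longrightarrow> bihom n 1 0 (linform n C j)"
  and bihom_linform2: "j \<in> block2 n \<Longrightarrow> bihom n 0 1 (linform n C j)"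
  by (auto simp: linform1 linform2 intro!: bihom_sum bihom_mconst_mult bihom_pvar1 [simplified] bihom_pvar2 [simplified])

lemma linform_block:
  "J \<in> {block1 n, block2 n} \<Longrightarrow> j \<in> J \<Longrightarrow> linform n C j = (\<Sum>k\<in>J. mconst (C j k) * pvar k)"
  by (auto simp: linform1 linform2)

lemma linform_compose:
  assumes CD: "\<And>J j k. J \<in> {block1 n, block2 n} \<Longrightarrow> j \<in> J \<Longrightarrow> k \<in> J \<Longrightarrow>
     (\<Sum>l\<in>J. C j l * D l k) = (if j = k then 1 else 0)"
  shows "msub mconst (linform n D) (linform n C j) = pvar j"
proof (cases "j \<in> blocks n")
  case True
  then obtain J where J: "J \<in> {block1 n, block2 n}" and j: "j \<in> J" by auto
  have fin: "finite J" using J by auto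
  have "msub mconst (linform n D) (linform n C j) = (\<Sum>l\<in>J. mconst (C j l) * linform n D l)"
    by (simp add: linform_block [OF J j] rhom_simps [OF rhom_msub [OF rhom_mconst]] rhom_mconst)
  also have "\<dots> = (\<Sum>l\<in>J. mconst (C j l) * (\<Sum>k\<in>J. mconst (D l k) * pvar k))"
    by (intro sum.cong refl) (simp add: linform_block [OF J])
  also have "\<dots> = (\<Sum>k\<in>J. mconst (\<Sum>l\<in>J. C j l * D l k) * pvar k)"
    by (simp add: sum_distrib_left sum_distrib_right mconst_mult rhom_sum [OF rhom_mconst] mult.assoc)
       (rule sum.swap)
  also have "\<dots> = (\<Sum>k\<in>J. if j = k then pvar k else 0)"
    by (intro sum.cong refl) (simp add: CD [OF J j])
  finally show ?thesis using j fin by simp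
qed (simp add: linform3 rhom_mconst)

lemma bihom_msub:
  assumes F: "bihom n a b F" and u1: "\<And>i. i \<in> block1 n \<Longrightarrow> bihom n 1 0 (u i)"
    and u2: "\<And>i. i \<in> block2 n \<Longrightarrow> bihom n 0 1 (u i)"
  shows "bihom n a b (msub mconst u F)"
  unfolding msub_def
proof (intro bihom_sum bihom_mconst_mult)
  fix e assume "e \<in> keys F"
  then have e: "bideg n a b e" using F by (simp add: bihom_iff)
  have 1: "bihom n (\<Sum>i\<in>block1 n. 1 * lookup e i) (\<Sum>i\<in>block1 n. 0 * lookup e i) (\<Prod>i\<in>block1 n. u i ^ lookup e i)"
    by (intro bihom_prod bihom_power u1)
  have 2: "bihom n (\<Sum>i\<in>block2 n. 0 * lookup e i) (\<Sum>i\<in>block2 n. 1 * lookup e i) (\<Prod>i\<in>block2 n. u i ^ lookup e i)"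
    by (intro bihom_prod bihom_power u2)
  show "bihom n a b (\<Prod>i\<in>keys e. u i ^ lookup e i)"
    unfolding bideg_monomial_value [OF e]
    using bihom_mult [OF 1 2] e by (simp add: bideg_def)
qed

definition vanishes_on :: "'a::field mpol \<Rightarrow> (nat \<Rightarrow> 'a) set \<Rightarrow> bool" where
  "vanishes_on F V \<longleftrightarrow> (\<forall>z\<in>V. peval F z = 0)"

text \<open>
  \<open>B\<close> expresses the original coordinates by the adapted ones, \<open>L\<close> is its inverse. The point \<open>p i\<close> becomes the
  \<open>s1 i\<close>-th coordinate point of the first factor for \<open>i \<in> I\<close> and the \<open>s2 i\<close>-th one of the second for \<open>i \<in> I2\<close>.
  The set \<open>I2\<close> may be larger than \<open>I\<close> since the second factor has room for one more independent point.
\<close>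
locale adapted_coordinates =
  fixes n :: nat and p :: "nat \<Rightarrow> nat \<Rightarrow> 'a::field_char_0" and I I2 :: "nat set"
    and s1 s2 :: "nat \<Rightarrow> nat" and B L :: "nat \<Rightarrow> nat \<Rightarrow> 'a"
  assumes fin: "finite I2" "I \<subseteq> I2" "I \<noteq> {}"
    and inj1: "inj_on s1 I" and s1: "s1 ` I \<subseteq> block1 n"
    and inj2: "inj_on s2 I2" and s2: "s2 ` I2 \<subseteq> block2 n"
    and BL: "\<And>J j k. J \<in> {block1 n, block2 n} \<Longrightarrow> j \<in> J \<Longrightarrow> k \<in> J \<Longrightarrow>
       (\<Sum>l\<in>J. B j l * L l k) = (if j = k then 1 else 0)"
    and LB: "\<And>J j k. J \<in> {block1 n, block2 n} \<Longrightarrow> j \<in> J \<Longrightarrow> k \<in> J \<Longrightarrow>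
       (\<Sum>l\<in>J. L j l * B l k) = (if j = k then 1 else 0)"
    and B1: "\<And>i j. i \<in> I \<Longrightarrow> j \<in> block1 n \<Longrightarrow> B j (s1 i) = p i j"
    and B2: "\<And>i j. i \<in> I2 \<Longrightarrow> j \<in> block2 n \<Longrightarrow> B j (s2 i) = p i j"

lemma adapted_coordinates_exist:
  fixes p :: "nat \<Rightarrow> nat \<Rightarrow> 'a::field_char_0"
  assumes "finite I2" "I \<subseteq> I2" "I \<noteq> {}" "independent_in (block1 n) p I" "independent_in (block2 n) p I2"
  shows "\<exists>s1 s2 B L. adapted_coordinates n p I I2 s1 s2 B L"
proof -
  have "finite I" using assms finite_subset by blast
  obtain s1 B1 L1 where 1: "inj_on s1 I" "s1 ` I \<subseteq> block1 n"
     "\<forall>j\<in>block1 n. \<forall>k\<in>block1 n. (\<Sum>l\<in>block1 n. B1 j l * L1 l k) = (if j = k then 1 else 0)"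
     "\<forall>j\<in>block1 n. \<forall>k\<in>block1 n. (\<Sum>l\<in>block1 n. L1 j l * B1 l k) = (if j = k then 1 else 0)"
     "\<forall>i\<in>I. \<forall>j\<in>block1 n. B1 j (s1 i) = p i j"
    using extend_to_basis [OF _ \<open>finite I\<close> assms(4)] by auto
  obtain s2 B2 L2 where 2: "inj_on s2 I2" "s2 ` I2 \<subseteq> block2 n"
     "\<forall>j\<in>block2 n. \<forall>k\<in>block2 n. (\<Sum>l\<in>block2 n. B2 j l * L2 l k) = (if j = k then 1 else 0)"
     "\<forall>j\<in>block2 n. \<forall>k\<in>block2 n. (\<Sum>l\<in>block2 n. L2 j l * B2 l k) = (if j = k then 1 else 0)"
     "\<forall>i\<in>I2. \<forall>j\<in>block2 n. B2 j (s2 i) = p i j"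
    using extend_to_basis [OF _ assms(1,5)] by auto
  define B where "B j = (if j \<in> block1 n then B1 j else B2 j)" for j
  define L where "L j = (if j \<in> block1 n then L1 j else L2 j)" for j
  have B: "j \<in> block1 n \<Longrightarrow> B j = B1 j" "j \<in> block2 n \<Longrightarrow> B j = B2 j"
    and L: "j \<in> block1 n \<Longrightarrow> L j = L1 j" "j \<in> block2 n \<Longrightarrow> L j = L2 j" for j
    using block_disjointD by (auto simp: B_def L_def)
  have "adapted_coordinates n p I I2 s1 s2 B L"
    by (rule adapted_coordinates.intro) (use assms 1 2 in \<open>auto simp: B L cong: sum.cong\<close>)
  then show ?thesis by blast
qed

context adapted_coordinates
begin

abbreviation "to_adapted \<equiv> msub mconst (linform n B)"
abbreviation "of_adapted \<equiv> msub mconst (linform n L)"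
definition pt_adapted :: "(nat \<Rightarrow> 'a) \<Rightarrow> nat \<Rightarrow> 'a" where "pt_adapted z j = peval (linform n L j) z"
definition pt_original :: "(nat \<Rightarrow> 'a) \<Rightarrow> nat \<Rightarrow> 'a" where "pt_original z j = peval (linform n B j) z"

lemma rhom_to_adapted: "rhom to_adapted" and rhom_of_adapted: "rhom of_adapted"
  by (rule rhom_msub [OF rhom_mconst])+

lemma of_adapted_linform: "of_adapted (linform n B j) = pvar j"
  by (rule linform_compose) (rule BL)
lemma to_adapted_linform: "to_adapted (linform n L j) = pvar j"
  by (rule linform_compose) (rule LB)

lemma of_adapted_to_adapted [simp]: "of_adapted (to_adapted F) = F"
  by (rule mpol_hom_eq [OF rhom_comp [OF rhom_of_adapted rhom_to_adapted] rhom_id])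
     (simp_all add: rhom_mconst of_adapted_linform)
lemma to_adapted_of_adapted [simp]: "to_adapted (of_adapted F) = F"
  by (rule mpol_hom_eq [OF rhom_comp [OF rhom_to_adapted rhom_of_adapted] rhom_id])
     (simp_all add: rhom_mconst to_adapted_linform)

lemma to_adapted_eq_0_iff [simp]: "to_adapted F = 0 \<longleftrightarrow> F = 0"
  by (metis of_adapted_to_adapted rhom_0 rhom_of_adapted rhom_to_adapted)

lemma bihom_to_adapted: "bihom n a b F \<Longrightarrow> bihom n a b (to_adapted F)"
  and bihom_of_adapted: "bihom n a b F \<Longrightarrow> bihom n a b (of_adapted F)"
  by (erule bihom_msub; simp add: bihom_linform1 [simplified] bihom_linform2 [simplified])+

lemma peval_of_adapted: "peval (of_adapted G) z = peval G (pt_adapted z)"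
  by (rule mpol_hom_eq [OF rhom_comp [OF rhom_peval rhom_of_adapted] rhom_peval]) (simp_all add: rhom_mconst pt_adapted_def)
lemma peval_to_adapted: "peval (to_adapted F) z = peval F (pt_original z)"
  by (rule mpol_hom_eq [OF rhom_comp [OF rhom_peval rhom_to_adapted] rhom_peval]) (simp_all add: rhom_mconst pt_original_def)

lemma pt_original_adapted [simp]: "pt_original (pt_adapted z) = z"
  using peval_to_adapted [of "linform n L j" for j] peval_of_adapted [of "linform n B j" z for j]
  by (auto simp: pt_original_def of_adapted_linform)
lemma pt_adapted_original [simp]: "pt_adapted (pt_original z) = z"
  using peval_to_adapted [of "linform n L j" z for j] by (auto simp: pt_adapted_def to_adapted_linform)

lemma pt_adapted_linear:
  assumes J: "J \<in> {block1 n, block2 n}" "j \<in> J" and z: "\<forall>k\<in>J. z k = (\<Sum>i\<in>A. c i * q i k)"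
  shows "pt_adapted z j = (\<Sum>i\<in>A. c i * pt_adapted (q i) j)"
proof -
  have "pt_adapted z j = (\<Sum>k\<in>J. L j k * (\<Sum>i\<in>A. c i * q i k))" using z by (simp add: pt_adapted_def linform_block [OF J])
  also have "\<dots> = (\<Sum>i\<in>A. c i * (\<Sum>k\<in>J. L j k * q i k))"
    by (simp add: sum_distrib_left mult.left_commute) (rule sum.swap)
  finally show ?thesis by (simp add: pt_adapted_def linform_block [OF J])
qed

lemma pt_adapted_point1: "i \<in> I \<Longrightarrow> j \<in> block1 n \<Longrightarrow> pt_adapted (p i) j = (if j = s1 i then 1 else 0)"
  using LB [of "block1 n" j "s1 i"] s1 by (force simp: pt_adapted_def linform1 B1 [symmetric] intro: sum.cong)
lemma pt_adapted_point2: "i \<in> I2 \<Longrightarrow> j \<in> block2 n \<Longrightarrow> pt_adapted (p i) j = (if j = s2 i then 1 else 0)"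
  using LB [of "block2 n" j "s2 i"] s2 by (force simp: pt_adapted_def linform2 B2 [symmetric] intro: sum.cong)

lemma pt_adapted_point: "i \<in> I \<Longrightarrow> j \<in> blocks n \<Longrightarrow> pt_adapted (p i) j = unit_point (s1 i) (s2 i) j"
  using pt_adapted_point1 [of i j] pt_adapted_point2 [of i j] fin s1 s2 block_disjointD [of _ n]
  by (auto simp: unit_point_def)

lemma theta_to_adapted: "theta (pt_adapted z) (to_adapted F) = map_poly to_adapted (theta z F)"
proof (rule mpol_hom_eq [OF rhom_comp [OF rhom_theta rhom_to_adapted] rhom_comp [OF rhom_map_poly [OF rhom_to_adapted] rhom_theta]])
  fix i
  have lin: "(\<Sum>k\<in>J. [:mconst (B i k):] * [:mconst (pt_adapted z k), pvar k:])
      = [:mconst (\<Sum>k\<in>J. B i k * pt_adapted z k), \<Sum>k\<in>J. mconst (B i k) * pvar k:]" for J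
    by (induction J rule: infinite_finite_induct) (simp_all add: mconst_add mconst_mult)
  have "theta (pt_adapted z) (linform n B i) = [:mconst (pt_original (pt_adapted z) i), linform n B i:]"
  proof -
    consider "i \<in> block1 n" | "i \<in> block2 n" | "i \<notin> block1 n" "i \<notin> block2 n" by blast
    then show ?thesis
      by cases (use lin in \<open>simp_all add: linform1 linform2 linform3 pt_original_def del: pt_original_adapted\<close>)
  qed
  then show "theta (pt_adapted z) (to_adapted (pvar i)) = map_poly to_adapted (theta z (pvar i))"
    by (simp add: rhom_mconst map_poly_pCons rhom_0 [OF rhom_to_adapted])
qed (simp add: rhom_mconst map_poly_pCons rhom_0 [OF rhom_to_adapted])

lemma tau_dvd_theta_to_adapted: "tau ^ m dvd theta z F \<longleftrightarrow> tau ^ m dvd theta (pt_adapted z) (to_adapted F)"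
  unfolding theta_to_adapted tau_power_dvd_iff by (simp add: coeff_map_poly rhom_0 [OF rhom_to_adapted])

lemma monomial_bound_to_adapted:
  assumes "bihom n d1 d2 F" "i \<in> I" "tau ^ m dvd theta (p i) F" "e \<in> keys (to_adapted F)"
  shows "lookup e (s1 i) + lookup e (s2 i) + m \<le> d1 + d2"
proof (rule monomial_bound [OF bihom_to_adapted [OF assms(1)]])
  show "s1 i \<in> block1 n" "s2 i \<in> block2 n" using assms(2) fin s1 s2 by auto
  show "tau ^ m dvd theta (unit_point (s1 i) (s2 i)) (to_adapted F)"
    using iffD1 [OF tau_dvd_theta_to_adapted assms(3)] theta_cong_bihom [OF bihom_to_adapted [OF assms(1)] pt_adapted_point [OF assms(2)]]
    by simp
qed fact

subsection \<open>The bilinear span in adapted coordinates\<close>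

text \<open>
  The coordinates whose common zero locus is the bilinear span.
\<close>
definition rest :: "nat set" where "rest = (block1 n - s1 ` I) \<union> (block2 n - s2 ` I)"

lemma pt_adapted_span_0:
  assumes "z \<in> bilinear_span n p I" "j \<in> rest" shows "pt_adapted z j = 0"
proof -
  obtain c d where "\<forall>j\<in>block1 n. z j = (\<Sum>i\<in>I. c i * p i j)" "\<forall>j\<in>block2 n. z j = (\<Sum>i\<in>I. d i * p i j)"
    using assms(1) by (auto simp: bilinear_span_def)
  then have "j \<in> block1 n \<Longrightarrow> pt_adapted z j = (\<Sum>i\<in>I. c i * pt_adapted (p i) j)" "j \<in> block2 n \<Longrightarrow> pt_adapted z j = (\<Sum>i\<in>I. d i * pt_adapted (p i) j)"
    using pt_adapted_linear [where J = "block1 n" and j = j and z = z and A = I and c = c and q = p]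
      pt_adapted_linear [where J = "block2 n" and j = j and z = z and A = I and c = d and q = p] by auto
  moreover have "pt_adapted (p i) j = 0" if i: "i \<in> I" for i
  proof -
    have "i \<in> I2" using i fin by blast
    from assms(2) consider "j \<in> block1 n" "j \<noteq> s1 i" | "j \<in> block2 n" "j \<noteq> s2 i"
      using i by (auto simp: rest_def)
    then show ?thesis by cases (simp_all add: pt_adapted_point1 pt_adapted_point2 i \<open>i \<in> I2\<close>)
  qed
  ultimately show ?thesis using assms(2) by (auto simp: rest_def)
qed

lemma span_if_pt_adapted_0:
  assumes z: "z \<in> biproj n" and 0: "\<And>j. j \<in> rest \<Longrightarrow> pt_adapted z j = 0"
  shows "z \<in> bilinear_span n p I"
proof -
  have expand: "z j = (\<Sum>i\<in>I. pt_adapted z (\<sigma> i) * p i j)"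
    if J: "J \<in> {block1 n, block2 n}" "j \<in> J" and \<sigma>: "inj_on \<sigma> I" "\<sigma> ` I \<subseteq> J" "J - \<sigma> ` I \<subseteq> rest"
      and Bp: "\<And>i. i \<in> I \<Longrightarrow> B j (\<sigma> i) = p i j" for J j \<sigma>
  proof -
    have fin: "finite J" using J by auto
    have "z j = (\<Sum>k\<in>J. B j k * pt_adapted z k)"
      using fun_cong [OF pt_original_adapted [of z], of j] by (simp add: pt_original_def linform_block [OF J] del: pt_original_adapted)
    also have "\<dots> = (\<Sum>k\<in>\<sigma> ` I. B j k * pt_adapted z k)"
      by (rule sum.mono_neutral_right) (use \<sigma> 0 fin in auto)
    finally show ?thesis by (simp add: sum.reindex [OF \<sigma>(1)] Bp mult.commute)
  qed
  have c1: "z j = (\<Sum>i\<in>I. pt_adapted z (s1 i) * p i j)" if "j \<in> block1 n" for j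
    by (rule expand [OF _ that inj1 s1]) (auto simp: rest_def B1 that)
  have c2: "z j = (\<Sum>i\<in>I. pt_adapted z (s2 i) * p i j)" if "j \<in> block2 n" for j
    by (rule expand [OF _ that inj_on_subset [OF inj2 fin(2)]])
       (use s2 fin that in \<open>auto simp: rest_def B2 subset_iff\<close>)
  have "\<exists>c. \<forall>j\<in>block1 n. z j = (\<Sum>i\<in>I. c i * p i j)"
    by (rule exI [of _ "\<lambda>i. pt_adapted z (s1 i)"]) (simp add: c1)
  moreover have "\<exists>c. \<forall>j\<in>block2 n. z j = (\<Sum>i\<in>I. c i * p i j)"
    by (rule exI [of _ "\<lambda>i. pt_adapted z (s2 i)"]) (simp add: c2)
  ultimately show ?thesis using z by (simp add: bilinear_span_def)
qed

abbreviation "span_restrict \<equiv> msub mconst (\<lambda>j. if j \<in> rest then 0 else pvar j)"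

lemma rhom_span_restrict: "rhom span_restrict" by (rule rhom_msub [OF rhom_mconst])

lemma peval_span_restrict: "peval (span_restrict G) X = peval G (\<lambda>j. if j \<in> rest then 0 else X j)"
  by (rule mpol_hom_eq [OF rhom_comp [OF rhom_peval rhom_span_restrict] rhom_peval]) (simp_all add: rhom_mconst)

text \<open>
  A point with generic values of the free coordinates lies in \<open>biproj n\<close>, hence on the span; multiplying by one
  free coordinate of each block disposes of the points for which a block vanishes.
\<close>
lemma vanishes_on_span_iff:
  assumes A: "bihom n a b A"
  shows "vanishes_on A (bilinear_span n p I) \<longleftrightarrow> span_restrict (to_adapted A) = 0"
proof
  assume 0: "span_restrict (to_adapted A) = 0"
  show "vanishes_on A (bilinear_span n p I)"
    unfolding vanishes_on_def
  proof
    fix z assume z: "z \<in> bilinear_span n p I"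
    have "peval A z = peval (to_adapted A) (pt_adapted z)" by (simp add: peval_to_adapted)
    also have "pt_adapted z = (\<lambda>j. if j \<in> rest then 0 else pt_adapted z j)" using pt_adapted_span_0 [OF z] by auto
    also have "peval (to_adapted A) \<dots> = peval (span_restrict (to_adapted A)) (pt_adapted z)" by (simp add: peval_span_restrict)
    finally show "peval A z = 0" using 0 by simp
  qed
next
  assume van: "vanishes_on A (bilinear_span n p I)"
  obtain i where i: "i \<in> I" using fin by blast
  have ab: "s1 i \<in> block1 n" "s2 i \<in> block2 n" "s1 i \<notin> rest" "s2 i \<notin> rest"
    using i fin s1 s2 block_disjointD [of _ n] by (auto simp: rest_def)
  have "span_restrict (to_adapted A) * pvar (s1 i) * pvar (s2 i) = 0"
  proof (rule mpol_eq_0I)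
    fix X
    show "peval (span_restrict (to_adapted A) * pvar (s1 i) * pvar (s2 i)) X = 0"
    proof (cases "X (s1 i) = 0 \<or> X (s2 i) = 0")
      case False
      define Y where "Y = (\<lambda>j. if j \<in> rest then 0 else X j)"
      define z where "z = (\<lambda>i. if i > 2 * n + 2 then 0 else pt_original Y i)"
      have zc: "z j = pt_original Y j" if "j \<in> blocks n" for j using that by (simp add: z_def blocks_Un)
      have pcz: "pt_adapted z j = Y j" if "j \<in> blocks n" for j
      proof -
        have "pt_adapted z j = pt_adapted (pt_original Y) j"
          unfolding pt_adapted_def
          using that by (auto intro: peval_cong_bihom bihom_linform1 bihom_linform2 simp: zc)
        then show ?thesis by simp
      qed
      have z1: "\<exists>j\<in>block1 n. z j \<noteq> 0"
      proof (rule ccontr)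
        assume "\<not> ?thesis"
        then have "pt_adapted z (s1 i) = 0" using ab by (simp add: pt_adapted_def linform1)
        then show False using pcz [of "s1 i"] ab False by (simp add: Y_def)
      qed
      have z2: "\<exists>j\<in>block2 n. z j \<noteq> 0"
      proof (rule ccontr)
        assume "\<not> ?thesis"
        then have "pt_adapted z (s2 i) = 0" using ab by (simp add: pt_adapted_def linform2)
        then show False using pcz [of "s2 i"] ab False by (simp add: Y_def)
      qed
      have "z \<in> bilinear_span n p I"
      proof (rule span_if_pt_adapted_0)
        show "z \<in> biproj n" using z1 z2 by (simp add: biproj_def z_def)
        show "pt_adapted z j = 0" if "j \<in> rest" for j using that pcz [of j] by (auto simp: rest_def Y_def)
      qed
      then have "peval A z = 0" using van by (simp add: vanishes_on_def)
      moreover have "peval A z = peval A (pt_original Y)" using A zc by (rule peval_cong_bihom)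
      ultimately have "peval (span_restrict (to_adapted A)) X = 0" by (simp add: peval_span_restrict peval_to_adapted Y_def)
      then show ?thesis by simp
    qed auto
  qed
  then show "span_restrict (to_adapted A) = 0" by simp
qed

lemma span_prime:
  assumes "bihom n a b A" "bihom n c d C" "vanishes_on (A * C) (bilinear_span n p I)"
  shows "vanishes_on A (bilinear_span n p I) \<or> vanishes_on C (bilinear_span n p I)"
  using assms vanishes_on_span_iff [OF bihom_mult [OF assms(1,2)]]
  by (simp add: vanishes_on_span_iff [OF assms(1)] vanishes_on_span_iff [OF assms(2)]
      rhom_mult [OF rhom_to_adapted] rhom_mult [OF rhom_span_restrict])

end

section \<open>Subrings and powers of ideals\<close>

definition subring_of :: "'k::field set \<Rightarrow> bool" where
  "subring_of R \<longleftrightarrow> 1 \<in> R \<and> (\<forall>a\<in>R. \<forall>b\<in>R. a - b \<in> R \<and> a * b \<in> R)"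

lemma subring_1: "subring_of R \<Longrightarrow> 1 \<in> R"
  and subring_diff: "subring_of R \<Longrightarrow> a \<in> R \<Longrightarrow> b \<in> R \<Longrightarrow> a - b \<in> R"
  and subring_mult: "subring_of R \<Longrightarrow> a \<in> R \<Longrightarrow> b \<in> R \<Longrightarrow> a * b \<in> R"
  by (auto simp: subring_of_def)
lemma subring_0: "subring_of R \<Longrightarrow> 0 \<in> R"
  using subring_diff [of R 1 1] subring_1 by auto
lemma subring_power: "subring_of R \<Longrightarrow> a \<in> R \<Longrightarrow> a ^ k \<in> R"
  by (induction k) (auto intro: subring_1 subring_mult)

lemma unit_setD: "u \<in> unit_set R \<Longrightarrow> u \<in> R" "u \<in> unit_set R \<Longrightarrow> u \<noteq> 0" "u \<in> unit_set R \<Longrightarrow> inverse u \<in> R"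
  by (auto simp: unit_set_def)
lemma unit_set_1: "subring_of R \<Longrightarrow> 1 \<in> unit_set R"
  by (simp add: unit_set_def subring_1)
lemma unit_set_mult: "subring_of R \<Longrightarrow> u \<in> unit_set R \<Longrightarrow> v \<in> unit_set R \<Longrightarrow> u * v \<in> unit_set R"
  by (simp add: unit_set_def subring_mult)
lemma unit_set_inverse: "u \<in> unit_set R \<Longrightarrow> inverse u \<in> unit_set R"
  by (simp add: unit_set_def)
lemma unit_set_power: "subring_of R \<Longrightarrow> u \<in> unit_set R \<Longrightarrow> u ^ k \<in> unit_set R"
  by (induction k) (auto intro: unit_set_1 unit_set_mult)
lemma unit_set_power_int: "subring_of R \<Longrightarrow> u \<in> unit_set R \<Longrightarrow> u powi k \<in> unit_set R"
  by (auto simp: power_int_def intro: unit_set_power unit_set_inverse)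
lemma unit_set_prod: "subring_of R \<Longrightarrow> (\<And>i. i \<in> A \<Longrightarrow> f i \<in> unit_set R) \<Longrightarrow> prod f A \<in> unit_set R"
  by (induction A rule: infinite_finite_induct) (auto intro: unit_set_1 unit_set_mult)
lemma unit_set_mono: "R \<subseteq> S \<Longrightarrow> unit_set R \<subseteq> unit_set S"
  by (auto simp: unit_set_def)

lemma group_closure_subset:
  assumes "S \<subseteq> T" "0 \<in> T" "\<And>a b. a \<in> T \<Longrightarrow> b \<in> T \<Longrightarrow> a - b \<in> T"
  shows "group_closure S \<subseteq> T"
proof
  fix x assume "x \<in> group_closure S"
  then show "x \<in> T" by induction (use assms in auto)
qed

locale ideal_in =
  fixes R I :: "'k::field set"
  assumes ring: "subring_of R" and sub: "I \<subseteq> R" and absorb: "r \<in> R \<Longrightarrow> a \<in> I \<Longrightarrow> r * a \<in> I"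
begin

lemma ip_diff: "x \<in> ideal_power R I k \<Longrightarrow> y \<in> ideal_power R I k \<Longrightarrow> x - y \<in> ideal_power R I k"
  by (cases k) (auto intro: subring_diff [OF ring] group_closure.diff)
lemma ip_0: "0 \<in> ideal_power R I k"
  by (cases k) (auto intro: subring_0 [OF ring])
lemma ip_add: "x \<in> ideal_power R I k \<Longrightarrow> y \<in> ideal_power R I k \<Longrightarrow> x + y \<in> ideal_power R I k"
  using ip_diff [of x k "0 - y"] ip_diff [OF ip_0] by force
lemma ip_sum: "(\<And>i. i \<in> A \<Longrightarrow> f i \<in> ideal_power R I k) \<Longrightarrow> sum f A \<in> ideal_power R I k"
  by (induction A rule: infinite_finite_induct) (auto intro: ip_0 ip_add)

lemma ip_SucI: "a \<in> I \<Longrightarrow> b \<in> ideal_power R I k \<Longrightarrow> a * b \<in> ideal_power R I (Suc k)"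
  by (auto intro!: group_closure.base)

lemma ip_induct [consumes 1, case_names mult]:
  assumes "x \<in> ideal_power R I (Suc k)"
    and "\<And>a b. a \<in> I \<Longrightarrow> b \<in> ideal_power R I k \<Longrightarrow> a * b \<in> T"
    and "0 \<in> T" "\<And>a b. a \<in> T \<Longrightarrow> b \<in> T \<Longrightarrow> a - b \<in> T"
  shows "x \<in> T"
proof -
  have "group_closure {a * b | a b. a \<in> I \<and> b \<in> ideal_power R I k} \<subseteq> T"
    using assms(2-) by (intro group_closure_subset) auto
  then show ?thesis using assms(1) by auto
qed

lemma ip_absorb: "r \<in> R \<Longrightarrow> x \<in> ideal_power R I k \<Longrightarrow> r * x \<in> ideal_power R I k"
proof (cases k)
  case 0 then show "r \<in> R \<Longrightarrow> x \<in> ideal_power R I k \<Longrightarrow> ?thesis" by (simp add: subring_mult [OF ring])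
next
  case (Suc l)
  assume r: "r \<in> R" and x: "x \<in> ideal_power R I k"
  have "x \<in> ideal_power R I (Suc l)" using x Suc by simp
  then have "x \<in> {x. r * x \<in> ideal_power R I (Suc l)}"
  proof (induction rule: ip_induct)
    case (mult a b)
    then have "(r * a) * b \<in> ideal_power R I (Suc l)" by (intro ip_SucI absorb r)
    then show ?case by (simp only: mem_Collect_eq mult.assoc)
  qed (auto simp only: mem_Collect_eq mult_zero_right right_diff_distrib intro: ip_0 ip_diff)
  then show ?thesis using Suc by simp
qed

lemma ip_subset_ring: "ideal_power R I k \<subseteq> R"
proof (induction k)
  case (Suc k)
  show ?case
  proof
    fix x assume "x \<in> ideal_power R I (Suc k)"
    then show "x \<in> R"
      by (induction rule: ip_induct) (use Suc sub in \<open>auto intro: subring_mult [OF ring] subring_0 [OF ring] subring_diff [OF ring]\<close>)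
  qed
qed simp

lemma ip_Suc_subset: "ideal_power R I (Suc k) \<subseteq> ideal_power R I k"
proof
  fix x assume "x \<in> ideal_power R I (Suc k)"
  then show "x \<in> ideal_power R I k"
    by (induction rule: ip_induct) (use sub in \<open>auto intro: ip_absorb ip_0 ip_diff\<close>)
qed

lemma ip_antimono: "k \<le> l \<Longrightarrow> ideal_power R I l \<subseteq> ideal_power R I k"
  by (induction rule: dec_induct) (use ip_Suc_subset in blast)+

lemma ip_mult: "x \<in> ideal_power R I k \<Longrightarrow> y \<in> ideal_power R I l \<Longrightarrow> x * y \<in> ideal_power R I (k + l)"
proof (induction k arbitrary: x)
  case 0 then show ?case by (simp add: ip_absorb)
next
  case (Suc k)
  have "x \<in> {x. x * y \<in> ideal_power R I (Suc (k + l))}"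
    using Suc.prems(1)
  proof (induction rule: ip_induct)
    case (mult a b)
    then have "a * (b * y) \<in> ideal_power R I (Suc (k + l))" by (intro ip_SucI Suc.IH Suc.prems)
    then show ?case by (simp only: mem_Collect_eq mult.assoc)
  qed (auto simp only: mem_Collect_eq mult_zero_left left_diff_distrib intro: ip_0 ip_diff)
  then show ?case by simp
qed

lemma ip_power: "a \<in> I \<Longrightarrow> a ^ k \<in> ideal_power R I k"
  by (induction k) (auto simp: subring_1 [OF ring] intro: ip_SucI simp del: ideal_power.simps(2))

lemma ip_prod:
  assumes "finite A" "\<And>i. i \<in> A \<Longrightarrow> f i \<in> R" "\<And>i. i \<in> A \<inter> T \<Longrightarrow> f i \<in> I"
  shows "(\<Prod>i\<in>A. f i ^ e i) \<in> ideal_power R I (\<Sum>i\<in>A \<inter> T. e i)"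
  using assms
proof (induction A rule: finite_induct)
  case empty then show ?case by (simp add: subring_1 [OF ring])
next
  case (insert i A)
  then have IH: "(\<Prod>i\<in>A. f i ^ e i) \<in> ideal_power R I (\<Sum>i\<in>A \<inter> T. e i)" by auto
  show ?case
  proof (cases "i \<in> T")
    case True
    then have "f i ^ e i * (\<Prod>i\<in>A. f i ^ e i) \<in> ideal_power R I (e i + (\<Sum>i\<in>A \<inter> T. e i))"
      using insert.prems by (intro ip_mult ip_power IH) auto
    then show ?thesis using insert.hyps True by simp
  next
    case False
    have "f i ^ e i * (\<Prod>i\<in>A. f i ^ e i) \<in> ideal_power R I (\<Sum>i\<in>A \<inter> T. e i)"
      using insert.prems by (intro ip_absorb IH subring_power [OF ring]) auto
    then show ?thesis using insert.hyps False by simp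
  qed
qed

lemma affine_blowup_subring:
  assumes t: "t \<in> I" "t \<noteq> 0" shows "subring_of (affine_blowup R I t)"
  unfolding subring_of_def
proof (intro conjI ballI)
  have "1 \<in> ideal_power R I 0" by (simp add: subring_1 [OF ring])
  then show "1 \<in> affine_blowup R I t" unfolding affine_blowup_def by force
next
  fix x y assume "x \<in> affine_blowup R I t" "y \<in> affine_blowup R I t"
  then obtain a k b l where x: "x = a / t ^ k" "a \<in> ideal_power R I k" and y: "y = b / t ^ l" "b \<in> ideal_power R I l"
    unfolding affine_blowup_def by blast
  have "x * y = (a * b) / t ^ (k + l)" using x y by (simp add: power_add)
  then show "x * y \<in> affine_blowup R I t"
    unfolding affine_blowup_def using ip_mult [OF x(2) y(2)] by blast
  have "x - y = (a * t ^ l - t ^ k * b) / t ^ (k + l)"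
    unfolding x(1) y(1) using t(2) by (simp add: diff_frac_eq power_add mult.commute)
  moreover have "a * t ^ l - t ^ k * b \<in> ideal_power R I (k + l)"
    using x y t by (intro ip_diff ip_mult ip_power)
  ultimately show "x - y \<in> affine_blowup R I t" unfolding affine_blowup_def by blast
qed

lemma ring_subset_affine_blowup: "R \<subseteq> affine_blowup R I t"
proof
  fix x assume "x \<in> R"
  then have "x = x / t ^ 0" "x \<in> ideal_power R I 0" by auto
  then show "x \<in> affine_blowup R I t" unfolding affine_blowup_def by blast
qed

end

lemma localize_subring:
  assumes A: "subring_of A" and Q: "prime_ideal_of A Q"
  shows "subring_of (localize A Q)" and "A \<subseteq> localize A Q"
proof -
  have one: "1 \<in> A - Q" using A Q by (simp add: prime_ideal_of_def subring_1)
  have mult: "b * d \<in> A - Q" "b \<noteq> 0" if "b \<in> A - Q" "d \<in> A - Q" for b d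
    using that Q A by (auto simp: prime_ideal_of_def subring_mult)
  show "A \<subseteq> localize A Q"
  proof
    fix a assume "a \<in> A"
    then have "a = a / 1" "a \<in> A" by auto
    then show "a \<in> localize A Q" unfolding localize_def using one by blast
  qed
  show "subring_of (localize A Q)"
    unfolding subring_of_def
  proof (intro conjI ballI)
    show "1 \<in> localize A Q" using \<open>A \<subseteq> localize A Q\<close> one by blast
    fix x y assume "x \<in> localize A Q" "y \<in> localize A Q"
    then obtain a b c d where x: "x = a / b" "a \<in> A" "b \<in> A - Q" and y: "y = c / d" "c \<in> A" "d \<in> A - Q"
      unfolding localize_def by blast
    have "x * y = (a * c) / (b * d)" using x y by simp
    then show "x * y \<in> localize A Q" unfolding localize_def
      using subring_mult [OF A x(2) y(2)] mult [OF x(3) y(3)] by blast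
    have "b \<noteq> 0" "d \<noteq> 0" using mult x y by blast+
    then have "x - y = (a * d - c * b) / (b * d)" using x y by (simp add: field_simps)
    moreover have "a * d - c * b \<in> A" using x y by (auto intro: subring_diff [OF A] subring_mult [OF A])
    ultimately show "x - y \<in> localize A Q" unfolding localize_def using mult [OF x(3) y(3)] by blast
  qed
qed

section \<open>Valuations of the function field given by an order of vanishing\<close>

lemma Fract_eq_0_iff: "B \<noteq> 0 \<Longrightarrow> Fract A B = 0 \<longleftrightarrow> A = 0"
  by (simp add: Fract_conv_to_fract)

text \<open>
  A substitution into a family with parameter \<open>\<tau>\<close> gives a discrete valuation of the field of fractions; it is
  multiplicative because \<open>'a mpol poly\<close> is a domain. It is used with the Taylor expansion at a point and with
  the scaling of one coordinate.
\<close>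
locale order_valuation =
  fixes \<Theta> :: "'a::field mpol \<Rightarrow> 'a mpol poly"
  assumes hom: "rhom \<Theta>" and inj: "\<Theta> F = 0 \<Longrightarrow> F = 0"
begin

definition vord :: "'a mpol \<Rightarrow> nat" where "vord F = order 0 (\<Theta> F)"

lemma vord_mult: "F \<noteq> 0 \<Longrightarrow> G \<noteq> 0 \<Longrightarrow> vord (F * G) = vord F + vord G"
  unfolding vord_def rhom_mult [OF hom] using inj by (intro order_mult) auto

lemma vord_ge_iff: "F \<noteq> 0 \<Longrightarrow> k \<le> vord F \<longleftrightarrow> tau ^ k dvd \<Theta> F"
  using order_divides [of 0 k "\<Theta> F"] inj by (auto simp: vord_def)

text \<open>
  Only the values at nonzero arguments are meaningful.
\<close>
definition val :: "'a ratfun \<Rightarrow> int" where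
  "val x = (SOME k. \<exists>A B. x = Fract A B \<and> A \<noteq> 0 \<and> B \<noteq> 0 \<and> k = int (vord A) - int (vord B))"

lemma val_Fract:
  assumes "A \<noteq> 0" "B \<noteq> 0" shows "val (Fract A B) = int (vord A) - int (vord B)"
  unfolding val_def
proof (rule some_equality)
  fix k assume "\<exists>A' B'. Fract A B = Fract A' B' \<and> A' \<noteq> 0 \<and> B' \<noteq> 0 \<and> k = int (vord A') - int (vord B')"
  then obtain A' B' where *: "Fract A B = Fract A' B'" "A' \<noteq> 0" "B' \<noteq> 0" "k = int (vord A') - int (vord B')" by blast
  then have "A * B' = A' * B" using assms by (simp add: eq_fract)
  then have "vord A + vord B' = vord A' + vord B" using assms * vord_mult by metis
  then show "k = int (vord A) - int (vord B)" using * by simp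
qed (use assms in blast)

lemma nonzero_Fract: obtains A B where "x = Fract A B" "B \<noteq> 0" "x \<noteq> 0 \<longrightarrow> A \<noteq> 0"
proof (cases x rule: Fract_cases)
  case (Fract A B)
  then show thesis by (intro that) (auto simp: fract_collapse)
qed

lemma val_mult:
  assumes "x \<noteq> 0" "y \<noteq> 0" shows "val (x * y) = val x + val y"
proof -
  obtain A B where x: "x = Fract A B" "A \<noteq> 0" "B \<noteq> 0" using nonzero_Fract [of x] assms by metis
  obtain C D where y: "y = Fract C D" "C \<noteq> 0" "D \<noteq> 0" using nonzero_Fract [of y] assms by metis
  show ?thesis using x y by (simp add: val_Fract vord_mult)
qed

lemma val_1 [simp]: "val 1 = 0"
  using val_mult [of 1 1] by simp
lemma val_inverse: "x \<noteq> 0 \<Longrightarrow> val (inverse x) = - val x"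
  using val_mult [of x "inverse x"] by simp
lemma val_divide: "x \<noteq> 0 \<Longrightarrow> y \<noteq> 0 \<Longrightarrow> val (x / y) = val x - val y"
  unfolding divide_inverse by (simp add: val_mult val_inverse)
lemma val_power: "x \<noteq> 0 \<Longrightarrow> val (x ^ k) = int k * val x"
  by (induction k) (simp_all add: val_mult algebra_simps)
lemma val_power_int: "x \<noteq> 0 \<Longrightarrow> val (x powi k) = k * val x"
  by (simp add: power_int_def val_power val_inverse)

definition vge :: "int \<Rightarrow> 'a ratfun set" where "vge k = {x. x = 0 \<or> k \<le> val x}"

lemma vge_0 [simp]: "0 \<in> vge k" by (simp add: vge_def)
lemma vge_mult: "x \<in> vge k \<Longrightarrow> y \<in> vge l \<Longrightarrow> x * y \<in> vge (k + l)"
  by (cases "x = 0 \<or> y = 0") (auto simp: vge_def val_mult)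
lemma vge_Fract: "B \<noteq> 0 \<Longrightarrow> Fract A B \<in> vge k \<longleftrightarrow> A = 0 \<or> int (vord B) + k \<le> int (vord A)"
  by (cases "A = 0") (auto simp: vge_def val_Fract Fract_conv_to_fract [of 0] Fract_eq_0_iff)

lemma vge_diff:
  assumes "x \<in> vge k" "y \<in> vge k" shows "x - y \<in> vge k"
proof -
  obtain A B where x: "x = Fract A B" "B \<noteq> 0" using nonzero_Fract [of x] by metis
  obtain C D where y: "y = Fract C D" "D \<noteq> 0" using nonzero_Fract [of y] by metis
  have xy: "x - y = Fract (A * D - C * B) (B * D)" using x y by (simp add: diff_fract)
  show ?thesis
  proof (cases "A * D - C * B = 0")
    case True then show ?thesis using xy by (simp add: fract_collapse)
  next
    case nz: False
    define N where "N = nat (int (vord (B * D)) + k)"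
    have 1: "tau ^ N dvd \<Theta> (A * D)"
    proof (cases "A = 0")
      case False
      then have "int (vord B) + k \<le> int (vord A)" using assms x by (simp add: vge_Fract)
      then have "N \<le> vord (A * D)" using False x y by (simp add: N_def vord_mult)
      then show ?thesis using False y by (simp add: vord_ge_iff)
    qed (simp add: rhom_0 [OF hom])
    have 2: "tau ^ N dvd \<Theta> (C * B)"
    proof (cases "C = 0")
      case False
      then have "int (vord D) + k \<le> int (vord C)" using assms y by (simp add: vge_Fract)
      then have "N \<le> vord (C * B)" using False x y by (simp add: N_def vord_mult)
      then show ?thesis using False x by (simp add: vord_ge_iff)
    qed (simp add: rhom_0 [OF hom])
    have "tau ^ N dvd \<Theta> (A * D - C * B)"
      unfolding rhom_diff [OF hom] using 1 2 by (rule dvd_diff)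
    then have "N \<le> vord (A * D - C * B)" using nz vord_ge_iff by blast
    then show ?thesis unfolding xy using x y by (auto simp: vge_Fract N_def nat_le_iff)
  qed
qed

lemma vge_ideal_power:
  assumes "R \<subseteq> vge 0" "I \<subseteq> vge 1"
  shows "ideal_power R I k \<subseteq> vge (int k)"
proof (induction k)
  case (Suc k)
  have "group_closure {a * b | a b. a \<in> I \<and> b \<in> ideal_power R I k} \<subseteq> vge (int (Suc k))"
  proof (rule group_closure_subset)
    show "{a * b | a b. a \<in> I \<and> b \<in> ideal_power R I k} \<subseteq> vge (int (Suc k))"
    proof clarify
      fix a b assume "a \<in> I" "b \<in> ideal_power R I k"
      then have "a * b \<in> vge (1 + int k)" using Suc assms by (intro vge_mult) auto
      then show "a * b \<in> vge (int (Suc k))" by simp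
    qed
  qed (auto intro: vge_diff)
  then show ?case by simp
qed (use assms in simp)

end

section \<open>Local rings\<close>

abbreviation point_ring :: "nat \<Rightarrow> (nat \<Rightarrow> 'a) \<Rightarrow> 'a::field ratfun set" where
  "point_ring n z \<equiv> local_ring n (point_class n z)"

text \<open>
  Irreducibility in the form needed for local rings. It covers irreducible closed sets, points
  and bilinear spans.
\<close>
definition prime_locus :: "nat \<Rightarrow> (nat \<Rightarrow> 'a::field) set \<Rightarrow> bool" where
  "prime_locus n V \<longleftrightarrow> V \<noteq> {} \<and> (\<forall>a b c d A C. bihom n a b A \<longrightarrow> bihom n c d C \<longrightarrow>
      vanishes_on (A * C) V \<longrightarrow> vanishes_on A V \<or> vanishes_on C V)"

lemma prime_locusD: "prime_locus n V \<Longrightarrow> bihom n a b A \<Longrightarrow> bihom n c d C \<Longrightarrow>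
    vanishes_on (A * C) V \<Longrightarrow> vanishes_on A V \<or> vanishes_on C V"
  unfolding prime_locus_def by blast

lemma local_ring_iff: "x \<in> local_ring n V \<longleftrightarrow>
   (\<exists>A B a b. x = Fract A B \<and> bihom n a b A \<and> bihom n a b B \<and> \<not> vanishes_on B V)"
  by (auto simp: local_ring_def vanishes_on_def)

lemma vanishes_on_0 [simp]: "vanishes_on 0 V" by (simp add: vanishes_on_def)
lemma not_vanishes_nonzero: "\<not> vanishes_on B V \<Longrightarrow> B \<noteq> 0" by auto
lemma vanishes_on_mult: "vanishes_on A V \<Longrightarrow> vanishes_on (C * A) V" by (simp add: vanishes_on_def)

context
  fixes n :: nat and V :: "(nat \<Rightarrow> 'a::field) set"
  assumes V: "prime_locus n V"
begin

lemma not_vanishes_mult: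
  "bihom n a b A \<Longrightarrow> bihom n c d C \<Longrightarrow> \<not> vanishes_on A V \<Longrightarrow> \<not> vanishes_on C V \<Longrightarrow> \<not> vanishes_on (A * C) V"
  using prime_locusD [OF V] by blast

lemma local_ring_subring: "subring_of (local_ring n V)"
  unfolding subring_of_def
proof (intro conjI ballI)
  have "\<not> vanishes_on 1 V" using V by (auto simp: prime_locus_def vanishes_on_def)
  then show "1 \<in> local_ring n V" unfolding local_ring_iff using bihom_1 fract_collapse(2) by metis
  fix x y assume "x \<in> local_ring n V" "y \<in> local_ring n V"
  then obtain A B a b C D c d where x: "x = Fract A B" "bihom n a b A" "bihom n a b B" "\<not> vanishes_on B V"
    and y: "y = Fract C D" "bihom n c d C" "bihom n c d D" "\<not> vanishes_on D V"
    unfolding local_ring_iff by blast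
  have BD: "bihom n (a + c) (b + d) (B * D)" "\<not> vanishes_on (B * D) V"
    by (rule bihom_mult [OF x(3) y(3)]) (rule not_vanishes_mult [OF x(3) y(3) x(4) y(4)])
  have "x * y = Fract (A * C) (B * D)" using x y by simp
  then show "x * y \<in> local_ring n V" unfolding local_ring_iff using BD bihom_mult [OF x(2) y(2)] by blast
  have "x - y = Fract (A * D - C * B) (B * D)"
    using x(1) y(1) not_vanishes_nonzero [OF x(4)] not_vanishes_nonzero [OF y(4)] by simp
  moreover have "bihom n (a + c) (b + d) (A * D - C * B)"
    using bihom_diff [OF bihom_mult [OF x(2) y(3)]] bihom_mult [OF y(2) x(3)] by (simp add: add.commute)
  ultimately show "x - y \<in> local_ring n V" unfolding local_ring_iff using BD by blast
qed

text \<open>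
  An inverse \<open>A' / B'\<close> of \<open>A / B\<close> satisfies \<open>B B' = A' A\<close>, and the left side does not vanish on the prime locus
  \<open>V\<close>.
\<close>
lemma nonunits_iff:
  assumes "bihom n a b A" "bihom n a b B" "\<not> vanishes_on B V"
  shows "Fract A B \<in> nonunits (local_ring n V) \<longleftrightarrow> vanishes_on A V"
proof -
  have B: "B \<noteq> 0" using assms(3) not_vanishes_nonzero by blast
  have inR: "Fract A B \<in> local_ring n V" unfolding local_ring_iff using assms by blast
  have "Fract A B \<in> unit_set (local_ring n V) \<longleftrightarrow> \<not> vanishes_on A V"
  proof
    assume u: "Fract A B \<in> unit_set (local_ring n V)"
    then have "Fract B A \<in> local_ring n V" by (simp add: unit_set_def)
    then obtain A' B' c d where *: "Fract B A = Fract A' B'" "bihom n c d A'" "bihom n c d B'" "\<not> vanishes_on B' V"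
      unfolding local_ring_iff by blast
    have "A \<noteq> 0" using u by (auto simp: unit_set_def fract_collapse)
    then have "B * B' = A' * A" using * not_vanishes_nonzero by (metis eq_fract(1))
    then show "\<not> vanishes_on A V"
      using not_vanishes_mult [OF assms(2) *(3) assms(3) *(4)] vanishes_on_mult by metis
  next
    assume A: "\<not> vanishes_on A V"
    then have "Fract B A \<in> local_ring n V" unfolding local_ring_iff using assms by blast
    moreover have "Fract A B \<noteq> 0" using A B not_vanishes_nonzero by (simp add: Fract_eq_0_iff)
    ultimately show "Fract A B \<in> unit_set (local_ring n V)" using inR by (simp add: unit_set_def)
  qed
  then show ?thesis using inR by (simp add: nonunits_def)
qed

lemma nonunitsE:
  assumes "x \<in> nonunits (local_ring n V)"
  obtains A B a b where "x = Fract A B" "bihom n a b A" "bihom n a b B" "vanishes_on A V" "\<not> vanishes_on B V"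
proof -
  have "x \<in> local_ring n V" using assms by (simp add: nonunits_def)
  then obtain A B a b where *: "x = Fract A B" "bihom n a b A" "bihom n a b B" "\<not> vanishes_on B V"
    unfolding local_ring_iff by blast
  then have "vanishes_on A V" using nonunits_iff assms by blast
  then show ?thesis using * that by blast
qed

lemma nonunits_ideal: "ideal_in (local_ring n V) (nonunits (local_ring n V))"
proof
  show "subring_of (local_ring n V)" by (rule local_ring_subring)
  show "nonunits (local_ring n V) \<subseteq> local_ring n V" by (auto simp: nonunits_def)
  fix r x assume "r \<in> local_ring n V" and x: "x \<in> nonunits (local_ring n V)"
  then obtain C D c d where r: "r = Fract C D" "bihom n c d C" "bihom n c d D" "\<not> vanishes_on D V"
    unfolding local_ring_iff by blast
  obtain A B a b where x: "x = Fract A B" "bihom n a b A" "bihom n a b B" "vanishes_on A V" "\<not> vanishes_on B V"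
    using nonunitsE [OF x] by blast
  have "r * x = Fract (C * A) (D * B)" using r x by simp
  moreover have "Fract (C * A) (D * B) \<in> nonunits (local_ring n V)"
    using nonunits_iff [OF bihom_mult [OF r(2) x(2)] bihom_mult [OF r(3) x(3)] not_vanishes_mult [OF r(3) x(3) r(4) x(5)]]
      vanishes_on_mult [OF x(4)] by blast
  ultimately show "r * x \<in> nonunits (local_ring n V)" by simp
qed

end

lemma irreducible_closed_prime:
  assumes "irreducible_closed n V" shows "prime_locus n V"
  unfolding prime_locus_def
proof (intro conjI allI impI)
  show "V \<noteq> {}" using assms by (simp add: irreducible_closed_def)
  have VP: "V \<subseteq> biproj n" using assms by (auto simp: irreducible_closed_def zariski_closed_def)
  fix a b c d A C assume A: "bihom n a b A" "bihom n c d C" and van: "vanishes_on (A * C) V"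
  define Z where "Z P = {z \<in> biproj n. \<forall>P\<in>{P}. peval P z = 0}" for P :: "'a mpol"
  have "zariski_closed n (Z P)" if "bihom n a' b' P" for a' b' P
    unfolding zariski_closed_def Z_def by (rule exI [of _ "{P}"]) (use that in auto)
  then have "zariski_closed n (Z A)" "zariski_closed n (Z C)" using A by auto
  moreover have "V \<subseteq> Z A \<union> Z C" using van VP by (auto simp: vanishes_on_def Z_def)
  ultimately have "V \<subseteq> Z A \<or> V \<subseteq> Z C" using assms by (auto simp: irreducible_closed_def)
  then show "vanishes_on A V \<or> vanishes_on C V" by (auto simp: vanishes_on_def Z_def)
qed

lemma self_in_point_class: "z \<in> point_class n z"
  unfolding point_class_def by (auto intro!: exI [of _ 1])

lemma vanishes_on_point: "bihom n a b F \<Longrightarrow> vanishes_on F (point_class n z) \<longleftrightarrow> peval F z = 0"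
  using self_in_point_class [of z n]
  by (auto simp: vanishes_on_def point_class_def peval_bihom_scale)

lemma point_prime: "prime_locus n (point_class n z)"
  unfolding prime_locus_def
proof (intro conjI allI impI)
  show "point_class n z \<noteq> {}" using self_in_point_class by blast
  fix a b c d A C assume A: "bihom n a b A" "bihom n c d C" and "vanishes_on (A * C) (point_class n z)"
  then show "vanishes_on A (point_class n z) \<or> vanishes_on C (point_class n z)"
    using vanishes_on_point [OF bihom_mult [OF A]] vanishes_on_point [OF A(1)] vanishes_on_point [OF A(2)]
    by simp
qed

lemma local_ring_mono: "z \<in> V \<Longrightarrow> point_ring n z \<subseteq> local_ring n V"
  unfolding local_ring_iff subset_iff using vanishes_on_point by (metis vanishes_on_def)

lemma Fract_in_local_ring:
  "bihom n a b A \<Longrightarrow> bihom n a b B \<Longrightarrow> peval B z \<noteq> 0 \<Longrightarrow> Fract A B \<in> point_ring n z"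
  unfolding local_ring_iff using vanishes_on_point by metis

lemma same_class_if_proportional:
  assumes z: "z \<in> biproj n" and q: "q \<in> biproj n"
    and 1: "\<And>a b. a \<in> block1 n \<Longrightarrow> b \<in> block1 n \<Longrightarrow> z a * q b = z b * q a"
    and 2: "\<And>a b. a \<in> block2 n \<Longrightarrow> b \<in> block2 n \<Longrightarrow> z a * q b = z b * q a"
  shows "z \<in> point_class n q"
proof -
  have *: "\<exists>s. s \<noteq> 0 \<and> (\<forall>j\<in>J. z j = s * q j)"
    if zJ: "\<exists>i\<in>J. z i \<noteq> 0" and qJ: "\<exists>i\<in>J. q i \<noteq> 0"
      and cross: "\<And>a b. a \<in> J \<Longrightarrow> b \<in> J \<Longrightarrow> z a * q b = z b * q a" for J
  proof -
    obtain i where i: "i \<in> J" "q i \<noteq> 0" using qJ by blast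
    have eq: "z j = (z i / q i) * q j" if "j \<in> J" for j
      using cross [OF that i(1)] i by (simp add: field_simps)
    then have "z i / q i \<noteq> 0" using zJ by (metis mult_zero_left)
    then show ?thesis using eq by blast
  qed
  obtain s where s: "s \<noteq> 0" "\<forall>j\<in>block1 n. z j = s * q j" using * [of "block1 n"] z q 1 by (auto simp: biproj_def)
  obtain t where t: "t \<noteq> 0" "\<forall>j\<in>block2 n. z j = t * q j" using * [of "block2 n"] z q 2 by (auto simp: biproj_def)
  have "z = (\<lambda>i. if i \<in> block1 n then s * q i else t * q i)"
  proof
    fix i
    show "z i = (if i \<in> block1 n then s * q i else t * q i)"
    proof (cases "i > 2 * n + 2")
      case True then show ?thesis using z q by (simp add: biproj_def)
    next
      case False
      then have "i \<in> blocks n" by (simp add: blocks_Un)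
      then show ?thesis using s t by auto
    qed
  qed
  then show ?thesis unfolding point_class_def using s t by blast
qed

lemma point_class_biproj:
  assumes "z \<in> biproj n" "y \<in> point_class n z" shows "y \<in> biproj n"
proof -
  obtain s t where y: "y = (\<lambda>i. if i \<in> block1 n then s * z i else t * z i)" "s \<noteq> 0" "t \<noteq> 0"
    using assms(2) unfolding point_class_def by blast
  then show ?thesis using assms(1) block_disjointD [of _ n] unfolding y(1) biproj_def by auto
qed

text \<open>
  Zero loci of bihomogeneous polynomials do not depend on the choice of coordinate vectors.
\<close>
lemma zariski_closed_saturated:
  assumes W: "zariski_closed n W" and z: "z \<in> W" shows "point_class n z \<subseteq> W"
proof
  fix y assume y: "y \<in> point_class n z"
  obtain S where S: "\<forall>P\<in>S. \<exists>a b. bihom n a b P" "W = {z \<in> biproj n. \<forall>P\<in>S. peval P z = 0}"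
    using W unfolding zariski_closed_def by blast
  have "peval P y = 0" if P: "P \<in> S" for P
  proof -
    obtain a b where ab: "bihom n a b P" using S P by blast
    have "vanishes_on P (point_class n z)" using vanishes_on_point [OF ab] z S P by blast
    then show ?thesis using y by (simp add: vanishes_on_def)
  qed
  moreover have "y \<in> biproj n" using point_class_biproj [OF _ y] z S by blast
  ultimately show "y \<in> W" using S by blast
qed

lemma point_class_sym:
  assumes z: "z \<in> biproj n" and q: "q \<in> biproj n" and zq: "z \<in> point_class n q"
  shows "q \<in> point_class n z"
proof -
  obtain s t where st: "z = (\<lambda>i. if i \<in> block1 n then s * q i else t * q i)"
    using zq unfolding point_class_def by blast
  show ?thesis
    by (rule same_class_if_proportional [OF q z]) (simp_all add: st block_disjointD)
qed

lemma point_irreducible_closed: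
  assumes z: "z \<in> biproj n" shows "irreducible_closed n (point_class n z)"
  unfolding irreducible_closed_def
proof (intro conjI allI impI)
  show "point_class n z \<noteq> {}" using self_in_point_class by blast
  define S where "S = {mconst (z b) * pvar a - mconst (z a) * pvar b | a b.
      (a \<in> block1 n \<and> b \<in> block1 n) \<or> (a \<in> block2 n \<and> b \<in> block2 n)}"
  have "\<exists>a b. bihom n a b P" if "P \<in> S" for P
    using that unfolding S_def
    by (auto intro: bihom_diff [OF bihom_mconst_mult bihom_mconst_mult] bihom_pvar1 bihom_pvar2)
  moreover have "point_class n z = {y \<in> biproj n. \<forall>P\<in>S. peval P y = 0}"
  proof (intro set_eqI iffI)
    fix y assume "y \<in> point_class n z"
    then obtain s t where y: "y = (\<lambda>i. if i \<in> block1 n then s * z i else t * z i)"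
      unfolding point_class_def by blast
    have "y \<in> biproj n" by (rule point_class_biproj [OF z \<open>y \<in> point_class n z\<close>])
    moreover have "peval P y = 0" if P: "P \<in> S" for P
      using P block_disjointD [of _ n] by (auto simp: S_def y)
    ultimately show "y \<in> {y \<in> biproj n. \<forall>P\<in>S. peval P y = 0}" by blast
  next
    fix y assume y: "y \<in> {y \<in> biproj n. \<forall>P\<in>S. peval P y = 0}"
    have "y a * z b = y b * z a" if "(a \<in> block1 n \<and> b \<in> block1 n) \<or> (a \<in> block2 n \<and> b \<in> block2 n)" for a b
    proof -
      have "mconst (z b) * pvar a - mconst (z a) * pvar b \<in> S" using that unfolding S_def by blast
      then have "peval (mconst (z b) * pvar a - mconst (z a) * pvar b) y = 0" using y by blast
      then show ?thesis by (simp add: mult.commute)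
    qed
    then show "y \<in> point_class n z" using y z by (intro same_class_if_proportional) auto
  qed
  ultimately show "zariski_closed n (point_class n z)" unfolding zariski_closed_def by blast
  fix V1 V2 assume V: "zariski_closed n V1 \<and> zariski_closed n V2 \<and> point_class n z \<subseteq> V1 \<union> V2"
  then have "z \<in> V1 \<or> z \<in> V2" using self_in_point_class by blast
  then show "point_class n z \<subseteq> V1 \<or> point_class n z \<subseteq> V2" using V zariski_closed_saturated by blast
qed

text \<open>
  The quotient of a linear form that vanishes at \<open>q\<close> and not at \<open>z\<close> by one that vanishes at neither point.
\<close>
lemma separating_unit:
  assumes z: "z \<in> biproj n" and q: "q \<in> biproj n" and neq: "z \<notin> point_class n q"
  shows "\<exists>f\<in>point_ideal n q. f \<in> unit_set (point_ring n z)"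
proof -
  have main: ?thesis
    if J: "\<And>i. i \<in> J \<Longrightarrow> bihom n d1 d2 (pvar i :: 'a mpol)" and zJ: "\<exists>i\<in>J. z i \<noteq> 0" and qJ: "\<exists>i\<in>J. q i \<noteq> 0"
      and ab: "a \<in> J" "b \<in> J" "z a * q b \<noteq> z b * q a" for J d1 d2 a b
  proof -
    define l where "l = mconst (q b) * pvar a - mconst (q a) * pvar b"
    have "bihom n d1 d2 l" unfolding l_def by (intro bihom_diff bihom_mconst_mult J ab)
    moreover have "peval l q = 0" "peval l z \<noteq> 0" using ab by (simp_all add: l_def mult.commute)
    ultimately have l: "bihom n d1 d2 l" "peval l q = 0" "peval l z \<noteq> 0" by auto
    obtain i k where ik: "i \<in> J" "z i \<noteq> 0" "k \<in> J" "q k \<noteq> 0" using zJ qJ by blast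
    have "\<exists>l2. bihom n d1 d2 l2 \<and> peval l2 z \<noteq> 0 \<and> peval l2 q \<noteq> 0"
    proof (cases "q i \<noteq> 0 \<or> z k \<noteq> 0")
      case True then show ?thesis using ik J peval_pvar by metis
    next
      case False
      then show ?thesis using ik by (intro exI [of _ "pvar i + pvar k"]) (auto intro!: bihom_add J)
    qed
    then obtain l2 where l2: "bihom n d1 d2 l2" "peval l2 z \<noteq> 0" "peval l2 q \<noteq> 0" by blast
    have "Fract l l2 \<in> point_ideal n q"
      unfolding point_ideal_def
      using nonunits_iff [OF point_prime l(1) l2(1)] vanishes_on_point [OF l(1)] vanishes_on_point [OF l2(1)] l l2 by blast
    moreover have "Fract l l2 \<in> point_ring n z" "Fract l2 l \<in> point_ring n z"
      using l l2 by (auto intro: Fract_in_local_ring)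
    moreover have "l \<noteq> 0" "l2 \<noteq> 0" using l l2 by auto
    then have "Fract l l2 \<noteq> 0" by (simp add: Fract_eq_0_iff)
    ultimately show ?thesis by (intro bexI [of _ "Fract l l2"]) (simp_all add: unit_set_def)
  qed
  from neq obtain a b where "(a \<in> block1 n \<and> b \<in> block1 n \<or> a \<in> block2 n \<and> b \<in> block2 n) \<and> z a * q b \<noteq> z b * q a"
    using same_class_if_proportional [OF z q] by blast
  then have ne: "z a * q b \<noteq> z b * q a" and "a \<in> block1 n \<and> b \<in> block1 n \<or> a \<in> block2 n \<and> b \<in> block2 n"
    by auto
  then consider "a \<in> block1 n" "b \<in> block1 n" | "a \<in> block2 n" "b \<in> block2 n" by blast
  then show ?thesis
  proof cases
    case 1
    show ?thesis
      by (rule main [OF bihom_pvar1 _ _ 1 ne]) (use z q in \<open>auto simp: biproj_def\<close>)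
  next
    case 2
    show ?thesis
      by (rule main [OF bihom_pvar2 _ _ 2 ne]) (use z q in \<open>auto simp: biproj_def\<close>)
  qed
qed

section \<open>Local equations on the blow-up\<close>

text \<open>
  The set of all local equations, given one of them.
\<close>
abbreviation unit_coset :: "'k::field set \<Rightarrow> 'k \<Rightarrow> 'k set" where
  "unit_coset R g \<equiv> {g * u | u. u \<in> unit_set R}"

text \<open>
  Any chart over which \<open>R\<close> lies gives the same local equation up to a unit: if all coordinates are regular
  multiples of the \<open>i\<close>-th one and of the \<open>c\<close>-th one, these two differ by a unit.
\<close>
lemma hyperplane_div_coset:
  fixes z :: "nat \<Rightarrow> 'a::field"
  assumes R: "subring_of R" "point_ring n z \<subseteq> R"
    and J: "\<And>i. i \<in> J \<Longrightarrow> bihom n a b (pvar i :: 'a mpol)" and c: "c \<in> J" "z c \<noteq> 0"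
  shows "hyperplane_div J i0 R = unit_coset R (Fract (pvar i0) (pvar c))"
proof (intro set_eqI iffI)
  have quot: "Fract (pvar k) (pvar c) \<in> R" if "k \<in> J" for k
    using Fract_in_local_ring [OF J [OF that] J [OF c(1)], of z] c(2) R(2) by auto
  fix x assume "x \<in> hyperplane_div J i0 R"
  then obtain i u where x: "x = Fract (pvar i0) (pvar i) * u" "i \<in> J" "\<forall>k\<in>J. Fract (pvar k) (pvar i) \<in> R" "u \<in> unit_set R"
    unfolding hyperplane_div_def by blast
  have "Fract (pvar i) (pvar c) \<in> R" using quot x by blast
  then have "Fract (pvar c) (pvar i) \<in> unit_set R"
    using x c by (simp add: unit_set_def Fract_eq_0_iff)
  then have "Fract (pvar c) (pvar i) * u \<in> unit_set R" using x R unit_set_mult by blast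
  moreover have "x = Fract (pvar i0) (pvar c) * (Fract (pvar c) (pvar i) * u)"
    unfolding x by (simp add: Fract_conv_to_fract)
  ultimately show "x \<in> unit_coset R (Fract (pvar i0) (pvar c))" by blast
next
  fix x assume "x \<in> unit_coset R (Fract (pvar i0) (pvar c))"
  moreover have "Fract (pvar k) (pvar c) \<in> R" if "k \<in> J" for k
    using Fract_in_local_ring [OF J [OF that] J [OF c(1)], of z] c(2) R(2) by auto
  ultimately show "x \<in> hyperplane_div J i0 R" unfolding hyperplane_div_def using c by blast
qed

text \<open>
  A function that vanishes at \<open>q\<close> and is a unit at \<open>z\<close> shows that \<open>R\<close> does not lie over \<open>q\<close>.
\<close>
lemma exceptional_div_away:
  assumes "point_ring n z \<subseteq> R" "z \<in> biproj n" "q \<in> biproj n" "z \<notin> point_class n q"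
  shows "exceptional_div n q R = unit_set R"
proof -
  obtain f where "f \<in> point_ideal n q" "f \<in> unit_set (point_ring n z)"
    using separating_unit [OF assms(2-4)] by blast
  then have "f \<in> point_ideal n q" "f \<notin> nonunits R" using unit_set_mono [OF assms(1)] by (auto simp: nonunits_def)
  then show ?thesis by (auto simp: exceptional_div_def)
qed

text \<open>
  In the chart of \<open>t\<close> every element of the ideal of \<open>q\<close> is a multiple of \<open>t\<close>, and \<open>t\<close> lies in the prime \<open>Q\<close>.
\<close>
lemma exceptional_div_over:
  assumes A: "A = affine_blowup (point_ring n q) (point_ideal n q) t"
    and t: "t \<in> point_ideal n q" "t \<noteq> 0" and Q: "prime_ideal_of A Q" "t \<in> Q"
  defines "R \<equiv> localize A Q"
  shows "subring_of R" "point_ring n q \<subseteq> R"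
    "exceptional_div n q R = unit_coset R t"
    "a \<in> ideal_power (point_ring n q) (point_ideal n q) k \<Longrightarrow> a / t ^ k \<in> R"
proof -
  interpret ideal_in "point_ring n q" "point_ideal n q"
    unfolding point_ideal_def by (rule nonunits_ideal [OF point_prime])
  have subA: "subring_of A" unfolding A using t by (rule affine_blowup_subring)
  have AR: "A \<subseteq> R" unfolding R_def by (rule localize_subring [OF subA Q(1)])
  show R: "subring_of R" unfolding R_def by (rule localize_subring [OF subA Q(1)])
  show OR: "point_ring n q \<subseteq> R" using AR ring_subset_affine_blowup unfolding A by blast
  show pow: "a / t ^ k \<in> R" if "a \<in> ideal_power (point_ring n q) (point_ideal n q) k" for a k
    using that AR unfolding A affine_blowup_def by blast
  have div_t: "a / t \<in> A" if "a \<in> point_ideal n q" for a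
  proof -
    have "a ^ 1 \<in> ideal_power (point_ring n q) (point_ideal n q) 1" using that by (rule ip_power)
    then show ?thesis unfolding A affine_blowup_def by (metis (mono_tags, lifting) mem_Collect_eq power_one_right)
  qed
  have "point_ideal n q \<subseteq> nonunits R"
  proof
    fix a assume a: "a \<in> point_ideal n q"
    have "a = (a / t) * t" using t by simp
    then have aQ: "a \<in> Q" using div_t [OF a] Q unfolding prime_ideal_of_def by metis
    have "a \<in> R" using a sub OR by blast
    moreover have "a \<notin> unit_set R"
    proof
      assume u: "a \<in> unit_set R"
      then obtain x b where xb: "inverse a = x / b" "x \<in> A" "b \<in> A - Q"
        unfolding unit_set_def R_def localize_def by blast
      have "b \<noteq> 0" "a \<noteq> 0" using xb Q u by (auto simp: prime_ideal_of_def unit_set_def)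
      then have "b = x * a" using xb by (simp add: field_simps)
      then show False using xb aQ Q by (auto simp: prime_ideal_of_def)
    qed
    ultimately show "a \<in> nonunits R" by (simp add: nonunits_def)
  qed
  then have "exceptional_div n q R = {t' * u | t' u. t' \<in> point_ideal n q \<and> u \<in> unit_set R \<and>
              (\<forall>a\<in>point_ideal n q. \<exists>r\<in>R. a = t' * r)}" by (simp add: exceptional_div_def)
  also have "\<dots> = unit_coset R t"
  proof (intro set_eqI iffI)
    fix x assume "x \<in> {t' * u | t' u. t' \<in> point_ideal n q \<and> u \<in> unit_set R \<and> (\<forall>a\<in>point_ideal n q. \<exists>r\<in>R. a = t' * r)}"
    then obtain t' u where x: "x = t' * u" "t' \<in> point_ideal n q" "u \<in> unit_set R"
      "\<forall>a\<in>point_ideal n q. \<exists>r\<in>R. a = t' * r" by blast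
    then obtain r where r: "r \<in> R" "t = t' * r" using t by blast
    then have "t' \<noteq> 0" "r \<noteq> 0" using t by auto
    then have "inverse r = t' / t" unfolding r(2) by (simp add: inverse_eq_divide)
    then have "inverse r \<in> R" using div_t [OF x(2)] AR by auto
    then have "inverse r \<in> unit_set R" using r \<open>r \<noteq> 0\<close> by (simp add: unit_set_def)
    then have "inverse r * u \<in> unit_set R" using x unit_set_mult [OF R] by blast
    moreover have "x = t * (inverse r * u)" using x r \<open>r \<noteq> 0\<close> by simp
    ultimately show "x \<in> unit_coset R t" by blast
  next
    fix x assume "x \<in> unit_coset R t"
    then obtain u where x: "x = t * u" "u \<in> unit_set R" by blast
    have "\<exists>r\<in>R. a = t * r" if "a \<in> point_ideal n q" for a
      using div_t [OF that] AR t by (intro bexI [of _ "a / t"]) auto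
    then show "x \<in> {t' * u | t' u. t' \<in> point_ideal n q \<and> u \<in> unit_set R \<and> (\<forall>a\<in>point_ideal n q. \<exists>r\<in>R. a = t' * r)}"
      using x t by blast
  qed
  finally show "exceptional_div n q R = unit_coset R t" .
qed

lemma blowup_div_coset:
  assumes R: "subring_of R"
    and h1: "H1 n R = unit_coset R h1" and h2: "H2 n R = unit_coset R h2"
    and e: "\<And>i. i \<in> {1..s} \<Longrightarrow> exceptional_div n (p i) R = unit_coset R (t i)"
  shows "blowup_div n s p d1 d2 m R =
     unit_coset R (h1 powi d1 * h2 powi d2 * (\<Prod>i\<in>{1..s}. t i powi (- m i)))" (is "_ = ?C")
proof (intro set_eqI iffI)
  fix x assume "x \<in> blowup_div n s p d1 d2 m R"
  then obtain k1 k2 f u where x: "x = k1 powi d1 * k2 powi d2 * (\<Prod>i\<in>{1..s}. f i powi (- m i)) * u"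
     "k1 \<in> H1 n R" "k2 \<in> H2 n R" "\<forall>i\<in>{1..s}. f i \<in> exceptional_div n (p i) R" "u \<in> unit_set R"
    unfolding blowup_div_def by blast
  obtain u1 where u1: "k1 = h1 * u1" "u1 \<in> unit_set R" using x(2) h1 by blast
  obtain u2 where u2: "k2 = h2 * u2" "u2 \<in> unit_set R" using x(3) h2 by blast
  have "\<forall>i\<in>{1..s}. \<exists>u. f i = t i * u \<and> u \<in> unit_set R" using x(4) e by blast
  then obtain v where v: "\<And>i. i \<in> {1..s} \<Longrightarrow> f i = t i * v i" "\<And>i. i \<in> {1..s} \<Longrightarrow> v i \<in> unit_set R" by metis
  define w where "w = u1 powi d1 * u2 powi d2 * (\<Prod>i\<in>{1..s}. v i powi (- m i)) * u"
  have "w \<in> unit_set R"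
    unfolding w_def using u1 u2 v x(5) by (intro unit_set_mult [OF R] unit_set_power_int [OF R] unit_set_prod [OF R]) auto
  moreover have "(\<Prod>i\<in>{1..s}. f i powi (- m i)) = (\<Prod>i\<in>{1..s}. t i powi (- m i)) * (\<Prod>i\<in>{1..s}. v i powi (- m i))"
    unfolding prod.distrib [symmetric] by (intro prod.cong refl) (simp add: v power_int_mult_distrib)
  then have "x = h1 powi d1 * h2 powi d2 * (\<Prod>i\<in>{1..s}. t i powi (- m i)) * w"
    unfolding x(1) u1(1) u2(1) w_def by (simp only: power_int_mult_distrib mult_ac)
  ultimately show "x \<in> ?C" by blast
next
  fix x assume "x \<in> ?C"
  then obtain u where x: "x = h1 powi d1 * h2 powi d2 * (\<Prod>i\<in>{1..s}. t i powi (- m i)) * u" "u \<in> unit_set R" by blast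
  have one: "1 \<in> unit_set R" by (rule unit_set_1 [OF R])
  have "h1 \<in> H1 n R" "h2 \<in> H2 n R" unfolding h1 h2 using one by force+
  moreover have "\<forall>i\<in>{1..s}. t i \<in> exceptional_div n (p i) R"
  proof
    fix i assume "i \<in> {1..s}"
    then have "exceptional_div n (p i) R = unit_coset R (t i)" by (rule e)
    then show "t i \<in> exceptional_div n (p i) R" using one by force
  qed
  ultimately show "x \<in> blowup_div n s p d1 d2 m R" unfolding blowup_div_def using x by blast
qed

lemma add_principal_coset:
  assumes "D R = unit_coset R g"
  shows "add_principal D f R = unit_coset R (g * f)"
  unfolding add_principal_def assms by (auto simp: mult_ac)

lemma unit_coset_subset_iff:
  assumes "subring_of R" shows "unit_coset R g \<subseteq> R \<longleftrightarrow> g \<in> R"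
proof
  have "g * 1 \<in> unit_coset R g" using unit_set_1 [OF assms] by blast
  then show "unit_coset R g \<subseteq> R \<Longrightarrow> g \<in> R" by auto
qed (auto intro: subring_mult [OF assms] dest: unit_setD(1))

lemma biproj_coords:
  assumes "z \<in> biproj n" obtains c1 c2 where "c1 \<in> block1 n" "z c1 \<noteq> 0" "c2 \<in> block2 n" "z c2 \<noteq> 0"
  using assms by (auto simp: biproj_def)

lemma H_coset:
  assumes "subring_of R" "point_ring n z \<subseteq> R"
  shows "c1 \<in> block1 n \<Longrightarrow> z c1 \<noteq> 0 \<Longrightarrow> H1 n R = unit_coset R (Fract (pvar 0) (pvar c1))"
    and "c2 \<in> block2 n \<Longrightarrow> z c2 \<noteq> 0 \<Longrightarrow> H2 n R = unit_coset R (Fract (pvar (n + 1)) (pvar c2))"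
  unfolding H1_def H2_def
  by (rule hyperplane_div_coset [OF assms bihom_pvar1]; assumption)
     (rule hyperplane_div_coset [OF assms bihom_pvar2]; assumption)

lemma general_position_distinct:
  assumes gp: "general_position n s p" and n: "n \<ge> 1" and ij: "i \<in> {1..s}" "j \<in> {1..s}" "i \<noteq> j"
  shows "p i \<notin> point_class n (p j)"
proof
  assume "p i \<in> point_class n (p j)"
  then obtain a b where a: "p i = (\<lambda>k. if k \<in> block1 n then a * p j k else b * p j k)"
    unfolding point_class_def by blast
  have "card {i, j} \<le> n + 1" "{i, j} \<subseteq> {1..s}" using n ij by auto
  then have "independent_in (block1 n) p {i, j}" using gp unfolding general_position_def by blast
  then have *: "(\<forall>k\<in>block1 n. (\<Sum>l\<in>{i, j}. (if l = i then 1 else - a) * p l k) = 0) \<longrightarrow> (\<forall>l\<in>{i, j}. (if l = i then 1 else - a) = 0)"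
    unfolding independent_in_def by (rule spec)
  have "p i k = a * p j k" if "k \<in> block1 n" for k using that fun_cong [OF a, of k] by simp
  then have "\<forall>k\<in>block1 n. (\<Sum>l\<in>{i, j}. (if l = i then 1 else - a) * p l k) = 0"
    using ij(3) by auto
  with * have "(if i = i then 1 else - a) = 0" by blast
  then show False by simp
qed

text \<open>
  The dehomogenization of \<open>F\<close> in the chart where the coordinates \<open>a\<close> and \<open>b\<close> do not vanish; for \<open>a = 0\<close> and
  \<open>b = n + 1\<close>, the coordinates used for \<open>H1\<close> and \<open>H2\<close>, it is the rational function whose divisor, added
  to \<open>D\<close>, gives the divisor of zeros of the section \<open>F\<close>.
\<close>
abbreviation dehom :: "'a::field mpol \<Rightarrow> nat \<Rightarrow> nat \<Rightarrow> nat \<Rightarrow> nat \<Rightarrow> 'a ratfun" where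
  "dehom F c d a b \<equiv> Fract F (pvar a ^ c * pvar b ^ d)"

abbreviation section_div ::
    "nat \<Rightarrow> nat \<Rightarrow> (nat \<Rightarrow> nat \<Rightarrow> 'a::field) \<Rightarrow> (nat \<Rightarrow> int) \<Rightarrow> 'a mpol \<Rightarrow> nat \<Rightarrow> nat \<Rightarrow> 'a divisor" where
  "section_div n s p m F c d \<equiv> add_principal (blowup_div n s p (int c) (int d) m) (dehom F c d 0 (n + 1))"

text \<open>
  The local equations of \<open>H1\<close> and \<open>H2\<close> change the chart of the dehomogenization.
\<close>
lemma section_div_coset:
  fixes z :: "nat \<Rightarrow> 'a::field"
  assumes R: "subring_of R" "point_ring n z \<subseteq> R"
    and e: "\<And>i. i \<in> {1..s} \<Longrightarrow> exceptional_div n (p i) R = unit_coset R (t i)"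
    and c: "c1 \<in> block1 n" "z c1 \<noteq> 0" "c2 \<in> block2 n" "z c2 \<noteq> 0"
  shows "section_div n s p m F c d R = unit_coset R (dehom F c d c1 c2 * (\<Prod>i\<in>{1..s}. t i powi (- m i)))"
proof -
  let ?h1 = "Fract (pvar 0) (pvar c1 :: 'a mpol)" and ?h2 = "Fract (pvar (n + 1)) (pvar c2 :: 'a mpol)"
  let ?T = "\<Prod>i\<in>{1..s}. t i powi (- m i)"
  have "blowup_div n s p (int c) (int d) m R = unit_coset R (?h1 powi int c * ?h2 powi int d * ?T)"
    by (rule blowup_div_coset [OF R(1) H_coset(1) [OF R c(1,2)] H_coset(2) [OF R c(3,4)] e])
  from add_principal_coset [of "blowup_div n s p (int c) (int d) m" R _ "dehom F c d 0 (n + 1)", OF this]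
  have "section_div n s p m F c d R
      = unit_coset R ((?h1 powi int c * ?h2 powi int d * dehom F c d 0 (n + 1)) * ?T)"
    by (simp only: mult_ac)
  also have "?h1 powi int c * ?h2 powi int d * dehom F c d 0 (n + 1) = dehom F c d c1 c2"
    by (simp add: Fract_conv_to_fract rhom_power [OF rhom_to_fract] power_divide)
  finally show ?thesis .
qed

lemma section_div_coset_away:
  fixes z :: "nat \<Rightarrow> 'a::field"
  assumes R: "subring_of R" "point_ring n z \<subseteq> R"
    and e: "\<And>i. i \<in> {1..s} \<Longrightarrow> exceptional_div n (p i) R = unit_set R"
    and c: "c1 \<in> block1 n" "z c1 \<noteq> 0" "c2 \<in> block2 n" "z c2 \<noteq> 0"
  shows "section_div n s p m F c d R = unit_coset R (dehom F c d c1 c2)"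
  using section_div_coset [OF R _ c, where s = s and p = p and t = "\<lambda>_. 1" and m = m and F = F and c = c and d = d] e by simp

lemma section_div_coset_over:
  fixes p :: "nat \<Rightarrow> nat \<Rightarrow> 'a::field"
  assumes n: "n \<ge> 1" and gp: "general_position n s p" and i: "i \<in> {1..s}"
    and R: "subring_of R" "point_ring n (p i) \<subseteq> R" "exceptional_div n (p i) R = unit_coset R t"
    and c: "c1 \<in> block1 n" "p i c1 \<noteq> 0" "c2 \<in> block2 n" "p i c2 \<noteq> 0"
  shows "section_div n s p m F c d R = unit_coset R (dehom F c d c1 c2 * t powi (- m i))"
proof -
  have pb: "p j \<in> biproj n" if "j \<in> {1..s}" for j using gp that by (simp add: general_position_def)
  define T where "T j = (if j = i then t else 1)" for j
  have "exceptional_div n (p j) R = unit_coset R (T j)" if j: "j \<in> {1..s}" for j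
  proof (cases "j = i")
    case True then show ?thesis using R(3) by (simp add: T_def)
  next
    case False
    then have "exceptional_div n (p j) R = unit_set R"
      using exceptional_div_away [OF R(2) pb [OF i] pb [OF j]] general_position_distinct [OF gp n i j] by auto
    then show ?thesis using False by (simp add: T_def)
  qed
  from section_div_coset [OF R(1,2) this c]
  have "section_div n s p m F c d R = unit_coset R (dehom F c d c1 c2 * (\<Prod>j\<in>{1..s}. T j powi (- m j)))" .
  also have "(\<Prod>j\<in>{1..s}. T j powi (- m j)) = (\<Prod>j\<in>{1..s}. if j = i then t powi (- m i) else 1)"
    by (intro prod.cong) (auto simp: T_def)
  also have "\<dots> = t powi (- m i)" using i by simp
  finally show ?thesis .
qed

text \<open>
  The exponents \<open>d1\<close> and \<open>d2\<close> are integers until the section is known to be a polynomial; this clears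
  the denominators in powers with exponent of either sign.
\<close>
lemma powi_divide_nat:
  fixes x y :: "'k::field"
  assumes "x \<noteq> 0" "y \<noteq> 0"
  shows "(x / y) powi d * (x ^ nat (- d) * y ^ nat d) = x ^ nat d * y ^ nat (- d)"
  using assms by (cases "d \<ge> 0") (auto simp: power_int_def power_divide field_simps)

section \<open>Sections of the line bundle are polynomials\<close>

text \<open>
  The two products in parentheses are numerator and denominator of \<open>f x\<^sub>0\<^bsup>d1\<^esup> y\<^sub>0\<^bsup>d2\<^esup>\<close> with the negative
  powers moved to the other side.
\<close>
lemma regular_at_point:
  assumes f: "f = Fract A B" "B \<noteq> 0"
    and z: "z \<in> biproj n" "\<forall>i\<in>{1..s}. z \<notin> point_class n (p i)" and p: "\<forall>i\<in>{1..s}. p i \<in> biproj n"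
    and eff: "effective_on (blowup n s p) (add_principal (blowup_div n s p d1 d2 m) f)"
  shows "\<exists>A' B'. (A * pvar 0 ^ nat d1 * pvar (n + 1) ^ nat d2) * B' =
            A' * (B * pvar 0 ^ nat (- d1) * pvar (n + 1) ^ nat (- d2)) \<and> peval B' z \<noteq> 0"
proof -
  let ?R = "point_ring n z"
  have "point_class n z \<noteq> point_class n (p i)" if "i \<in> {1..s}" for i
    using z(2) that self_in_point_class by metis
  then have "?R \<in> blowup n s p"
    unfolding blowup_def using point_irreducible_closed [OF z(1)] by blast
  then have D: "add_principal (blowup_div n s p d1 d2 m) f ?R \<subseteq> ?R" using eff by (simp add: effective_on_def)
  have R: "subring_of ?R" by (rule local_ring_subring [OF point_prime])
  obtain c1 c2 where c: "c1 \<in> block1 n" "z c1 \<noteq> 0" "c2 \<in> block2 n" "z c2 \<noteq> 0" using biproj_coords [OF z(1)] .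
  define h1 where "h1 = Fract (pvar 0) (pvar c1 :: 'a mpol)"
  define h2 where "h2 = Fract (pvar (n + 1)) (pvar c2 :: 'a mpol)"
  have "blowup_div n s p d1 d2 m ?R =
     unit_coset ?R (h1 powi d1 * h2 powi d2 * (\<Prod>i\<in>{1..s}. (\<lambda>_. 1) i powi (- m i)))"
    unfolding h1_def h2_def
    by (rule blowup_div_coset [OF R H_coset(1) [OF R order_refl c(1,2)] H_coset(2) [OF R order_refl c(3,4)]])
       (use exceptional_div_away [OF order_refl z(1)] z p in simp)
  then have "blowup_div n s p d1 d2 m ?R = unit_coset ?R (h1 powi d1 * h2 powi d2)" by simp
  from D [unfolded add_principal_coset [of "blowup_div n s p d1 d2 m" ?R _ f, OF this] unit_coset_subset_iff [OF R]]
  have "h1 powi d1 * h2 powi d2 * f \<in> ?R" .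
  then obtain A' B' a b where AB: "h1 powi d1 * h2 powi d2 * f = Fract A' B'" "bihom n a b B'" "\<not> vanishes_on B' (point_class n z)"
    unfolding local_ring_iff by blast
  then have B': "B' \<noteq> 0" "peval B' z \<noteq> 0" using not_vanishes_nonzero vanishes_on_point by metis+
  define x where "x i = to_fract (pvar i :: 'a mpol)" for i
  have xn: "x i \<noteq> 0" for i by (simp add: x_def)
  have h: "h1 = x 0 / x c1" "h2 = x (n + 1) / x c2" by (simp_all add: h1_def h2_def x_def Fract_conv_to_fract)
  have "to_fract (A * pvar 0 ^ nat d1 * pvar (n + 1) ^ nat d2 * (pvar c1 ^ nat (- d1) * pvar c2 ^ nat (- d2) * B'))
     = to_fract A * (x 0 ^ nat d1 * x c1 ^ nat (- d1)) * (x (n + 1) ^ nat d2 * x c2 ^ nat (- d2)) * to_fract B'"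
    by (simp add: x_def rhom_power [OF rhom_to_fract] mult_ac)
  also have "\<dots> = to_fract A * (h1 powi d1 * (x 0 ^ nat (- d1) * x c1 ^ nat d1)) *
       (h2 powi d2 * (x (n + 1) ^ nat (- d2) * x c2 ^ nat d2)) * to_fract B'"
    unfolding h by (simp only: powi_divide_nat [OF xn xn])
  also have "\<dots> = (h1 powi d1 * h2 powi d2 * f) * to_fract B' * to_fract B * (x 0 ^ nat (- d1) * x c1 ^ nat d1) * (x (n + 1) ^ nat (- d2) * x c2 ^ nat d2)"
    using f by (simp add: Fract_conv_to_fract mult_ac)
  also have "\<dots> = to_fract (A' * pvar c1 ^ nat d1 * pvar c2 ^ nat d2 * (B * pvar 0 ^ nat (- d1) * pvar (n + 1) ^ nat (- d2)))"
    unfolding AB(1) using B' by (simp add: Fract_conv_to_fract x_def rhom_power [OF rhom_to_fract] mult_ac)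
  finally have "A * pvar 0 ^ nat d1 * pvar (n + 1) ^ nat d2 * (pvar c1 ^ nat (- d1) * pvar c2 ^ nat (- d2) * B')
     = A' * pvar c1 ^ nat d1 * pvar c2 ^ nat d2 * (B * pvar 0 ^ nat (- d1) * pvar (n + 1) ^ nat (- d2))"
    by (simp only: to_fract_eq_iff)
  moreover have "peval (pvar c1 ^ nat (- d1) * pvar c2 ^ nat (- d2) * B') z \<noteq> 0" using c B' by simp
  ultimately show ?thesis by blast
qed

lemma idx_blocks: "0 \<in> block1 n" "n + 1 \<in> block2 n" by (auto simp: block1_def block2_def)

lemma bihom_pvar_powers:
  assumes "a1 \<in> block1 n" "a2 \<in> block2 n" shows "bihom n c d (pvar a1 ^ c * pvar a2 ^ d)"
  using bihom_mult [OF bihom_power [OF bihom_pvar1 [OF assms(1)], of c] bihom_power [OF bihom_pvar2 [OF assms(2)], of d]]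
  by simp

text \<open>
  By \<open>regular_imp_dvd\<close> the denominator of \<open>f x\<^sub>0\<^bsup>d1\<^esup> y\<^sub>0\<^bsup>d2\<^esup>\<close> divides the numerator. The bidegree of the
  quotient is \<open>(d1, d2)\<close>, so that these integers are not negative.
\<close>
lemma section_polynomial:
  fixes p :: "nat \<Rightarrow> nat \<Rightarrow> 'a :: {alg_closed_field, field_char_0}"
  assumes n: "n \<ge> 1" and p: "\<forall>i\<in>{1..s}. p i \<in> biproj n"
    and f: "f \<in> function_field n" "f \<noteq> 0"
    and eff: "effective_on (blowup n s p) (add_principal (blowup_div n s p d1 d2 m) f)"
  shows "\<exists>F c d. bihom n c d F \<and> F \<noteq> 0 \<and> d1 = int c \<and> d2 = int d \<and> f = dehom F c d 0 (n + 1)"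
proof -
  obtain A B a b where AB: "f = Fract A B" "bihom n a b A" "bihom n a b B" "B \<noteq> 0"
    using f unfolding function_field_def by blast
  have A0: "A \<noteq> 0" using f AB by (auto simp: Fract_eq_0_iff)
  note x = bihom_pvar_powers [OF idx_blocks]
  let ?A = "A * pvar 0 ^ nat d1 * pvar (n + 1) ^ nat d2"
  let ?B = "B * pvar 0 ^ nat (- d1) * pvar (n + 1) ^ nat (- d2)"
  have A: "bihom n (a + nat d1) (b + nat d2) ?A" using bihom_mult [OF AB(2) x] by (simp add: mult.assoc)
  have B: "bihom n (a + nat (- d1)) (b + nat (- d2)) ?B" using bihom_mult [OF AB(3) x] by (simp add: mult.assoc)
  have "?B dvd ?A"
  proof (rule regular_imp_dvd [OF n A B])
    show "?B \<noteq> 0" using AB by simp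
    fix z assume "z \<in> biproj n" "\<forall>i\<in>{1..s}. z \<notin> point_class n (p i)"
    then show "\<exists>A' B'. ?A * B' = A' * ?B \<and> peval B' z \<noteq> 0"
      using regular_at_point [OF AB(1) AB(4) _ _ p eff] by blast
  qed
  then obtain F where F: "?A = F * ?B" by (metis dvdE mult.commute)
  have "?A \<noteq> 0" using A0 by simp
  then obtain c d where cd: "a + nat d1 = a + nat (- d1) + c" "b + nat d2 = b + nat (- d2) + d" "bihom n c d F"
    using bihom_quotient [OF B A F] by blast
  then have d: "d1 = int c" "d2 = int d" by linarith+
  have "A * (pvar 0 ^ c * pvar (n + 1) ^ d) = F * B" using F unfolding d by (simp add: mult.assoc)
  then have "f = dehom F c d 0 (n + 1)" unfolding AB(1) using AB(4) by (simp add: eq_fract)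
  moreover have "F \<noteq> 0" using F \<open>?A \<noteq> 0\<close> by auto
  ultimately show ?thesis using d cd by blast
qed

lemma order_valuation_theta: "order_valuation (theta q)"
  by unfold_locales (simp_all add: rhom_theta)

lemma order_0_theta: "peval B q \<noteq> 0 \<Longrightarrow> order 0 (theta q B) = 0"
  using poly_theta_0 [of q B] by (intro order_0I) simp

text \<open>
  The generic point of the exceptional divisor. A linear form through \<open>q\<close> divided by a coordinate
  has order one and serves as \<open>t\<close>; the prime \<open>Q\<close> consists of the elements of positive order in the chart of \<open>t\<close>,
  and it is prime because the order is a valuation.
\<close>
lemma generic_exceptional_point:
  fixes q :: "nat \<Rightarrow> 'a::field"
  assumes n: "n \<ge> 1" and q: "q \<in> biproj n"
  defines "Rq \<equiv> point_ring n q"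
  shows "\<exists>t Q. t \<in> point_ideal n q \<and> t \<noteq> 0 \<and> prime_ideal_of (affine_blowup Rq (point_ideal n q) t) Q \<and> t \<in> Q \<and>
     localize (affine_blowup Rq (point_ideal n q) t) Q \<subseteq> order_valuation.vge (theta q) 0 \<and>
     order_valuation.val (theta q) t = 1"
proof -
  interpret order_valuation "theta q" by (rule order_valuation_theta)
  interpret ideal_in Rq "point_ideal n q"
    unfolding point_ideal_def Rq_def by (rule nonunits_ideal [OF point_prime])
  have v0: "vord B = 0" if "peval B q \<noteq> 0" for B using order_0_theta [OF that] by (simp add: vord_def)
  have O0: "Rq \<subseteq> vge 0"
  proof
    fix x assume "x \<in> Rq"
    then obtain A B a b where x: "x = Fract A B" "bihom n a b B" "\<not> vanishes_on B (point_class n q)"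
      unfolding Rq_def local_ring_iff by blast
    then have "peval B q \<noteq> 0" "B \<noteq> 0" using vanishes_on_point not_vanishes_nonzero by metis+
    then show "x \<in> vge 0" unfolding x by (simp add: vge_Fract v0)
  qed
  have I1: "point_ideal n q \<subseteq> vge 1"
  proof
    fix x assume "x \<in> point_ideal n q"
    then obtain A B a b where x: "x = Fract A B" "bihom n a b A" "bihom n a b B"
       "vanishes_on A (point_class n q)" "\<not> vanishes_on B (point_class n q)"
      unfolding point_ideal_def by (rule nonunitsE [OF point_prime])
    then have B: "peval B q \<noteq> 0" "B \<noteq> 0" and A: "peval A q = 0" using vanishes_on_point not_vanishes_nonzero by metis+
    have "tau ^ 1 dvd theta q A"
      using A poly_theta_0 [of q A] by (simp add: poly_eq_0_iff_dvd)
    then have "A \<noteq> 0 \<Longrightarrow> 1 \<le> vord A" using vord_ge_iff by blast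
    then show "x \<in> vge 1" unfolding x using B by (auto simp: vge_Fract v0)
  qed
  obtain a where a: "a \<in> block1 n" "q a \<noteq> 0" using q by (auto simp: biproj_def)
  obtain b where b: "b \<in> block1 n" "b \<noteq> a"
    using n by (metis block1_def atLeastAtMost_iff le0 zero_neq_one)
  define l where "l = mconst (q a) * pvar b - mconst (q b) * pvar a"
  have l1: "bihom n 1 0 l" unfolding l_def by (intro bihom_diff bihom_mconst_mult bihom_pvar1 a b)
  have lq: "peval l q = 0" by (simp add: l_def mult.commute)
  have "peval l (\<lambda>j. if j = b then 1 else 0) = q a" using b by (simp add: l_def)
  then have l0: "l \<noteq> 0" using a by auto
  define t where "t = Fract l (pvar a)"
  have t: "t \<in> point_ideal n q" "t \<noteq> 0"
  proof -
    show "t \<in> point_ideal n q"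
      unfolding t_def point_ideal_def
      using nonunits_iff [OF point_prime l1 bihom_pvar1 [OF a(1)]] vanishes_on_point [OF l1]
        vanishes_on_point [OF bihom_pvar1 [OF a(1)]] lq a by auto
    show "t \<noteq> 0" using l0 by (simp add: t_def Fract_eq_0_iff)
  qed
  have "theta q l = [:0, l:]" by (simp add: l_def mult.commute)
  also have "\<dots> = tau * [:l:]" by simp
  finally have th: "theta q l = tau * [:l:]" .
  have "order 0 (theta q l) = 1"
    unfolding th using l0 order_power_n_n [of 0 1] by (subst order_mult) (auto simp: order_0I)
  then have vt: "val t = 1" unfolding t_def using l0 a v0 [of "pvar a"] by (simp add: val_Fract) (simp add: vord_def)
  define A where "A = affine_blowup Rq (point_ideal n q) t"
  have A0: "A \<subseteq> vge 0"
  proof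
    fix x assume "x \<in> A"
    then obtain a k where x: "x = a / t ^ k" "a \<in> ideal_power Rq (point_ideal n q) k"
      unfolding A_def affine_blowup_def by blast
    then have "a \<in> vge (int k)" using vge_ideal_power [OF O0 I1] by blast
    then show "x \<in> vge 0" unfolding x vge_def using t by (cases "a = 0") (simp_all add: val_divide val_power vt)
  qed
  define Q where "Q = A \<inter> vge 1"
  have subA: "subring_of A" unfolding A_def using t by (rule affine_blowup_subring)
  have QA: "prime_ideal_of A Q"
    unfolding prime_ideal_of_def
  proof (intro conjI ballI impI)
    show "Q \<subseteq> A" "0 \<in> Q" "1 \<notin> Q" using subring_0 [OF subA] by (auto simp: Q_def vge_def)
    show "a - b \<in> Q" if "a \<in> Q" "b \<in> Q" for a b
      using that by (auto simp: Q_def intro: subring_diff [OF subA] vge_diff)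
    show "a * b \<in> Q" if "a \<in> A" "b \<in> Q" for a b
    proof -
      have "a * b \<in> vge (0 + 1)" using that A0 by (intro vge_mult) (auto simp: Q_def)
      then show ?thesis using that by (auto simp: Q_def intro: subring_mult [OF subA])
    qed
    show "a \<in> Q \<or> b \<in> Q" if "a \<in> A" "b \<in> A" "a * b \<in> Q" for a b
    proof (cases "a = 0 \<or> b = 0")
      case False
      then have "1 \<le> val a + val b" using that by (auto simp: Q_def vge_def val_mult)
      then have "1 \<le> val a \<or> 1 \<le> val b" by linarith
      then show ?thesis using that by (auto simp: Q_def vge_def)
    qed (use that in \<open>auto simp: Q_def\<close>)
  qed
  have "localize A Q \<subseteq> vge 0"
  proof
    fix x assume "x \<in> localize A Q"
    then obtain a b where x: "x = a / b" "a \<in> A" "b \<in> A - Q" unfolding localize_def by blast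
    have "b \<noteq> 0" "val b = 0" using x A0 by (auto simp: Q_def vge_def)
    then show "x \<in> vge 0" using x A0 by (cases "a = 0") (auto simp: vge_def val_divide)
  qed
  moreover have "t \<in> Q"
  proof -
    have "t \<in> A" using t sub ring_subset_affine_blowup unfolding A_def by blast
    then show ?thesis by (simp add: Q_def vge_def vt)
  qed
  ultimately show ?thesis using t QA vt unfolding A_def by blast
qed

text \<open>
  At the generic point of the exceptional divisor the local equation is the dehomogenization of \<open>F\<close> divided by
  \<open>t\<close> to the power \<open>m i\<close>, where \<open>t\<close> has order one; it has to have order at least zero.
\<close>
lemma section_multiplicity:
  fixes p :: "nat \<Rightarrow> nat \<Rightarrow> 'a :: {alg_closed_field, field_char_0}"
  assumes n: "n \<ge> 1" and gp: "general_position n s p" and i: "i \<in> {1..s}"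
    and F: "bihom n c d F" "F \<noteq> 0"
    and eff: "effective_on (blowup n s p) (section_div n s p m F c d)"
  shows "tau ^ nat (m i) dvd theta (p i) F"
proof -
  let ?O = "point_ring n (p i)"
  have pb: "p j \<in> biproj n" if "j \<in> {1..s}" for j using gp that by (simp add: general_position_def)
  interpret order_valuation "theta (p i)" by (rule order_valuation_theta)
  obtain t Q where t: "t \<in> point_ideal n (p i)" "t \<noteq> 0"
    and Q: "prime_ideal_of (affine_blowup ?O (point_ideal n (p i)) t) Q" "t \<in> Q"
    and sub: "localize (affine_blowup ?O (point_ideal n (p i)) t) Q \<subseteq> vge 0" and vt: "val t = 1"
    using generic_exceptional_point [OF n pb [OF i]] by blast
  define R where "R = localize (affine_blowup ?O (point_ideal n (p i)) t) Q"
  note ex = exceptional_div_over [OF refl t Q, folded R_def]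
  have "R \<in> blowup n s p" unfolding blowup_def R_def using i t Q by blast
  then have D: "section_div n s p m F c d R \<subseteq> R" using eff by (simp add: effective_on_def)
  obtain c1 c2 where cc: "c1 \<in> block1 n" "p i c1 \<noteq> 0" "c2 \<in> block2 n" "p i c2 \<noteq> 0"
    using biproj_coords [OF pb [OF i]] .
  have "dehom F c d c1 c2 * t powi (- m i) \<in> R"
    using D unfolding section_div_coset_over [OF n gp i ex(1-3) cc] unit_coset_subset_iff [OF ex(1)] .
  then have "dehom F c d c1 c2 * t powi (- m i) \<in> vge 0" using sub unfolding R_def by blast
  moreover have nz: "dehom F c d c1 c2 \<noteq> 0" using F by (simp add: Fract_eq_0_iff)
  ultimately have "0 \<le> val (dehom F c d c1 c2) - m i"
    using t by (simp add: vge_def val_mult val_power_int vt)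
  moreover have "vord (pvar c1 ^ c * pvar c2 ^ d) = 0"
    unfolding vord_def using cc by (intro order_0_theta) simp
  ultimately have "m i \<le> int (vord F)" using F by (simp add: val_Fract)
  then have "nat (m i) \<le> vord F" by linarith
  then show ?thesis using vord_ge_iff F by blast
qed

section \<open>Multiplicity along a bilinear span\<close>

context adapted_coordinates
begin

lemma span_prime_locus:
  assumes "\<forall>i\<in>I. p i \<in> biproj n" shows "prime_locus n (bilinear_span n p I)"
  unfolding prime_locus_def
proof (intro conjI allI impI)
  obtain i where i: "i \<in> I" using fin by blast
  have "p i \<in> bilinear_span n p I"
  proof (rule span_if_pt_adapted_0)
    show "p i \<in> biproj n" using assms i by blast
    show "pt_adapted (p i) j = 0" if "j \<in> rest" for j
    proof -
      have "j \<in> blocks n" using that by (auto simp: rest_def)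
      moreover have "j \<noteq> s1 i" "j \<noteq> s2 i"
        using that i fin s1 s2 block_disjointD [of _ n] by (auto simp: rest_def)
      ultimately show ?thesis using pt_adapted_point [OF i] by (simp add: unit_point_def)
    qed
  qed
  then show "bilinear_span n p I \<noteq> {}" by blast
qed (rule span_prime)

text \<open>
  Each point of \<open>I\<close> bounds the exponents of its own two coordinates by \<open>c + d - m i\<close>; the remaining coordinates
  take up the rest of the total degree \<open>c + d\<close>.
\<close>
lemma rest_exponent_bound:
  assumes F: "bihom n c d F" and m: "\<forall>i\<in>I. tau ^ nat (m i) dvd theta (p i) F" and e: "e \<in> keys (to_adapted F)"
  shows "(\<Sum>i\<in>I. m i) - (int (card I) - 1) * int (c + d) \<le> int (\<Sum>j\<in>rest. lookup e j)"
proof -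
  have inj2': "inj_on s2 I" using inj2 fin inj_on_subset by blast
  have be: "bideg n c d e" using bihom_to_adapted [OF F] e by (simp add: bihom_iff)
  have finI: "finite I" using fin finite_subset by blast
  have "(\<Sum>j\<in>rest. lookup e j) = (\<Sum>j\<in>block1 n - s1 ` I. lookup e j) + (\<Sum>j\<in>block2 n - s2 ` I. lookup e j)"
    unfolding rest_def by (rule sum.union_disjoint) (use block_disjoint [of n] in auto)
  moreover have "(\<Sum>j\<in>block1 n. lookup e j) = (\<Sum>j\<in>block1 n - s1 ` I. lookup e j) + (\<Sum>j\<in>s1 ` I. lookup e j)"
    by (rule sum.subset_diff [OF s1]) simp
  moreover have "(\<Sum>j\<in>block2 n. lookup e j) = (\<Sum>j\<in>block2 n - s2 ` I. lookup e j) + (\<Sum>j\<in>s2 ` I. lookup e j)"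
    by (rule sum.subset_diff) (use s2 fin in auto)
  moreover have "(\<Sum>j\<in>s1 ` I. lookup e j) + (\<Sum>j\<in>s2 ` I. lookup e j) = (\<Sum>i\<in>I. lookup e (s1 i) + lookup e (s2 i))"
    by (simp add: sum.reindex inj1 inj2' sum.distrib)
  ultimately have tot: "(\<Sum>j\<in>rest. lookup e j) + (\<Sum>i\<in>I. lookup e (s1 i) + lookup e (s2 i)) = c + d"
    using be by (simp add: bideg_def)
  have "int (lookup e (s1 i) + lookup e (s2 i)) + m i \<le> int (c + d)" if "i \<in> I" for i
    using monomial_bound_to_adapted [OF F that _ e, of "nat (m i)"] m that by auto
  then have "(\<Sum>i\<in>I. int (lookup e (s1 i) + lookup e (s2 i)) + m i) \<le> (\<Sum>i\<in>I. int (c + d))"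
    by (rule sum_mono)
  moreover have "int (\<Sum>i\<in>I. lookup e (s1 i) + lookup e (s2 i)) + (\<Sum>i\<in>I. m i) =
      (\<Sum>i\<in>I. int (lookup e (s1 i) + lookup e (s2 i)) + m i)"
    unfolding of_nat_sum by (rule sum.distrib [symmetric])
  moreover have "(\<Sum>i\<in>I. int (c + d)) = int (card I) * int (c + d)" by simp
  ultimately have "int (\<Sum>i\<in>I. lookup e (s1 i) + lookup e (s2 i)) + (\<Sum>i\<in>I. m i) \<le> int (card I) * int (c + d)"
    by linarith
  moreover have "int (\<Sum>i\<in>I. lookup e (s1 i) + lookup e (s2 i)) = int (c + d) - int (\<Sum>j\<in>rest. lookup e j)"
    using arg_cong [OF tot, of int] by simp
  ultimately show ?thesis by (simp add: algebra_simps)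
qed

text \<open>
  Each monomial in adapted coordinates, divided by powers of \<open>a1\<close> and \<open>a2\<close>, is a product of regular functions,
  and those that belong to \<open>rest\<close> vanish on the span.
\<close>
lemma span_ideal_power:
  assumes p: "\<forall>i\<in>I. p i \<in> biproj n"
    and F: "bihom n c d F" and m: "\<forall>i\<in>I. tau ^ nat (m i) dvd theta (p i) F"
    and a: "a1 \<in> block1 n" "a2 \<in> block2 n"
      "\<not> vanishes_on (pvar a1) (bilinear_span n p I)" "\<not> vanishes_on (pvar a2) (bilinear_span n p I)"
  defines "R \<equiv> local_ring n (bilinear_span n p I)"
  shows "dehom F c d a1 a2 \<in>
     ideal_power R (nonunits R) (nat ((\<Sum>i\<in>I. m i) - (int (card I) - 1) * int (c + d)))" (is "_ \<in> ideal_power R _ ?M")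
proof -
  note pl = span_prime_locus [OF p]
  interpret ideal_in R "nonunits R" unfolding R_def by (rule nonunits_ideal [OF pl])
  define r where "r j = Fract (linform n L j) (pvar (if j \<in> block1 n then a1 else a2))" for j
  have rR: "r j \<in> R" and rI: "j \<in> rest \<Longrightarrow> r j \<in> nonunits R" if j: "j \<in> blocks n" for j
  proof -
    obtain k l where bh: "bihom n k l (linform n L j)" "bihom n k l (pvar (if j \<in> block1 n then a1 else a2) :: 'a mpol)"
      using j bihom_linform1 [of j n L] bihom_linform2 [of j n L] bihom_pvar1 [OF a(1)] bihom_pvar2 [OF a(2)]
      by (cases "j \<in> block1 n") auto
    have nv: "\<not> vanishes_on (pvar (if j \<in> block1 n then a1 else a2)) (bilinear_span n p I)" using a by auto
    show "r j \<in> R" unfolding r_def R_def local_ring_iff using bh nv by blast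
    show "r j \<in> nonunits R" if "j \<in> rest"
      unfolding r_def R_def nonunits_iff [OF pl bh nv] vanishes_on_def
      using pt_adapted_span_0 [OF _ that] by (simp add: pt_adapted_def)
  qed
  let ?G = "to_adapted F"
  have summand: "to_fract (mconst (lookup ?G e)) * (\<Prod>j\<in>blocks n. r j ^ lookup e j) \<in> ideal_power R (nonunits R) ?M"
    if e: "e \<in> keys ?G" for e
  proof -
    have "?M \<le> (\<Sum>j\<in>rest. lookup e j)" using rest_exponent_bound [OF F m e] by linarith
    moreover have "blocks n \<inter> rest = rest" by (auto simp: rest_def)
    ultimately have "ideal_power R (nonunits R) (\<Sum>j\<in>blocks n \<inter> rest. lookup e j) \<subseteq> ideal_power R (nonunits R) ?M"
      using ip_antimono by simp
    moreover have "(\<Prod>j\<in>blocks n. r j ^ lookup e j) \<in> ideal_power R (nonunits R) (\<Sum>j\<in>blocks n \<inter> rest. lookup e j)"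
      by (rule ip_prod) (use rR rI in auto)
    moreover have "to_fract (mconst (lookup ?G e)) \<in> R"
    proof -
      have "\<not> vanishes_on 1 (bilinear_span n p I)" using pl by (auto simp: prime_locus_def vanishes_on_def)
      then show ?thesis unfolding R_def local_ring_iff to_fract_def using bihom_mconst bihom_1 by blast
    qed
    ultimately show ?thesis using ip_absorb by blast
  qed
  have "dehom F c d a1 a2 =
     (\<Sum>e\<in>keys ?G. to_fract (mconst (lookup ?G e)) * (\<Prod>j\<in>blocks n. r j ^ lookup e j))"
  proof -
    have t: "to_fract (mconst (lookup ?G e)) * (\<Prod>j\<in>blocks n. r j ^ lookup e j)
        = to_fract (mconst (lookup ?G e) * (\<Prod>j\<in>keys e. linform n L j ^ lookup e j)) / to_fract (pvar a1 ^ c * pvar a2 ^ d)"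
      if e: "e \<in> keys ?G" for e
    proof -
      have be: "bideg n c d e" using bihom_to_adapted [OF F] e by (simp add: bihom_iff)
      have 1: "(\<Prod>j\<in>block1 n. r j ^ lookup e j) = to_fract (\<Prod>j\<in>block1 n. linform n L j ^ lookup e j) / to_fract (pvar a1) ^ c"
      proof -
        have "(\<Prod>j\<in>block1 n. r j ^ lookup e j) = (\<Prod>j\<in>block1 n. to_fract (linform n L j) ^ lookup e j / to_fract (pvar a1) ^ lookup e j)"
          by (intro prod.cong refl) (simp add: r_def Fract_conv_to_fract power_divide)
        also have "\<dots> = (\<Prod>j\<in>block1 n. to_fract (linform n L j) ^ lookup e j) / to_fract (pvar a1) ^ (\<Sum>j\<in>block1 n. lookup e j)"
          by (simp add: prod_dividef power_sum)
        finally show ?thesis using be by (simp add: bideg_def rhom_simps [OF rhom_to_fract])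
      qed
      have 2: "(\<Prod>j\<in>block2 n. r j ^ lookup e j) = to_fract (\<Prod>j\<in>block2 n. linform n L j ^ lookup e j) / to_fract (pvar a2) ^ d"
      proof -
        have "(\<Prod>j\<in>block2 n. r j ^ lookup e j) = (\<Prod>j\<in>block2 n. to_fract (linform n L j) ^ lookup e j / to_fract (pvar a2) ^ lookup e j)"
          by (intro prod.cong refl) (simp add: r_def Fract_conv_to_fract power_divide block_disjointD)
        also have "\<dots> = (\<Prod>j\<in>block2 n. to_fract (linform n L j) ^ lookup e j) / to_fract (pvar a2) ^ (\<Sum>j\<in>block2 n. lookup e j)"
          by (simp add: prod_dividef power_sum)
        finally show ?thesis using be by (simp add: bideg_def rhom_simps [OF rhom_to_fract])
      qed
      have "(\<Prod>j\<in>blocks n. r j ^ lookup e j) = (\<Prod>j\<in>block1 n. r j ^ lookup e j) * (\<Prod>j\<in>block2 n. r j ^ lookup e j)"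
        by (rule prod.union_disjoint) (simp_all add: block_disjoint)
      then show ?thesis unfolding bideg_monomial_value [OF be] 1 2
        by (simp add: rhom_power [OF rhom_to_fract])
    qed
    have "(\<Sum>e\<in>keys ?G. to_fract (mconst (lookup ?G e)) * (\<Prod>j\<in>blocks n. r j ^ lookup e j))
        = to_fract (of_adapted ?G) / to_fract (pvar a1 ^ c * pvar a2 ^ d)"
      by (simp only: t sum_divide_distrib [symmetric] to_fract_sum [symmetric] msub_def [symmetric] cong: sum.cong)
    then show ?thesis by (simp only: of_adapted_to_adapted Fract_conv_to_fract)
  qed
  then show ?thesis using ip_sum [OF summand] by simp
qed

end

text \<open>
  For a singleton \<open>I\<close> this says that the order in the Taylor expansion bounds the multiplicity in the local
  ring of the point from below; in this form it is used in the proof of effectiveness.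
\<close>
lemma multiplicity_along_span:
  fixes p :: "nat \<Rightarrow> nat \<Rightarrow> 'a::field_char_0"
  assumes "finite I" "I \<noteq> {}" "independent_in (block1 n) p I" "independent_in (block2 n) p I"
    and "\<forall>i\<in>I. p i \<in> biproj n"
    and "bihom n c d F" and "\<forall>i\<in>I. tau ^ nat (m i) dvd theta (p i) F"
    and "a1 \<in> block1 n" "a2 \<in> block2 n"
      "\<not> vanishes_on (pvar a1) (bilinear_span n p I)" "\<not> vanishes_on (pvar a2) (bilinear_span n p I)"
  shows "dehom F c d a1 a2 \<in>
     ideal_power (local_ring n (bilinear_span n p I)) (nonunits (local_ring n (bilinear_span n p I)))
       (nat ((\<Sum>i\<in>I. m i) - (int (card I) - 1) * int (c + d)))"
proof -
  obtain s1 s2 B L where "adapted_coordinates n p I I s1 s2 B L"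
    using adapted_coordinates_exist [OF assms(1) order_refl assms(2-4)] by blast
  then show ?thesis by (rule adapted_coordinates.span_ideal_power) fact+
qed

lemma bilinear_span_single:
  assumes q: "p i \<in> biproj n" shows "bilinear_span n p {i} = point_class n (p i)"
proof (intro set_eqI iffI)
  fix z assume "z \<in> bilinear_span n p {i}"
  then obtain c d where z: "z \<in> biproj n" "\<forall>j\<in>block1 n. z j = c i * p i j" "\<forall>j\<in>block2 n. z j = d i * p i j"
    by (auto simp: bilinear_span_def)
  then show "z \<in> point_class n (p i)"
    using q by (intro same_class_if_proportional) auto
next
  fix z assume "z \<in> point_class n (p i)"
  then have zb: "z \<in> biproj n" using point_class_biproj [OF q] by blast
  obtain a b where z: "z = (\<lambda>j. if j \<in> block1 n then a * p i j else b * p i j)"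
    using \<open>z \<in> point_class n (p i)\<close> unfolding point_class_def by blast
  have "\<exists>c. \<forall>j\<in>block1 n. z j = (\<Sum>i\<in>{i}. c i * p i j)" by (rule exI [of _ "\<lambda>_. a"]) (simp add: z)
  moreover have "\<exists>c. \<forall>j\<in>block2 n. z j = (\<Sum>i\<in>{i}. c i * p i j)"
    by (rule exI [of _ "\<lambda>_. b"]) (simp add: z block_disjointD)
  ultimately show "z \<in> bilinear_span n p {i}" using zb by (simp add: bilinear_span_def)
qed

lemma point_in_span:
  assumes "finite I" "i \<in> I" "p i \<in> biproj n" shows "p i \<in> bilinear_span n p I"
proof -
  have "p i j = (\<Sum>k\<in>I. (if k = i then 1 else 0) * p k j)" for j
  proof -
    have "(\<Sum>k\<in>I. (if k = i then 1 else 0) * p k j) = (\<Sum>k\<in>I. if i = k then p k j else 0)"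
      by (intro sum.cong) auto
    then show ?thesis using assms by simp
  qed
  then have "\<exists>c. \<forall>j\<in>J. p i j = (\<Sum>k\<in>I. c k * p k j)" for J
    by (intro exI [of _ "\<lambda>k. if k = i then 1 else 0"] ballI)
  then show ?thesis using assms by (simp add: bilinear_span_def)
qed

section \<open>Polynomials with the prescribed multiplicities are sections\<close>

text \<open>
  Away from the exceptional divisors the local equation is a dehomogenization of \<open>F\<close>. Over \<open>p i\<close> it is divided by
  \<open>t\<close> to the power \<open>m i\<close>, and this is allowed since the dehomogenization lies in the corresponding power of
  the maximal ideal.
\<close>
lemma effective_if_multiplicities:
  fixes p :: "nat \<Rightarrow> nat \<Rightarrow> 'a::field_char_0"
  assumes n: "n \<ge> 1" and gp: "general_position n s p"
    and F: "bihom n c d F" and m: "\<forall>i\<in>{1..s}. tau ^ nat (m i) dvd theta (p i) F"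
  shows "effective_on (blowup n s p) (section_div n s p m F c d)"
  unfolding effective_on_def
proof
  let ?D = "section_div n s p m F c d"
  have pb: "p j \<in> biproj n" if "j \<in> {1..s}" for j using gp that by (simp add: general_position_def)
  fix R assume "R \<in> blowup n s p"
  then consider V where "R = local_ring n V" "irreducible_closed n V" "\<forall>i\<in>{1..s}. V \<noteq> point_class n (p i)"
    | i t A Q where "i \<in> {1..s}" "t \<in> point_ideal n (p i)" "t \<noteq> 0"
        "A = affine_blowup (point_ring n (p i)) (point_ideal n (p i)) t"
        "prime_ideal_of A Q" "t \<in> Q" "R = localize A Q"
    unfolding blowup_def by blast
  then show "?D R \<subseteq> R"
  proof cases
    case 1
    note pl = irreducible_closed_prime [OF 1(2)]
    have R: "subring_of R" unfolding 1(1) by (rule local_ring_subring [OF pl])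
    have Vb: "V \<subseteq> biproj n" using 1(2) by (auto simp: irreducible_closed_def zariski_closed_def)
    obtain z where z: "z \<in> V" using pl by (auto simp: prime_locus_def)
    have zR: "point_ring n y \<subseteq> R" if "y \<in> V" for y unfolding 1(1) using that by (rule local_ring_mono)
    obtain c1 c2 where c: "c1 \<in> block1 n" "z c1 \<noteq> 0" "c2 \<in> block2 n" "z c2 \<noteq> 0" using biproj_coords z Vb by blast
    have "exceptional_div n (p i) R = unit_set R" if i: "i \<in> {1..s}" for i
    proof -
      have "\<not> V \<subseteq> point_class n (p i)"
      proof
        assume sub: "V \<subseteq> point_class n (p i)"
        have "p i \<in> point_class n z" using point_class_sym [OF _ pb [OF i]] z sub Vb by blast
        moreover have "zariski_closed n V" using 1(2) by (simp add: irreducible_closed_def)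
        ultimately have "point_class n (p i) \<subseteq> V" using zariski_closed_saturated z by blast
        then show False using sub 1(3) i by blast
      qed
      then obtain y where "y \<in> V" "y \<notin> point_class n (p i)" by blast
      then show ?thesis using exceptional_div_away [OF zR _ pb [OF i]] Vb by blast
    qed
    then have D: "?D R = unit_coset R (dehom F c d c1 c2)"
      by (rule section_div_coset_away [OF R zR [OF z] _ c])
    have "dehom F c d c1 c2 \<in> R"
      using Fract_in_local_ring [OF F bihom_pvar_powers [OF c(1,3)], of z] c zR [OF z] by auto
    then show ?thesis unfolding D unit_coset_subset_iff [OF R] .
  next
    case 2
    note i = 2(1) and t = 2(2,3)
    note ex = exceptional_div_over [OF 2(4) t 2(5,6), folded 2(7)]
    let ?O = "point_ring n (p i)"
    obtain c1 c2 where cc: "c1 \<in> block1 n" "p i c1 \<noteq> 0" "c2 \<in> block2 n" "p i c2 \<noteq> 0"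
      using biproj_coords [OF pb [OF i]] .
    have FO: "dehom F c d c1 c2 \<in> ideal_power ?O (point_ideal n (p i)) (nat (m i))"
    proof -
      have "card {i} \<le> n + 1" "card {i} \<le> n + 2" "{i} \<subseteq> {1..s}" using i by auto
      then have ind: "independent_in (block1 n) p {i}" "independent_in (block2 n) p {i}"
        using gp unfolding general_position_def by blast+
      have sp: "bilinear_span n p {i} = point_class n (p i)" by (rule bilinear_span_single [of p i n, OF pb [OF i]])
      have "\<not> vanishes_on (pvar c1) (bilinear_span n p {i})" "\<not> vanishes_on (pvar c2) (bilinear_span n p {i})"
        unfolding sp vanishes_on_point [OF bihom_pvar1 [OF cc(1)]] vanishes_on_point [OF bihom_pvar2 [OF cc(3)]]
        using cc by auto
      from multiplicity_along_span [OF _ _ ind _ F _ cc(1,3) this, of m]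
      show ?thesis unfolding sp point_ideal_def using m pb i by simp
    qed
    have "dehom F c d c1 c2 * t powi (- m i) \<in> R"
    proof (cases "m i \<ge> 0")
      case True
      then have "t powi (- m i) = inverse (t ^ nat (m i))" by (simp add: power_int_def power_inverse)
      then show ?thesis using ex(4) [OF FO] by (simp add: divide_inverse)
    next
      case False
      interpret ideal_in ?O "point_ideal n (p i)"
        unfolding point_ideal_def by (rule nonunits_ideal [OF point_prime])
      have "t \<in> R" using t sub ex(2) by blast
      then have "t powi (- m i) \<in> R" using False by (simp add: power_int_def subring_power [OF ex(1)])
      moreover have "dehom F c d c1 c2 \<in> R" using FO ip_subset_ring ex(2) by blast
      ultimately show ?thesis by (intro subring_mult [OF ex(1)])
    qed
    then show ?thesis
      unfolding section_div_coset_over [OF n gp i ex(1-3) cc] unit_coset_subset_iff [OF ex(1)] .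
  qed
qed

section \<open>Order of vanishing along a coordinate hyperplane\<close>

text \<open>
  The order of a polynomial in the variable \<open>N\<close>, as the order in \<open>\<tau>\<close> after scaling this variable by \<open>\<tau>\<close>.
\<close>
definition hyp_sub :: "nat \<Rightarrow> 'a::field mpol \<Rightarrow> 'a mpol poly" where
  "hyp_sub N = psub (\<lambda>j. if j = N then [:0, pvar N:] else [:pvar j:])"

lemma rhom_hyp_sub: "rhom (hyp_sub N)" by (simp add: hyp_sub_def rhom_psub)

lemma hyp_sub_exponent:
  fixes G :: "'a::field_char_0 mpol"
  assumes dvd: "tau ^ k dvd hyp_sub N G" and e0: "e0 \<in> keys G"
  shows "k \<le> lookup e0 N"
proof -
  define L where "L = {G :: 'a mpol. tau ^ k dvd hyp_sub N G}"
  have "\<exists>G'\<in>L. e0 \<in> keys G' \<and> keys G' \<subseteq> {e \<in> keys G. \<forall>j\<in>UNIV. lookup e j = lookup e0 j}"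
  proof (rule isolate_euler)
    show "G \<in> L" "e0 \<in> keys G" using assms by (auto simp: L_def)
    show "reweight (\<lambda>e. of_nat (lookup e j) - c) F \<in> L" if "F \<in> L" for j c F
      unfolding L_def mem_Collect_eq hyp_sub_def
      by (rule tau_dvd_reweight_psub)
         (use that in \<open>auto simp: L_def hyp_sub_def map_poly_pCons euler_pvar\<close>)
  qed
  then obtain G' where G': "G' \<in> L" "e0 \<in> keys G'"
    and agree: "\<And>e. e \<in> keys G' \<Longrightarrow> \<forall>j. lookup e j = lookup e0 j" by blast
  have "keys G' \<subseteq> {e0}" using agree by (auto intro: poly_mapping_eqI)
  then have "G' = mconst (lookup G' e0) * monom_of e0" by (intro keys_eq_singletonD)
  then have "tau ^ k dvd hyp_sub N (mconst (lookup G' e0) * monom_of e0)" using G' by (simp add: L_def)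
  then have dvd: "tau ^ k dvd [:mconst (lookup G' e0):] * hyp_sub N (monom_of e0)" by (simp add: hyp_sub_def)
  have dm: "tau ^ k dvd hyp_sub N (monom_of e0 :: 'a mpol)"
    by (rule tau_power_dvd_mult_cancel [OF dvd]) (use G' in \<open>simp add: in_keys_iff\<close>)
  have "hyp_sub N (monom_of e0) = tau ^ (\<Sum>i\<in>keys e0. (if i = N then 1 else 0) * lookup e0 i) *
      (\<Prod>i\<in>keys e0. [:pvar i :: 'a mpol:] ^ lookup e0 i)"
    unfolding hyp_sub_def by (rule psub_monom_of) simp
  moreover have "(\<Sum>i\<in>keys e0. (if i = N then 1 else 0) * lookup e0 i) = (\<Sum>i\<in>keys e0. if i = N then lookup e0 i else 0)"
    by (intro sum.cong) auto
  then have "(\<Sum>i\<in>keys e0. (if i = N then 1 else 0) * lookup e0 i) = lookup e0 N"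
    by (auto simp: in_keys_iff)
  ultimately have "tau ^ k dvd tau ^ lookup e0 N * (\<Prod>i\<in>keys e0. [:pvar i :: 'a mpol:] ^ lookup e0 i)"
    using dm by simp
  then show ?thesis by (rule tau_power_dvd_le) (simp add: poly_prod)
qed

lemma order_valuation_hyp_sub:
  fixes \<phi> :: "'a::field mpol \<Rightarrow> 'a mpol"
  assumes "rhom \<phi>" "\<And>F. \<phi> F = 0 \<Longrightarrow> F = 0" shows "order_valuation (\<lambda>F. hyp_sub N (\<phi> F))"
proof
  show "rhom (\<lambda>F. hyp_sub N (\<phi> F))" by (rule rhom_comp [OF rhom_hyp_sub assms(1)])
  fix F assume 0: "hyp_sub N (\<phi> F) = 0"
  have "poly (hyp_sub N G) 1 = G" for G :: "'a mpol"
    by (rule mpol_hom_eq [OF rhom_comp [OF rhom_poly rhom_hyp_sub] rhom_id]) (simp_all add: hyp_sub_def)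
  then have "\<phi> F = 0" using 0 by (metis poly_0)
  then show "F = 0" by (rule assms(2))
qed

context adapted_coordinates
begin

text \<open>
  If the span is a hyperplane, its local ring lies in the valuation ring of the order along this hyperplane
  and the maximal ideal in that of elements of positive order. This bounds the multiplicity from above.
\<close>
lemma multiplicity_along_hyperplane:
  assumes rest: "rest = {N}" and p: "\<forall>i\<in>I. p i \<in> biproj n"
    and F: "bihom n c d F" and e: "e \<in> keys (to_adapted F)"
    and a: "a1 \<in> block1 n" "a2 \<in> block2 n"
      "\<not> vanishes_on (pvar a1) (bilinear_span n p I)" "\<not> vanishes_on (pvar a2) (bilinear_span n p I)"
    and mem: "dehom F c d a1 a2 \<in>
       ideal_power (local_ring n (bilinear_span n p I)) (nonunits (local_ring n (bilinear_span n p I))) k"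
  shows "k \<le> lookup e N"
proof -
  let ?V = "bilinear_span n p I"
  note pl = span_prime_locus [OF p]
  interpret order_valuation "\<lambda>F. hyp_sub N (to_adapted F)"
    by (rule order_valuation_hyp_sub [OF rhom_to_adapted]) simp
  have span_restrict: "poly (hyp_sub N G) 0 = span_restrict G" for G :: "'a mpol"
    by (rule mpol_hom_eq [OF rhom_comp [OF rhom_poly rhom_hyp_sub] rhom_span_restrict])
       (simp_all add: hyp_sub_def rest rhom_mconst)
  have v0: "vord B = 0" if "bihom n k l B" "\<not> vanishes_on B ?V" for B k l
    using that vanishes_on_span_iff [OF that(1)] span_restrict [of "to_adapted B"] unfolding vord_def by (intro order_0I) simp
  have v1: "1 \<le> vord A" if "bihom n k l A" "vanishes_on A ?V" "A \<noteq> 0" for A k l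
  proof -
    have "poly (hyp_sub N (to_adapted A)) 0 = 0" using that vanishes_on_span_iff [OF that(1)] span_restrict by simp
    then have "tau ^ 1 dvd hyp_sub N (to_adapted A)" by (simp add: poly_eq_0_iff_dvd)
    then show ?thesis using vord_ge_iff [OF that(3)] by blast
  qed
  have R0: "local_ring n ?V \<subseteq> vge 0"
  proof
    fix x assume "x \<in> local_ring n ?V"
    then obtain A B k l where x: "x = Fract A B" "bihom n k l B" "\<not> vanishes_on B ?V" unfolding local_ring_iff by blast
    then show "x \<in> vge 0" using v0 [OF x(2,3)] not_vanishes_nonzero [OF x(3)] by (simp add: vge_Fract)
  qed
  have I1: "nonunits (local_ring n ?V) \<subseteq> vge 1"
  proof
    fix x assume "x \<in> nonunits (local_ring n ?V)"
    then obtain A B k l where x: "x = Fract A B" "bihom n k l A" "bihom n k l B" "vanishes_on A ?V" "\<not> vanishes_on B ?V"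
      by (rule nonunitsE [OF pl])
    then show "x \<in> vge 1"
      using v0 [OF x(3,5)] v1 [OF x(2,4)] not_vanishes_nonzero [OF x(5)] by (auto simp: vge_Fract)
  qed
  have va: "vord (pvar a1 ^ c * pvar a2 ^ d) = 0"
  proof -
    have "vord (pvar a1) = 0" "vord (pvar a2) = 0"
      using v0 [OF bihom_pvar1] v0 [OF bihom_pvar2] a by blast+
    moreover have "vord 1 = 0" using vord_mult [of 1 1] by simp
    then have "vord (P ^ j) = j * vord P" if "P \<noteq> 0" for P j
      by (induction j) (use that in \<open>simp_all add: vord_mult\<close>)
    ultimately show ?thesis by (simp add: vord_mult)
  qed
  have F0: "F \<noteq> 0" using e by (metis to_adapted_eq_0_iff keys_zero empty_iff)
  have "dehom F c d a1 a2 \<in> vge (int k)"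
    using vge_ideal_power [OF R0 I1] mem by blast
  then have "k \<le> vord F" using F0 by (simp add: vge_Fract va)
  then have "tau ^ k dvd hyp_sub N (to_adapted F)" using vord_ge_iff [OF F0] by blast
  then show ?thesis using e by (rule hyp_sub_exponent)
qed

end

section \<open>Multiplicities in the base locus\<close>

lemma general_position_independent:
  assumes "general_position n s p" "I \<subseteq> {1..s}"
  shows "card I \<le> n + 1 \<Longrightarrow> independent_in (block1 n) p I" "card I \<le> n + 2 \<Longrightarrow> independent_in (block2 n) p I"
  using assms unfolding general_position_def by blast+

text \<open>
  A span of at least two points contains, for each \<open>j\<close>, a point of \<open>I\<close> other than \<open>p j\<close>. So its generic point lies
  over none of the \<open>p j\<close>, and the exceptional divisors do not contribute to the local equation.
\<close>
lemma div_coset_span: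
  fixes p :: "nat \<Rightarrow> nat \<Rightarrow> 'a::field_char_0"
  assumes n: "n \<ge> 1" and gp: "general_position n s p" and I: "I \<subseteq> {1..s}" "2 \<le> card I" "card I \<le> n + 1"
  defines "V \<equiv> bilinear_span n p I"
  obtains a1 a2 where "a1 \<in> block1 n" "a2 \<in> block2 n" "\<not> vanishes_on (pvar a1) V" "\<not> vanishes_on (pvar a2) V"
    "prime_locus n V"
    "\<And>c d m F. section_div n s p m F c d (local_ring n V)
       = unit_coset (local_ring n V) (dehom F c d a1 a2)"
proof -
  have pb: "p j \<in> biproj n" if "j \<in> {1..s}" for j using gp that by (simp add: general_position_def)
  have finI: "finite I" using I(1) finite_subset by blast
  have ne: "I \<noteq> {}" using I(2) by auto
  have card2: "card I \<le> n + 2" using I(3) by simp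
  obtain s1 s2 B L where "adapted_coordinates n p I I s1 s2 B L"
    using adapted_coordinates_exist [OF finI order_refl ne general_position_independent(1) [OF gp I(1,3)]
        general_position_independent(2) [OF gp I(1) card2]] by blast
  then have pl: "prime_locus n V"
    unfolding V_def using adapted_coordinates.span_prime_locus pb I(1) by blast
  have pV: "p i \<in> V" if "i \<in> I" for i unfolding V_def using point_in_span [OF finI that] pb I(1) that by blast
  obtain i where i: "i \<in> I" using ne by blast
  then have "p i \<in> biproj n" using pb I(1) by blast
  then obtain a1 a2 where a: "a1 \<in> block1 n" "p i a1 \<noteq> 0" "a2 \<in> block2 n" "p i a2 \<noteq> 0" by (rule biproj_coords)
  have R: "subring_of (local_ring n V)" by (rule local_ring_subring [OF pl])
  have sub: "point_ring n (p j) \<subseteq> local_ring n V" if "j \<in> I" for j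
    by (rule local_ring_mono [OF pV [OF that]])
  have ex: "exceptional_div n (p j) (local_ring n V) = unit_set (local_ring n V)" if j: "j \<in> {1..s}" for j
  proof -
    have "\<exists>k\<in>I. k \<noteq> j"
    proof (rule ccontr)
      assume "\<not> (\<exists>k\<in>I. k \<noteq> j)"
      then have "I \<subseteq> {j}" by blast
      then have "card I \<le> 1" using card_mono [of "{j}" I] by simp
      then show False using I(2) by simp
    qed
    then obtain k where k: "k \<in> I" "k \<noteq> j" by blast
    then have ks: "k \<in> {1..s}" using I(1) by blast
    show ?thesis
      by (rule exceptional_div_away [OF sub [OF k(1)] pb [OF ks] pb [OF j] general_position_distinct [OF gp n ks j k(2)]])
  qed
  have nv: "\<not> vanishes_on (pvar a1) V" "\<not> vanishes_on (pvar a2) V"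
    using a pV [OF i] by (auto simp: vanishes_on_def)
  show thesis
    by (rule that [OF a(1,3) nv pl], rule section_div_coset_away [OF R sub [OF i] ex a]) assumption
qed

lemma le_div_mult: "D R \<subseteq> ideal_power R (nonunits R) k \<Longrightarrow> enat k \<le> div_mult R D"
  unfolding div_mult_def by (rule Sup_upper) blast

lemma div_mult_le: "(\<And>k. D R \<subseteq> ideal_power R (nonunits R) k \<Longrightarrow> k \<le> M) \<Longrightarrow> div_mult R D \<le> enat M"
  unfolding div_mult_def by (rule Sup_least) auto

lemma linear_systemE:
  fixes p :: "nat \<Rightarrow> nat \<Rightarrow> 'a :: {alg_closed_field, field_char_0}"
  assumes n: "n \<ge> 1" and gp: "general_position n s p"
    and D: "D \<in> linear_system n s p (blowup_div n s p d1 d2 m)"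
  obtains F c d where "bihom n c d F" "F \<noteq> 0" "d1 = int c" "d2 = int d"
    "D = section_div n s p m F c d"
    "\<forall>i\<in>{1..s}. tau ^ nat (m i) dvd theta (p i) F"
proof -
  obtain f where f: "D = add_principal (blowup_div n s p d1 d2 m) f" "f \<in> function_field n" "f \<noteq> 0"
      "effective_on (blowup n s p) (add_principal (blowup_div n s p d1 d2 m) f)"
    using D unfolding linear_system_def by blast
  have "\<forall>i\<in>{1..s}. p i \<in> biproj n" using gp by (simp add: general_position_def)
  from section_polynomial [OF n this f(2-4)] obtain F c d where
    F: "bihom n c d F" "F \<noteq> 0" "d1 = int c" "d2 = int d" "f = dehom F c d 0 (n + 1)" by blast
  have "\<forall>i\<in>{1..s}. tau ^ nat (m i) dvd theta (p i) F"
    using section_multiplicity [OF n gp _ F(1,2)] f(4) unfolding F(3,4,5) by blast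
  then show thesis using that F f(1) by metis
qed

text \<open>
  The polynomial of a member of the linear system satisfies the hypotheses of \<open>multiplicity_along_span\<close>, and the
  generic point of the span sees its dehomogenization as local equation.
\<close>
lemma span_in_base_locus:
  fixes p :: "nat \<Rightarrow> nat \<Rightarrow> 'a :: {alg_closed_field, field_char_0}"
  assumes n: "n \<ge> 1" and gp: "general_position n s p"
    and D: "D \<in> linear_system n s p (blowup_div n s p d1 d2 m)"
    and I: "I \<subseteq> {1..s}" "2 \<le> card I" "card I \<le> n + 1"
  shows "enat (nat (max 0 ((\<Sum>i\<in>I. m i) - (int (card I) - 1) * (d1 + d2))))
     \<le> div_mult (local_ring n (bilinear_span n p I)) D"
proof -
  let ?V = "bilinear_span n p I" and ?M = "nat ((\<Sum>i\<in>I. m i) - (int (card I) - 1) * (d1 + d2))"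
  let ?R = "local_ring n ?V"
  obtain F c d where F: "bihom n c d F" "F \<noteq> 0" "d1 = int c" "d2 = int d"
    "D = section_div n s p m F c d"
    "\<forall>i\<in>{1..s}. tau ^ nat (m i) dvd theta (p i) F"
    using linear_systemE [OF n gp D] by blast
  obtain a1 a2 where a: "a1 \<in> block1 n" "a2 \<in> block2 n" "\<not> vanishes_on (pvar a1) ?V" "\<not> vanishes_on (pvar a2) ?V"
    and pl: "prime_locus n ?V"
    and co: "\<And>c d m F. section_div n s p m F c d ?R
       = unit_coset ?R (dehom F c d a1 a2)"
    using div_coset_span [OF n gp I] by blast
  interpret ideal_in ?R "nonunits ?R" by (rule nonunits_ideal [OF pl])
  have finI: "finite I" using I(1) finite_subset by blast
  have ne: "I \<noteq> {}" using I(2) by auto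
  have pI: "\<forall>i\<in>I. p i \<in> biproj n" using gp I(1) by (auto simp: general_position_def)
  have mI: "\<forall>i\<in>I. tau ^ nat (m i) dvd theta (p i) F" using F(6) I(1) by blast
  have card2: "card I \<le> n + 2" using I(3) by simp
  have mem: "dehom F c d a1 a2 \<in> ideal_power ?R (nonunits ?R) ?M"
    using multiplicity_along_span [OF finI ne general_position_independent(1) [OF gp I(1,3)]
        general_position_independent(2) [OF gp I(1) card2] pI F(1) mI a]
    by (simp add: F)
  have "dehom F c d a1 a2 * u \<in> ideal_power ?R (nonunits ?R) ?M" if "u \<in> unit_set ?R" for u
    by (subst mult.commute) (rule ip_absorb [OF unit_setD(1) [OF that] mem])
  then have "D ?R \<subseteq> ideal_power ?R (nonunits ?R) ?M" unfolding F(5) co by blast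
  then have "enat ?M \<le> div_mult ?R D" by (rule le_div_mult)
  moreover have "nat (max 0 x) = nat x" for x :: int by simp
  ultimately show ?thesis by (simp only:)
qed

text \<open>
  Adapted coordinates with \<open>I\<close> a basis in the first block and all points independent in the second. A point
  outside \<open>I\<close> then projects to the \<open>N\<close>-th coordinate point of the second factor, where \<open>N\<close> is the one coordinate in \<open>rest\<close>. Start
  from any section and lower its exponent of \<open>N\<close>; the result is again the polynomial of an effective divisor.
\<close>
lemma base_multiplicity_attained:
  fixes p :: "nat \<Rightarrow> nat \<Rightarrow> 'a :: {alg_closed_field, field_char_0}"
  assumes n: "n \<ge> 1" and gp: "general_position n s p" and s: "s \<le> n + 2"
    and ne: "linear_system n s p (blowup_div n s p d1 d2 m) \<noteq> {}"
    and I: "I \<subseteq> {1..s}" "card I = n + 1"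
  shows "\<exists>D \<in> linear_system n s p (blowup_div n s p d1 d2 m).
     div_mult (local_ring n (bilinear_span n p I)) D \<le> enat (nat (max 0 ((\<Sum>i\<in>I. m i) - int n * (d1 + d2))))"
proof -
  let ?V = "bilinear_span n p I" and ?M = "max 0 ((\<Sum>i\<in>I. m i) - int n * (d1 + d2))"
  let ?R = "local_ring n ?V"
  obtain F c d where F: "bihom n c d F" "F \<noteq> 0" "d1 = int c" "d2 = int d"
    "\<forall>i\<in>{1..s}. tau ^ nat (m i) dvd theta (p i) F"
    using ne linear_systemE [OF n gp, of _ d1 d2 m] by blast
  have pb: "p j \<in> biproj n" if "j \<in> {1..s}" for j using gp that by (simp add: general_position_def)
  have card2: "card {1..s} \<le> n + 2" using s by simp
  have card1: "card I \<le> n + 1" using I(2) by simp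
  have Ine: "I \<noteq> {}" using I(2) by auto
  have finI: "finite I" using I(1) finite_subset by blast
  obtain s1 s2 B L where "adapted_coordinates n p I {1..s} s1 s2 B L"
    using adapted_coordinates_exist [OF _ I(1) Ine general_position_independent(1) [OF gp I(1) card1]
        general_position_independent(2) [OF gp order_refl card2]] by blast
  then interpret adapted_coordinates n p I "{1..s}" s1 s2 B L .
  have inj2': "inj_on s2 I" using inj2 I(1) inj_on_subset by blast
  have img1: "s1 ` I = block1 n"
    by (rule card_subset_eq) (use s1 inj1 I in \<open>auto simp: card_image card_block\<close>)
  have "card (block2 n - s2 ` I) = card (block2 n) - card (s2 ` I)"
    by (rule card_Diff_subset) (use finI s2 I in auto)
  then have "card (block2 n - s2 ` I) = 1" using inj2' I by (simp add: card_image card_block)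
  then obtain N where N: "block2 n - s2 ` I = {N}" by (rule card_1_singletonE)
  have Nb: "N \<in> block2 n" using N by blast
  have bij1: "bij_betw s1 I (block1 n)" using inj1 img1 by (simp add: bij_betw_def)
  have "s2 ` I = block2 n - {N}" using N s2 I(1) by blast
  then have bij2: "bij_betw s2 I (block2 n - {N})" using inj2' by (simp add: bij_betw_def)
  have rest: "rest = {N}" unfolding rest_def img1 N by simp
  let ?Q = "{1..s} - I" and ?P = "\<lambda>q. pt_adapted (p q)"
  have s2q: "s2 q = N" if "q \<in> ?Q" for q
  proof -
    have "s2 q \<notin> s2 ` I" using inj_onD [OF inj2, of q] that I(1) by blast
    then show ?thesis using N s2 that by blast
  qed
  let ?adm = "admissible n c d I s1 s2 m ?Q (\<lambda>q. nat (m q)) ?P"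
  have adm: "?adm (to_adapted F)"
    unfolding admissible_def
  proof (intro conjI ballI)
    show "bihom n c d (to_adapted F)" by (rule bihom_to_adapted [OF F(1)])
    show "int (lookup e (s1 i) + lookup e (s2 i)) + m i \<le> int (c + d)" if "i \<in> I" "e \<in> keys (to_adapted F)" for i e
      using monomial_bound_to_adapted [OF F(1) that(1) _ that(2), of "nat (m i)"] F(5) that I(1) by force
    show "tau ^ nat (m q) dvd theta (pt_adapted (p q)) (to_adapted F)" if "q \<in> ?Q" for q
      using F(5) that tau_dvd_theta_to_adapted by blast
  qed
  have "to_adapted F \<noteq> 0" using F by simp
  then obtain e where e: "e \<in> keys (to_adapted F)" by (metis keys_eq_empty ex_in_conv)
  have P0: "?P q j = 0" if "q \<in> ?Q" "j \<in> block2 n - {N}" for q j using that s2q pt_adapted_point2 [of q j] by auto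
  have PN: "?P q N \<noteq> 0" if "q \<in> ?Q" for q using that s2q pt_adapted_point2 [of q N] Nb by auto
  obtain G e where G: "?adm G" "e \<in> keys G" "int (lookup e N) \<le> max 0 ((\<Sum>i\<in>I. m i) - int n * int (c + d))"
    using lower_last_exponent [OF bij1 bij2 Nb P0 PN adm e] by blast
  define F0 where "F0 = of_adapted G"
  have F0: "bihom n c d F0" "to_adapted F0 = G" using G(1) by (auto simp: F0_def admissible_def intro: bihom_of_adapted)
  have F0n: "F0 \<noteq> 0" using G(2) F0(2) by (metis to_adapted_eq_0_iff keys_zero empty_iff)
  have mult: "tau ^ nat (m i) dvd theta (p i) F0" if i: "i \<in> {1..s}" for i
  proof (cases "i \<in> I")
    case True
    have ab: "s1 i \<in> block1 n" "s2 i \<in> block2 n" using True s1 s2 i by auto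
    have bG: "bihom n c d G" using G(1) by (simp add: admissible_def)
    have "tau ^ nat (m i) dvd theta (unit_point (s1 i) (s2 i)) G"
    proof (rule monomial_bound_converse [OF bG ab])
      fix e assume e: "e \<in> keys G"
      have "int (lookup e (s1 i) + lookup e (s2 i)) + m i \<le> int (c + d)" using G(1) True e by (simp add: admissible_def)
      moreover have "lookup e (s1 i) + lookup e (s2 i) \<le> c + d"
        using bideg_weight_unit_point [of n c d e, OF _ ab] bG e by (auto simp: bihom_iff)
      ultimately show "lookup e (s1 i) + lookup e (s2 i) + nat (m i) \<le> c + d" by linarith
    qed
    moreover have "theta (pt_adapted (p i)) G = theta (unit_point (s1 i) (s2 i)) G"
      using theta_cong_bihom [OF bG pt_adapted_point [OF True]] .
    ultimately have "tau ^ nat (m i) dvd theta (pt_adapted (p i)) (to_adapted F0)" using F0(2) by simp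
    then show ?thesis using tau_dvd_theta_to_adapted by blast
  next
    case False
    then have "tau ^ nat (m i) dvd theta (pt_adapted (p i)) (to_adapted F0)"
      using G(1) i F0(2) by (simp add: admissible_def)
    then show ?thesis using tau_dvd_theta_to_adapted by blast
  qed
  let ?f = "dehom F0 c d 0 (n + 1)"
  let ?D = "add_principal (blowup_div n s p (int c) (int d) m) ?f"
  have "?f \<in> function_field n"
  proof -
    have "bihom n c d (pvar 0 ^ c * pvar (n + 1) ^ d :: 'a mpol)" by (rule bihom_pvar_powers [OF idx_blocks])
    moreover have "pvar 0 ^ c * pvar (n + 1) ^ d \<noteq> (0 :: 'a mpol)" by simp
    ultimately show ?thesis unfolding function_field_def using F0(1) by blast
  qed
  moreover have "?f \<noteq> 0" using F0n by (simp add: Fract_eq_0_iff)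
  moreover have "effective_on (blowup n s p) ?D"
    using effective_if_multiplicities [OF n gp F0(1)] mult by blast
  ultimately have DL: "?D \<in> linear_system n s p (blowup_div n s p d1 d2 m)"
    unfolding linear_system_def F(3,4) by blast
  have I2: "2 \<le> card I" "card I \<le> n + 1" using I(2) n by auto
  obtain a1 a2 where a: "a1 \<in> block1 n" "a2 \<in> block2 n" "\<not> vanishes_on (pvar a1) ?V" "\<not> vanishes_on (pvar a2) ?V"
    and pl: "prime_locus n ?V"
    and co: "\<And>c d m F. section_div n s p m F c d ?R
       = unit_coset ?R (dehom F c d a1 a2)"
    using div_coset_span [OF n gp I(1) I2] by blast
  have "div_mult ?R ?D \<le> enat (lookup e N)"
  proof (rule div_mult_le)
    fix k assume "?D ?R \<subseteq> ideal_power ?R (nonunits ?R) k"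
    moreover have "dehom F0 c d a1 a2 \<in> ?D ?R"
      unfolding co using unit_set_1 [OF local_ring_subring [OF pl]] by force
    ultimately have mem: "dehom F0 c d a1 a2 \<in> ideal_power ?R (nonunits ?R) k" by blast
    have pI: "\<forall>i\<in>I. p i \<in> biproj n" using pb I(1) by blast
    have "e \<in> keys (to_adapted F0)" using G(2) F0(2) by simp
    from multiplicity_along_hyperplane [OF rest pI F0(1) this a mem] show "k \<le> lookup e N" .
  qed
  also have "enat (lookup e N) \<le> enat (nat ?M)" using G(3) F(3,4) by simp
  finally show ?thesis using DL by blast
qed

theorem proposition4p4:
  fixes n s :: nat
    and p :: "nat \<Rightarrow> nat \<Rightarrow> 'a :: {alg_closed_field, field_char_0}"
    and d1 d2 :: int and m :: "nat \<Rightarrow> int"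
  assumes "n \<ge> 1" and "s \<le> n + 3"
    and "general_position n s p"
    and effective: "linear_system n s p (blowup_div n s p d1 d2 m) \<noteq> {}"
  shows
    "(\<forall>k I. 2 \<le> k \<and> k \<le> n + 1 \<and> I \<subseteq> {1..s} \<and> card I = k \<longrightarrow>
        (\<forall>D \<in> linear_system n s p (blowup_div n s p d1 d2 m).
           div_mult (strict_transform_pt n (bilinear_span n p I)) D
             \<ge> enat (nat (max 0 ((\<Sum>i\<in>I. m i) - (int k - 1) * (d1 + d2))))))
     \<and>
     (n + 1 \<le> s \<and> s \<le> n + 2 \<longrightarrow>
       (\<forall>I. I \<subseteq> {1..s} \<and> card I = n + 1 \<longrightarrow>
          base_mult n s p (blowup_div n s p d1 d2 m) (strict_transform_pt n (bilinear_span n p I))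
            = enat (nat (max 0 ((\<Sum>i\<in>I. m i) - int n * (d1 + d2))))))"
proof (intro conjI allI impI ballI)
  fix k I D
  assume "2 \<le> k \<and> k \<le> n + 1 \<and> I \<subseteq> {1..s} \<and> card I = k"
    and D: "D \<in> linear_system n s p (blowup_div n s p d1 d2 m)"
  then show "div_mult (strict_transform_pt n (bilinear_span n p I)) D
             \<ge> enat (nat (max 0 ((\<Sum>i\<in>I. m i) - (int k - 1) * (d1 + d2))))"
    unfolding strict_transform_pt_def using span_in_base_locus [OF assms(1,3) D, of I] by blast
next
  fix I assume s: "n + 1 \<le> s \<and> s \<le> n + 2" and I: "I \<subseteq> {1..s} \<and> card I = n + 1"
  show "base_mult n s p (blowup_div n s p d1 d2 m) (strict_transform_pt n (bilinear_span n p I))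
            = enat (nat (max 0 ((\<Sum>i\<in>I. m i) - int n * (d1 + d2))))"
    unfolding base_mult_def strict_transform_pt_def
  proof (rule antisym)
    have s2: "s \<le> n + 2" using s by simp
    obtain D where D: "D \<in> linear_system n s p (blowup_div n s p d1 d2 m)"
        "div_mult (local_ring n (bilinear_span n p I)) D \<le> enat (nat (max 0 ((\<Sum>i\<in>I. m i) - int n * (d1 + d2))))"
      using base_multiplicity_attained [OF assms(1,3) s2 effective] I by blast
    show "(INF D'\<in>linear_system n s p (blowup_div n s p d1 d2 m). div_mult (local_ring n (bilinear_span n p I)) D')
        \<le> enat (nat (max 0 ((\<Sum>i\<in>I. m i) - int n * (d1 + d2))))"
      by (rule order_trans [OF INF_lower [OF D(1), of "div_mult (local_ring n (bilinear_span n p I))"] D(2)])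
  next
    have I2: "I \<subseteq> {1..s}" "2 \<le> card I" "card I \<le> n + 1" using I assms(1) by auto
    have "int (card I) - 1 = int n" using I by simp
    then show "enat (nat (max 0 ((\<Sum>i\<in>I. m i) - int n * (d1 + d2))))
       \<le> (INF D'\<in>linear_system n s p (blowup_div n s p d1 d2 m). div_mult (local_ring n (bilinear_span n p I)) D')"
      using span_in_base_locus [OF assms(1,3) _ I2, of _ d1 d2 m] by (intro INF_greatest) simp
  qed
qed

end
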